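(* Assume $G$ is amenable and let $\{F_i\}$ be a Følner net for $G$. Define $T^i:G\times A\to A$ by $T^i(g,a)=\frac{|gF_i\cap F_i|}{|F_i|}\,a$. Then $\{T^i\}$ is a Fourier summing net for $\Sigma$, each $T^i$ has finite $G$-support, and $|||T^i|||=1$ for every $i$. In particular, $\Sigma$ has the bounded Fejér property.
   Context: Standing setup. All C*-algebras are unital. A twisted (unital, discrete) C*-dynamical system is a quadruple $\Sigma=(A,G,\alpha,\sigma)$, where $A$ is a unital C*-algebra, $G$ a discrete group with identity $e$, $\alpha:G\to\mathrm{Aut}(A)$ and $\sigma:G\times G\to\mathcal U(A)$ satisfy $\alpha_g\alpha_h=\mathrm{Ad}(\sigma(g,h))\alpha_{gh}$, $\sigma(g,h)\sigma(gh,k)=\alpha_g(\sigma(h,k))\sigma(g,hk)$, $\sigma(g,e)=\sigma(e,g)=1$. Series converge unconditionally. Let $A^\Sigma$ be the set of $\xi:G\to A$ such that $\sum_g\alpha_g^{-1}(\xi(g)^*\xi(g))$ converges in norm; a right Hilbert $A$-module with $(\xi\times a)(g)=\xi(g)\alpha_g(a)$, $\langle\xi,\eta\rangle_\alpha=\sum_g\alpha_g^{-1}(\xi(g)^*\eta(g))$. $A$ acts by $(a\xi)(h)=a\xi(h)$, and $(\lambda_\Sigma(g)\xi)(h)=\alpha_g(\xi(g^{-1}h))\sigma(g,g^{-1}h)$. $C_r^*(\Sigma)$ is the C*-subalgebra of $\mathcal L(A^\Sigma)$ generated by $A$ and $\lambda_\Sigma(G)$, operator norm $\|\cdot\|$.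 $C_c(\Sigma)$: finitely supported $G\to A$, $\Lambda_\Sigma(f)=\sum_g f(g)\lambda_\Sigma(g)$. For $x\in C_r^*(\Sigma)$, $\hat x=x\xi_0$ with $\xi_0(e)=1$, $\xi_0(g)=0$ otherwise; its Fourier series is $\sum_g\hat x(g)\lambda_\Sigma(g)$. Multipliers and summation: for $T:G\times A\to A$ linear in the second variable write $T_g(a)=T(g,a)$, $(T\cdot f)(g)=T_g(f(g))$. $T\in MA(\Sigma)$ if there is a bounded linear $M_T:C_r^*(\Sigma)\to C_r^*(\Sigma)$ with $M_T(\Lambda_\Sigma(f))=\Lambda_\Sigma(T\cdot f)$ for all $f\in C_c(\Sigma)$; $|||T|||:=\|M_T\|$. $CF(\Sigma)$ is the set of $x$ whose Fourier series converges in operator norm; $MCF(\Sigma)=\{T\in MA(\Sigma)\mid M_T(x)\in CF(\Sigma)\ \forall x\}$. A Fourier summing net is a net $\{T^i\}$ in $MCF(\Sigma)$ with $\|M_{T^i}(x)-x\|\to0$ for all $x\in C_r^*(\Sigma)$; it is bounded if $\sup_i|||T^i|||<\infty$. $T$ has finite $G$-support if $T_g=0$ for all but finitely many $g$. $\Sigma$ has the bounded Fejér property if there is a bounded Fourier summing net for $\Sigma$ consisting of multipliers with finite $G$-support. A Følner net is a net of finite nonempty $F_i\subseteq G$ with $|gF_i\,\triangle\,F_i|/|F_i|\to0$ for all $g$. *)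

theory Defs
  imports "HOL-Analysis.Analysis"
begin

class unital_cstar = real_normed_algebra_1 + banach +
  fixes cscale :: "complex \<Rightarrow> 'a \<Rightarrow> 'a"
    and cstar :: "'a \<Rightarrow> 'a"
  assumes cscale_add_right: "cscale c (x + y) = cscale c x + cscale c y"
    and cscale_add_left: "cscale (c + d) x = cscale c x + cscale d x"
    and cscale_cscale: "cscale c (cscale d x) = cscale (c * d) x"
    and cscale_one: "cscale 1 x = x"
    and cscale_of_real: "cscale (complex_of_real r) x = scaleR r x"
    and cscale_left_mult: "cscale c (x * y) = cscale c x * y"
    and cscale_right_mult: "cscale c (x * y) = x * cscale c y"
    and norm_cscale: "norm (cscale c x) = cmod c * norm x"
    and cstar_cstar: "cstar (cstar x) = x"
    and cstar_add: "cstar (x + y) = cstar x + cstar y"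
    and cstar_mult: "cstar (x * y) = cstar y * cstar x"
    and cstar_cscale: "cstar (cscale c x) = cscale (cnj c) (cstar x)"
    and cstar_identity: "norm (cstar x * x) = (norm x)\<^sup>2"

definition unitary :: "'a::unital_cstar \<Rightarrow> bool" where
  "unitary u \<longleftrightarrow> cstar u * u = 1 \<and> u * cstar u = 1"

definition cstar_aut :: "('a::unital_cstar \<Rightarrow> 'a) \<Rightarrow> bool" where
  "cstar_aut \<phi> \<longleftrightarrow> bij \<phi> \<and> (\<forall>x y. \<phi> (x + y) = \<phi> x + \<phi> y) \<and> (\<forall>x y. \<phi> (x * y) = \<phi> x * \<phi> y)
     \<and> (\<forall>c x. \<phi> (cscale c x) = cscale c (\<phi> x)) \<and> (\<forall>x. \<phi> (cstar x) = cstar (\<phi> x))"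

text \<open>The discrete group G is a type of class group_add (written additively:
identity 0, product g + h, inverse - g; not assumed commutative).\<close>

definition twisted_system :: "('g::group_add \<Rightarrow> 'a::unital_cstar \<Rightarrow> 'a) \<Rightarrow> ('g \<Rightarrow> 'g \<Rightarrow> 'a) \<Rightarrow> bool" where
  "twisted_system \<alpha> \<sigma> \<longleftrightarrow>
     (\<forall>g. cstar_aut (\<alpha> g)) \<and> (\<forall>g h. unitary (\<sigma> g h))
     \<and> (\<forall>g h a. \<alpha> g (\<alpha> h a) = \<sigma> g h * \<alpha> (g + h) a * cstar (\<sigma> g h))
     \<and> (\<forall>g h k. \<sigma> g h * \<sigma> (g + h) k = \<alpha> g (\<sigma> h k) * \<sigma> g (h + k))
     \<and> (\<forall>g. \<sigma> g 0 = 1 \<and> \<sigma> 0 g = 1)"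

definition modset :: "('g \<Rightarrow> 'a::unital_cstar \<Rightarrow> 'a) \<Rightarrow> ('g \<Rightarrow> 'a) set" where
  "modset \<alpha> = {\<xi>. (\<lambda>g. inv (\<alpha> g) (cstar (\<xi> g) * \<xi> g)) summable_on UNIV}"

definition minner :: "('g \<Rightarrow> 'a::unital_cstar \<Rightarrow> 'a) \<Rightarrow> ('g \<Rightarrow> 'a) \<Rightarrow> ('g \<Rightarrow> 'a) \<Rightarrow> 'a" where
  "minner \<alpha> \<xi> \<eta> = infsum (\<lambda>g. inv (\<alpha> g) (cstar (\<xi> g) * \<eta> g)) UNIV"

definition mnorm :: "('g \<Rightarrow> 'a::unital_cstar \<Rightarrow> 'a) \<Rightarrow> ('g \<Rightarrow> 'a) \<Rightarrow> real" where
  "mnorm \<alpha> \<xi> = sqrt (norm (minner \<alpha> \<xi> \<xi>))"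

text \<open>Operators on A^Sigma are represented by functions that vanish outside A^Sigma.\<close>

definition op_ext :: "('g \<Rightarrow> 'a::unital_cstar \<Rightarrow> 'a) \<Rightarrow> (('g \<Rightarrow> 'a) \<Rightarrow> ('g \<Rightarrow> 'a)) \<Rightarrow> bool" where
  "op_ext \<alpha> T \<longleftrightarrow> (\<forall>\<xi>. \<xi> \<notin> modset \<alpha> \<longrightarrow> T \<xi> = (\<lambda>_. 0))"

definition is_adjoint_of :: "('g \<Rightarrow> 'a::unital_cstar \<Rightarrow> 'a) \<Rightarrow> (('g \<Rightarrow> 'a) \<Rightarrow> ('g \<Rightarrow> 'a)) \<Rightarrow> (('g \<Rightarrow> 'a) \<Rightarrow> ('g \<Rightarrow> 'a)) \<Rightarrow> bool" where
  "is_adjoint_of \<alpha> S T \<longleftrightarrow> (\<forall>\<eta>\<in>modset \<alpha>. S \<eta> \<in> modset \<alpha>)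
     \<and> (\<forall>\<xi>\<in>modset \<alpha>. \<forall>\<eta>\<in>modset \<alpha>. minner \<alpha> (T \<xi>) \<eta> = minner \<alpha> \<xi> (S \<eta>))"

definition adjointable :: "('g \<Rightarrow> 'a::unital_cstar \<Rightarrow> 'a) \<Rightarrow> (('g \<Rightarrow> 'a) \<Rightarrow> ('g \<Rightarrow> 'a)) \<Rightarrow> bool" where
  "adjointable \<alpha> T \<longleftrightarrow> op_ext \<alpha> T \<and> (\<forall>\<xi>\<in>modset \<alpha>. T \<xi> \<in> modset \<alpha>) \<and> (\<exists>S. is_adjoint_of \<alpha> S T)"

definition opnorm :: "('g \<Rightarrow> 'a::unital_cstar \<Rightarrow> 'a) \<Rightarrow> (('g \<Rightarrow> 'a) \<Rightarrow> ('g \<Rightarrow> 'a)) \<Rightarrow> real" where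
  "opnorm \<alpha> T = Sup ((\<lambda>\<xi>. mnorm \<alpha> (T \<xi>)) ` {\<xi>\<in>modset \<alpha>. mnorm \<alpha> \<xi> \<le> 1})"

definition op_add :: "(('g \<Rightarrow> 'a::unital_cstar) \<Rightarrow> ('g \<Rightarrow> 'a)) \<Rightarrow> (('g \<Rightarrow> 'a) \<Rightarrow> ('g \<Rightarrow> 'a)) \<Rightarrow> ('g \<Rightarrow> 'a) \<Rightarrow> ('g \<Rightarrow> 'a)" where
  "op_add T S = (\<lambda>\<xi> h. T \<xi> h + S \<xi> h)"

definition op_diff :: "(('g \<Rightarrow> 'a::unital_cstar) \<Rightarrow> ('g \<Rightarrow> 'a)) \<Rightarrow> (('g \<Rightarrow> 'a) \<Rightarrow> ('g \<Rightarrow> 'a)) \<Rightarrow> ('g \<Rightarrow> 'a) \<Rightarrow> ('g \<Rightarrow> 'a)" where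
  "op_diff T S = (\<lambda>\<xi> h. T \<xi> h - S \<xi> h)"

definition op_scale :: "complex \<Rightarrow> (('g \<Rightarrow> 'a::unital_cstar) \<Rightarrow> ('g \<Rightarrow> 'a)) \<Rightarrow> ('g \<Rightarrow> 'a) \<Rightarrow> ('g \<Rightarrow> 'a)" where
  "op_scale c T = (\<lambda>\<xi> h. cscale c (T \<xi> h))"

definition lmult :: "('g \<Rightarrow> 'a::unital_cstar \<Rightarrow> 'a) \<Rightarrow> 'a \<Rightarrow> ('g \<Rightarrow> 'a) \<Rightarrow> ('g \<Rightarrow> 'a)" where
  "lmult \<alpha> a \<xi> = (if \<xi> \<in> modset \<alpha> then (\<lambda>h. a * \<xi> h) else (\<lambda>_. 0))"

definition lamb :: "('g::group_add \<Rightarrow> 'a::unital_cstar \<Rightarrow> 'a) \<Rightarrow> ('g \<Rightarrow> 'g \<Rightarrow> 'a) \<Rightarrow> 'g \<Rightarrow> ('g \<Rightarrow> 'a) \<Rightarrow> ('g \<Rightarrow> 'a)" where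
  "lamb \<alpha> \<sigma> g \<xi> = (if \<xi> \<in> modset \<alpha> then (\<lambda>h. \<alpha> g (\<xi> (- g + h)) * \<sigma> g (- g + h)) else (\<lambda>_. 0))"

inductive_set cred :: "('g::group_add \<Rightarrow> 'a::unital_cstar \<Rightarrow> 'a) \<Rightarrow> ('g \<Rightarrow> 'g \<Rightarrow> 'a) \<Rightarrow> (('g \<Rightarrow> 'a) \<Rightarrow> ('g \<Rightarrow> 'a)) set"
  for \<alpha> \<sigma> where
  gen_A: "lmult \<alpha> a \<in> cred \<alpha> \<sigma>"
| gen_lamb: "lamb \<alpha> \<sigma> g \<in> cred \<alpha> \<sigma>"
| add: "T \<in> cred \<alpha> \<sigma> \<Longrightarrow> S \<in> cred \<alpha> \<sigma> \<Longrightarrow> op_add T S \<in> cred \<alpha> \<sigma>"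
| scale: "T \<in> cred \<alpha> \<sigma> \<Longrightarrow> op_scale c T \<in> cred \<alpha> \<sigma>"
| comp: "T \<in> cred \<alpha> \<sigma> \<Longrightarrow> S \<in> cred \<alpha> \<sigma> \<Longrightarrow> T \<circ> S \<in> cred \<alpha> \<sigma>"
| adj: "T \<in> cred \<alpha> \<sigma> \<Longrightarrow> adjointable \<alpha> S \<Longrightarrow> is_adjoint_of \<alpha> S T \<Longrightarrow> S \<in> cred \<alpha> \<sigma>"
| lim: "(\<And>n. X n \<in> cred \<alpha> \<sigma>) \<Longrightarrow> adjointable \<alpha> T
        \<Longrightarrow> (\<lambda>n. opnorm \<alpha> (op_diff (X n) T)) \<longlonglongrightarrow> 0 \<Longrightarrow> T \<in> cred \<alpha> \<sigma>"

definition cc_fun :: "('g \<Rightarrow> 'a::zero) \<Rightarrow> bool" where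
  "cc_fun f \<longleftrightarrow> finite {g. f g \<noteq> 0}"

definition Lam :: "('g::group_add \<Rightarrow> 'a::unital_cstar \<Rightarrow> 'a) \<Rightarrow> ('g \<Rightarrow> 'g \<Rightarrow> 'a) \<Rightarrow> ('g \<Rightarrow> 'a) \<Rightarrow> ('g \<Rightarrow> 'a) \<Rightarrow> ('g \<Rightarrow> 'a)" where
  "Lam \<alpha> \<sigma> f = (\<lambda>\<xi> h. \<Sum>g\<in>{g. f g \<noteq> 0}. lmult \<alpha> (f g) (lamb \<alpha> \<sigma> g \<xi>) h)"

definition xi0 :: "'g::group_add \<Rightarrow> 'a::unital_cstar" where
  "xi0 = (\<lambda>g. if g = 0 then 1 else 0)"

definition fourier :: "(('g::group_add \<Rightarrow> 'a::unital_cstar) \<Rightarrow> ('g \<Rightarrow> 'a)) \<Rightarrow> 'g \<Rightarrow> 'a" where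
  "fourier x = x xi0"

definition CF :: "('g::group_add \<Rightarrow> 'a::unital_cstar \<Rightarrow> 'a) \<Rightarrow> ('g \<Rightarrow> 'g \<Rightarrow> 'a) \<Rightarrow> (('g \<Rightarrow> 'a) \<Rightarrow> ('g \<Rightarrow> 'a)) set" where
  "CF \<alpha> \<sigma> = {x \<in> cred \<alpha> \<sigma>. \<exists>y. adjointable \<alpha> y \<and>
      (\<forall>\<epsilon>>0. \<exists>F0. finite F0 \<and> (\<forall>F. finite F \<and> F0 \<subseteq> F \<longrightarrow>
         opnorm \<alpha> (op_diff (Lam \<alpha> \<sigma> (\<lambda>g. if g \<in> F then fourier x g else 0)) y) < \<epsilon>))}"

definition Tdot :: "('g \<Rightarrow> 'a \<Rightarrow> 'a) \<Rightarrow> ('g \<Rightarrow> 'a) \<Rightarrow> ('g \<Rightarrow> 'a)" where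
  "Tdot T f = (\<lambda>g. T g (f g))"

definition is_mult_map :: "('g::group_add \<Rightarrow> 'a::unital_cstar \<Rightarrow> 'a) \<Rightarrow> ('g \<Rightarrow> 'g \<Rightarrow> 'a) \<Rightarrow> ('g \<Rightarrow> 'a \<Rightarrow> 'a)
     \<Rightarrow> ((('g \<Rightarrow> 'a) \<Rightarrow> ('g \<Rightarrow> 'a)) \<Rightarrow> (('g \<Rightarrow> 'a) \<Rightarrow> ('g \<Rightarrow> 'a))) \<Rightarrow> bool" where
  "is_mult_map \<alpha> \<sigma> T M \<longleftrightarrow>
     (\<forall>x\<in>cred \<alpha> \<sigma>. M x \<in> cred \<alpha> \<sigma>)
     \<and> (\<forall>x\<in>cred \<alpha> \<sigma>. \<forall>y\<in>cred \<alpha> \<sigma>. M (op_add x y) = op_add (M x) (M y))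
     \<and> (\<forall>c. \<forall>x\<in>cred \<alpha> \<sigma>. M (op_scale c x) = op_scale c (M x))
     \<and> (\<exists>K. \<forall>x\<in>cred \<alpha> \<sigma>. opnorm \<alpha> (M x) \<le> K * opnorm \<alpha> x)
     \<and> (\<forall>f. cc_fun f \<longrightarrow> M (Lam \<alpha> \<sigma> f) = Lam \<alpha> \<sigma> (Tdot T f))"

definition MA :: "('g::group_add \<Rightarrow> 'a::unital_cstar \<Rightarrow> 'a) \<Rightarrow> ('g \<Rightarrow> 'g \<Rightarrow> 'a) \<Rightarrow> ('g \<Rightarrow> 'a \<Rightarrow> 'a) set" where
  "MA \<alpha> \<sigma> = {T. (\<forall>g x y. T g (x + y) = T g x + T g y) \<and> (\<forall>g c x. T g (cscale c x) = cscale c (T g x))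
                 \<and> (\<exists>M. is_mult_map \<alpha> \<sigma> T M)}"

definition M_T :: "('g::group_add \<Rightarrow> 'a::unital_cstar \<Rightarrow> 'a) \<Rightarrow> ('g \<Rightarrow> 'g \<Rightarrow> 'a) \<Rightarrow> ('g \<Rightarrow> 'a \<Rightarrow> 'a)
     \<Rightarrow> (('g \<Rightarrow> 'a) \<Rightarrow> ('g \<Rightarrow> 'a)) \<Rightarrow> (('g \<Rightarrow> 'a) \<Rightarrow> ('g \<Rightarrow> 'a))" where
  "M_T \<alpha> \<sigma> T = (SOME M. is_mult_map \<alpha> \<sigma> T M)"

definition tnorm :: "('g::group_add \<Rightarrow> 'a::unital_cstar \<Rightarrow> 'a) \<Rightarrow> ('g \<Rightarrow> 'g \<Rightarrow> 'a) \<Rightarrow> ('g \<Rightarrow> 'a \<Rightarrow> 'a) \<Rightarrow> real" where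
  "tnorm \<alpha> \<sigma> T = Sup ((\<lambda>x. opnorm \<alpha> (M_T \<alpha> \<sigma> T x)) ` {x \<in> cred \<alpha> \<sigma>. opnorm \<alpha> x \<le> 1})"

definition MCF :: "('g::group_add \<Rightarrow> 'a::unital_cstar \<Rightarrow> 'a) \<Rightarrow> ('g \<Rightarrow> 'g \<Rightarrow> 'a) \<Rightarrow> ('g \<Rightarrow> 'a \<Rightarrow> 'a) set" where
  "MCF \<alpha> \<sigma> = {T \<in> MA \<alpha> \<sigma>. \<forall>x\<in>cred \<alpha> \<sigma>. M_T \<alpha> \<sigma> T x \<in> CF \<alpha> \<sigma>}"

definition finite_G_support :: "('g \<Rightarrow> 'a::zero \<Rightarrow> 'a) \<Rightarrow> bool" where
  "finite_G_support T \<longleftrightarrow> finite {g. T g \<noteq> (\<lambda>_. 0)}"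

text \<open>A net is indexed by a type 'i carrying a directed preorder le.\<close>
definition directed :: "('i \<Rightarrow> 'i \<Rightarrow> bool) \<Rightarrow> bool" where
  "directed le \<longleftrightarrow> (\<forall>i. le i i) \<and> (\<forall>i j k. le i j \<longrightarrow> le j k \<longrightarrow> le i k) \<and> (\<forall>i j. \<exists>k. le i k \<and> le j k)"

definition net_tendsto0 :: "('i \<Rightarrow> 'i \<Rightarrow> bool) \<Rightarrow> ('i \<Rightarrow> real) \<Rightarrow> bool" where
  "net_tendsto0 le r \<longleftrightarrow> (\<forall>\<epsilon>>0. \<exists>i0. \<forall>i. le i0 i \<longrightarrow> \<bar>r i\<bar> < \<epsilon>)"

definition fourier_summing_net :: "('g::group_add \<Rightarrow> 'a::unital_cstar \<Rightarrow> 'a) \<Rightarrow> ('g \<Rightarrow> 'g \<Rightarrow> 'a)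
     \<Rightarrow> ('i \<Rightarrow> 'i \<Rightarrow> bool) \<Rightarrow> ('i \<Rightarrow> 'g \<Rightarrow> 'a \<Rightarrow> 'a) \<Rightarrow> bool" where
  "fourier_summing_net \<alpha> \<sigma> le T \<longleftrightarrow> directed le \<and> (\<forall>i. T i \<in> MCF \<alpha> \<sigma>)
     \<and> (\<forall>x\<in>cred \<alpha> \<sigma>. net_tendsto0 le (\<lambda>i. opnorm \<alpha> (op_diff (M_T \<alpha> \<sigma> (T i) x) x)))"

definition bounded_mult_net :: "('g::group_add \<Rightarrow> 'a::unital_cstar \<Rightarrow> 'a) \<Rightarrow> ('g \<Rightarrow> 'g \<Rightarrow> 'a)
     \<Rightarrow> ('i \<Rightarrow> 'g \<Rightarrow> 'a \<Rightarrow> 'a) \<Rightarrow> bool" where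
  "bounded_mult_net \<alpha> \<sigma> T \<longleftrightarrow> (\<exists>B. \<forall>i. tnorm \<alpha> \<sigma> (T i) \<le> B)"

definition bounded_fejer :: "'i itself \<Rightarrow> ('g::group_add \<Rightarrow> 'a::unital_cstar \<Rightarrow> 'a) \<Rightarrow> ('g \<Rightarrow> 'g \<Rightarrow> 'a) \<Rightarrow> bool" where
  "bounded_fejer _ \<alpha> \<sigma> \<longleftrightarrow> (\<exists>(le::'i \<Rightarrow> 'i \<Rightarrow> bool) T. fourier_summing_net \<alpha> \<sigma> le T
       \<and> bounded_mult_net \<alpha> \<sigma> T \<and> (\<forall>i. finite_G_support (T i)))"

definition amenable_group :: "'g::group_add itself \<Rightarrow> bool" where
  "amenable_group _ \<longleftrightarrow> (\<exists>m :: ('g \<Rightarrow> real) \<Rightarrow> real.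
     (\<forall>f h. bdd_above (range (\<lambda>x. \<bar>f x\<bar>)) \<longrightarrow> bdd_above (range (\<lambda>x. \<bar>h x\<bar>)) \<longrightarrow>
        m (\<lambda>x. f x + h x) = m f + m h)
     \<and> (\<forall>c f. bdd_above (range (\<lambda>x. \<bar>f x\<bar>)) \<longrightarrow> m (\<lambda>x. c * f x) = c * m f)
     \<and> (\<forall>f. bdd_above (range f) \<longrightarrow> (\<forall>x. f x \<ge> 0) \<longrightarrow> m f \<ge> 0)
     \<and> m (\<lambda>_. 1) = 1
     \<and> (\<forall>f g. bdd_above (range (\<lambda>x. \<bar>f x\<bar>)) \<longrightarrow> m (\<lambda>x. f (- g + x)) = m f))"

definition folner_net :: "('i \<Rightarrow> 'i \<Rightarrow> bool) \<Rightarrow> ('i \<Rightarrow> 'g::group_add set) \<Rightarrow> bool" where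
  "folner_net le F \<longleftrightarrow> directed le \<and> (\<forall>i. finite (F i) \<and> F i \<noteq> {})
     \<and> (\<forall>g. net_tendsto0 le (\<lambda>i. real (card ((((+) g) ` F i - F i) \<union> (F i - ((+) g) ` F i)))
                                   / real (card (F i))))"

end

theory Submission
  imports Defs
begin

text \<open>The Hilbert module is isomorphic to the standard module of square-summable families via
  \<open>\<xi> g \<mapsto> \<alpha>\<^sub>g\<^sup>-\<^sup>1 (\<xi> g)\<close>. Its theory rests on positivity of \<open>a\<^sup>* a\<close>, which is derived from the C*-identity with the
  binomial series for the square root in place of a functional calculus. An adjointable \<open>x\<close> satisfies
  \<open>\<langle>x \<xi>, x \<xi>\<rangle> \<le> \<parallel>x\<parallel>\<^sup>2 \<langle>\<xi>, \<xi>\<rangle>\<close>, so by Cauchy--Schwarz the average of the compressions of \<open>x\<close> to the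
  translates \<open>{h. h + k \<in> F}\<close> is a contraction in \<open>x\<close>; on finitely supported elements it multiplies the \<open>g\<close>-th
  coefficient by \<open>card (gF \<inter> F) / card F\<close>. Finitely supported elements are dense in the reduced crossed product, so
  contractivity passes to all of it, and convergence only has to be checked on finitely supported elements, where it is
  the Foelner condition.\<close>

text \<open>The coefficient \<open>card (gF \<inter> F) / card F\<close> is the matrix coefficient
  of left translation by g at the normalised indicator of F, which is why contractivity is to be
  expected. The compressions use right translates because these commute with left translation: the
  entry of x leading from \<open>- g + h\<close> to \<open>h\<close> survives the k-th compression
  exactly when \<open>h + k\<close> and \<open>- g + h + k\<close> both lie in F, and the number of
  such k depends on g alone. The main obstacle is that scalar norms lose too much. The norm of a sum
  of A-valued squares can be far below the sum of their norms, so overlapping compressions can only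
  be counted in the order of A. This is the reason for an A-valued bound on
  \<open>\<langle>x \<xi>, x \<xi>\<rangle>\<close>, and for building the order of A from scratch. A
  second obstacle is that the definition of an adjointable operator contains no bound and
  \<open>opnorm\<close> is a bare supremum: boundedness has to be proved before
  \<open>opnorm\<close> yields any estimate.\<close>

section \<open>Involution and complex scalars\<close>

lemma cstar_zero [simp]: "cstar (0::'a::unital_cstar) = 0"
  using cstar_add[of "0::'a" 0] by simp

lemma cstar_minus [simp]: "cstar (- x) = - cstar (x::'a::unital_cstar)"
  using cstar_add[of x "- x"] minus_unique[of "cstar x" "cstar (- x)"] by simp

lemma cstar_diff: "cstar (x - y) = cstar x - cstar (y::'a::unital_cstar)"
  using cstar_add[of x "- y"] by simp

lemma cstar_one [simp]: "cstar (1::'a::unital_cstar) = 1"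
  by (metis cstar_cstar cstar_mult mult.right_neutral mult_1)

lemma cstar_scaleR [simp]: "cstar (r *\<^sub>R x) = r *\<^sub>R cstar (x::'a::unital_cstar)"
  by (metis cscale_of_real cstar_cscale complex_cnj_complex_of_real)

lemma cstar_of_real [simp]: "cstar (of_real r :: 'a::unital_cstar) = of_real r"
  by (simp add: of_real_def)

lemma cstar_sum: "cstar (\<Sum>i\<in>S. f i) = (\<Sum>i\<in>S. cstar (f i :: 'a::unital_cstar))"
  by (induction S rule: infinite_finite_induct) (auto simp: cstar_add)

lemma cstar_power: "cstar (x ^ n) = cstar (x::'a::unital_cstar) ^ n"
  by (induction n) (auto simp: cstar_mult power_commutes)

lemma norm_cstar [simp]: "norm (cstar x) = norm (x::'a::unital_cstar)"
proof -
  have le: "norm y \<le> norm (cstar y)" for y :: 'a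
  proof (cases "y = 0")
    case False
    have "norm y * norm y \<le> norm (cstar y) * norm y"
      by (metis cstar_identity norm_mult_ineq power2_eq_square)
    then show ?thesis using False by simp
  qed simp
  from le[of x] le[of "cstar x"] show ?thesis by (simp add: cstar_cstar)
qed

lemma bounded_linear_cstar: "bounded_linear (cstar :: 'a::unital_cstar \<Rightarrow> 'a)"
  by (rule bounded_linear_intro[where K=1]) (auto simp: cstar_add)

lemma cscale_zero_right [simp]: "cscale c (0::'a::unital_cstar) = 0"
  using cscale_add_right[of c "0::'a" 0] by simp

lemma cscale_minus_right: "cscale c (- x) = - cscale c (x::'a::unital_cstar)"
  using cscale_add_right[of c x "- x"] minus_unique[of "cscale c x" "cscale c (- x)"] by simp

lemma cscale_minus_one: "cscale (- 1) x = - (x::'a::unital_cstar)"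
  using cscale_of_real[of "-1" x] by simp

lemma cscale_minus_left: "cscale (- c) x = - cscale c (x::'a::unital_cstar)"
  using cscale_cscale[of "- 1" c x] by (simp add: cscale_minus_one)

lemma cscale_ii_ii: "cscale \<i> (cscale \<i> x) = - (x::'a::unital_cstar)"
  by (simp add: cscale_cscale cscale_minus_one)

lemma norm_square_selfadjoint:
  "cstar k = k \<Longrightarrow> norm (k * k) = (norm (k::'a::unital_cstar))\<^sup>2"
  using cstar_identity[of k] by simp

subsection \<open>Square roots\<close>

text \<open>Taylor coefficients of sqrt(1 - x) at 0.\<close>

definition sqrt_coeff :: "nat \<Rightarrow> real" where
  "sqrt_coeff n = (1/2 gchoose n) * (- 1) ^ n"

lemma sqrt_coeff_0 [simp]: "sqrt_coeff 0 = 1"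
  by (simp add: sqrt_coeff_def)

lemma sqrt_coeff_Suc: "sqrt_coeff (Suc n) = sqrt_coeff n * ((real n - 1/2) / (real n + 1))"
proof -
  have *: "(1/2 gchoose Suc n :: real) = (1/2 gchoose n) * - ((real n - 1/2) / (real n + 1))"
    using gbinomial_mult_1[of "1/2::real" n] by (simp add: field_simps)
  show ?thesis unfolding sqrt_coeff_def * by simp
qed

lemma sqrt_coeff_Suc_nonpos: "sqrt_coeff (Suc n) \<le> 0"
proof (induction n)
  case (Suc n)
  have "(real (Suc n) - 1/2) / (real (Suc n) + 1) \<ge> 0" by simp
  with Suc show ?case by (subst sqrt_coeff_Suc) (rule mult_nonpos_nonneg)
qed (simp add: sqrt_coeff_Suc)

text \<open>By the alternating summation formula for generalised binomials these numbers are exactly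
  the partial sums of \<open>sqrt_coeff\<close>; their sign bounds those sums from below.\<close>

lemma minus_half_gchoose_nonneg: "(- 1) ^ m * (- 1/2 gchoose m :: real) \<ge> 0"
proof (induction m)
  case (Suc m)
  have *: "(- 1/2 gchoose Suc m :: real) = (- 1/2 gchoose m) * - ((real m + 1/2) / (real m + 1))"
    using gbinomial_mult_1[of "-1/2::real" m] by (simp add: field_simps)
  have "(- 1) ^ Suc m * (- 1/2 gchoose Suc m :: real)
      = ((- 1) ^ m * (- 1/2 gchoose m)) * ((real m + 1/2) / (real m + 1))"
    unfolding * by simp
  with Suc show ?case by simp
qed simp

text \<open>Every coefficient after the first is nonpositive, so the absolute sum is 1 minus a
  partial sum of the whole series, and those partial sums are nonnegative. The sharp constant 1
  later places the square root within distance 1 of the identity.\<close>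

lemma sum_abs_sqrt_coeff: "(\<Sum>n<m. \<bar>sqrt_coeff (Suc n)\<bar>) \<le> 1"
proof -
  have "(\<Sum>n<m. \<bar>sqrt_coeff (Suc n)\<bar>) = 1 - (\<Sum>k\<le>m. sqrt_coeff k)"
    using sqrt_coeff_Suc_nonpos by (simp add: sum.atMost_shift sum_negf)
  also have "(\<Sum>k\<le>m. sqrt_coeff k) = (- 1) ^ m * (1/2 - 1 gchoose m)"
    unfolding sqrt_coeff_def by (rule gbinomial_sum_lower_neg)
  finally show ?thesis using minus_half_gchoose_nonneg[of m] by simp
qed

lemma summable_abs_sqrt_coeff: "summable (\<lambda>n. \<bar>sqrt_coeff n\<bar>)"
proof -
  have "summable (\<lambda>n. \<bar>sqrt_coeff (Suc n)\<bar>)"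
    by (rule summableI_nonneg_bounded[of _ 1]) (auto simp: sum_abs_sqrt_coeff)
  then show ?thesis by (subst (asm) summable_Suc_iff)
qed

text \<open>Vandermonde with 1/2 + 1/2 = 1: squaring the series gives the binomial series of
  exponent 1, that is 1 - x.\<close>

lemma sqrt_coeff_convolution:
  "(\<Sum>i\<le>k. sqrt_coeff i * sqrt_coeff (k - i)) = (if k = 0 then 1 else if k = 1 then - 1 else 0)"
proof -
  have "(\<Sum>i\<le>k. sqrt_coeff i * sqrt_coeff (k - i))
      = (\<Sum>i=0..k. (1/2 gchoose i) * (1/2 gchoose (k - i))) * (- 1) ^ k"
    unfolding sum_distrib_right atMost_atLeast0
    by (rule sum.cong) (auto simp: sqrt_coeff_def simp flip: power_add)
  also have "(\<Sum>i=0..k. (1/2 gchoose i) * (1/2 gchoose (k - i))) = (1 gchoose k :: real)"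
    using gbinomial_Vandermonde[of "1/2::real" "1/2" k] by simp
  also have "(1 gchoose k :: real) = of_nat (1 choose k)"
    using binomial_gbinomial[of 1 k, where 'a=real] by simp
  finally show ?thesis
    by (cases k) (auto simp: binomial_eq_0)
qed

text \<open>Absolute summability of the coefficients makes the series converge on the closed unit
  ball, including norm 1, where non-invertible positive elements end up after scaling. The
  commutation clause is inherited from the powers of x and stands in for the fact that a functional
  calculus stays in the bicommutant.\<close>

lemma one_minus_sqrt:
  fixes x :: "'a::unital_cstar"
  assumes "cstar x = x" "norm x \<le> 1"
  obtains s where "cstar s = s" "s * s = 1 - x" "norm (1 - s) \<le> 1"
    "\<And>y. y * x = x * y \<Longrightarrow> y * s = s * y"
proof -
  define t where "t n = sqrt_coeff n *\<^sub>R x ^ n" for n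
  have nt: "norm (t n) \<le> \<bar>sqrt_coeff n\<bar>" for n
  proof -
    have "norm (x ^ n) \<le> 1"
      using norm_power_ineq[of x n] power_le_one[OF norm_ge_zero assms(2), of n] by linarith
    then show ?thesis by (simp add: t_def mult_left_le)
  qed
  have snt: "summable (\<lambda>n. norm (t n))"
    by (rule summable_comparison_test'[OF summable_abs_sqrt_coeff]) (use nt in auto)
  have st: "summable t" by (rule summable_norm_cancel[OF snt])
  define s where "s = suminf t"
  show ?thesis
  proof
    have "cstar s = (\<Sum>n. cstar (t n))"
      unfolding s_def by (rule bounded_linear.suminf[OF bounded_linear_cstar st])
    moreover have "cstar (t n) = t n" for n by (simp add: t_def cstar_power assms(1))
    ultimately show "cstar s = s" by (simp add: s_def)
    have conv: "(\<Sum>i\<le>k. t i * t (k - i)) = (if k = 0 then 1 else if k = 1 then - x else 0)" for k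
    proof -
      have "(\<Sum>i\<le>k. t i * t (k - i)) = (\<Sum>i\<le>k. sqrt_coeff i * sqrt_coeff (k - i)) *\<^sub>R x ^ k"
        unfolding scaleR_sum_left by (rule sum.cong) (auto simp: t_def simp flip: power_add)
      then show ?thesis by (simp add: sqrt_coeff_convolution)
    qed
    have "(\<lambda>k. if k = 0 then 1 else if k = 1 then - x else 0) sums (s * s)"
      using Cauchy_product_sums[OF snt snt] by (simp add: conv s_def)
    moreover have "(\<lambda>k. if k = 0 then 1 else if k = 1 then - x else 0) sums
        (\<Sum>k<2::nat. if k = 0 then 1 else if k = 1 then - x else (0::'a))"
      by (rule sums_finite) auto
    ultimately show "s * s = 1 - x"
      by (auto simp: numeral_2_eq_2 dest: sums_unique2)
    have "(\<lambda>m. \<Sum>n<m. t (Suc n)) \<longlonglongrightarrow> s - 1"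
      using summable_sums[OF st] sums_Suc_iff[of t "s - 1"] by (simp add: sums_def s_def t_def)
    moreover have "norm (\<Sum>n<m. t (Suc n)) \<le> 1" for m
      by (rule order_trans[OF sum_norm_le sum_abs_sqrt_coeff[of m]]) (rule nt)
    ultimately have "norm (s - 1) \<le> 1"
      by (intro Lim_bounded[OF tendsto_norm]) auto
    then show "norm (1 - s) \<le> 1" by (simp add: norm_minus_commute)
    fix y assume "y * x = x * y"
    then have "y * x ^ n = x ^ n * y" for n
      by (induction n) (auto simp: mult.assoc, metis mult.assoc)
    then have "y * t n = t n * y" for n by (simp add: t_def)
    then show "y * s = s * y"
      unfolding s_def by (simp add: suminf_mult[OF st, symmetric] suminf_mult2[OF st])
  qed
qed

subsection \<open>Positive elements\<close>

text \<open>For self-adjoint h the inequality says that the spectrum lies in [0, 2c], so this is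
  positivity without mention of a spectrum. The free constant c makes closure under sums a matter of
  the triangle inequality.\<close>

definition cpos :: "'a::unital_cstar \<Rightarrow> bool" where
  "cpos h \<longleftrightarrow> cstar h = h \<and> (\<exists>c\<ge>0. norm (of_real c - h) \<le> c)"

lemma cpos_selfadjoint: "cpos h \<Longrightarrow> cstar h = h"
  by (simp add: cpos_def)

lemma cpos_sqrt:
  assumes "cpos h"
  obtains s where "cpos s" "s * s = h" "\<And>y. y * h = h * y \<Longrightarrow> y * s = s * y"
proof -
  obtain c where h: "cstar h = h" and c: "c \<ge> 0" "norm (of_real c - h) \<le> c"
    using assms by (auto simp: cpos_def)
  show ?thesis
  proof (cases "c = 0")
    case True
    with c have "h = 0" by simp
    then show ?thesis by (intro that[of 0]) (auto simp: cpos_def intro: exI[of _ 0])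
  next
    case False
    with c have cp: "c > 0" by simp
    \<comment> \<open>The witness c rescales h into the unit ball around 1. The root of 1 - x = h /
      c is stretched back by sqrt c, and its distance to 1 certifies its own positivity.\<close>
    define x where "x = 1 - (1 / c) *\<^sub>R h"
    have "x = (1 / c) *\<^sub>R (of_real c - h)"
      using cp by (simp add: x_def of_real_def algebra_simps)
    then have "norm x \<le> 1" using c cp by (simp add: divide_simps)
    moreover have "cstar x = x" by (simp add: x_def cstar_diff h)
    ultimately obtain s where s: "cstar s = s" "s * s = 1 - x" "norm (1 - s) \<le> 1"
      and comm: "\<And>y. y * x = x * y \<Longrightarrow> y * s = s * y"
      using one_minus_sqrt by metis
    show ?thesis
    proof (rule that[of "sqrt c *\<^sub>R s"])
      have "of_real (sqrt c) - sqrt c *\<^sub>R s = sqrt c *\<^sub>R (1 - s)"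
        by (simp add: of_real_def algebra_simps)
      then have "norm (of_real (sqrt c) - sqrt c *\<^sub>R s) \<le> sqrt c"
        using s(3) cp by (simp add: mult_left_le)
      then show "cpos (sqrt c *\<^sub>R s)"
        using s(1) cp by (auto simp: cpos_def intro!: exI[of _ "sqrt c"])
      show "sqrt c *\<^sub>R s * sqrt c *\<^sub>R s = h"
        using cp s(2) by (simp add: x_def)
      fix y assume "y * h = h * y"
      then have "y * x = x * y" by (simp add: x_def algebra_simps)
      then show "y * sqrt c *\<^sub>R s = sqrt c *\<^sub>R s * y" by (simp add: comm)
    qed
  qed
qed

text \<open>Here \<open>k + \<i>s\<close> is a unitary with real and imaginary parts \<open>k\<close> and \<open>s\<close>.\<close>

lemma norm_le_one_of_squares_sum_one:
  fixes k s :: "'a::unital_cstar"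
  assumes "cstar k = k" "cstar s = s" "k * s = s * k" "k * k + s * s = 1"
  shows "norm k \<le> 1" "norm s \<le> 1"
proof -
  define u where "u = k + cscale \<i> s"
  have cu: "cstar u = k - cscale \<i> s"
    by (simp add: u_def cstar_add cstar_cscale assms cscale_minus_left)
  have "cstar u * u = k * k + k * cscale \<i> s - cscale \<i> s * k - cscale \<i> s * cscale \<i> s"
    unfolding cu unfolding u_def by (simp add: algebra_simps)
  also have "\<dots> = k * k + s * s"
    by (simp add: assms(3) cscale_ii_ii flip: cscale_left_mult cscale_right_mult)
  finally have "cstar u * u = k * k + s * s" .
  then have "(norm u)\<^sup>2 = 1" using cstar_identity[of u] assms(4) by simp
  then have nu: "norm u = 1" by (simp add: power2_eq_1_iff) (use norm_ge_zero[of u] in linarith)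
  have "norm (u + cstar u) \<le> 2" "norm (u - cstar u) \<le> 2"
    using norm_triangle_ineq[of u "cstar u"] norm_triangle_ineq4[of u "cstar u"] nu by auto
  moreover have "u + cstar u = 2 *\<^sub>R k" "u - cstar u = 2 *\<^sub>R cscale \<i> s"
    unfolding cu unfolding u_def by (simp_all add: scaleR_2)
  ultimately show "norm k \<le> 1" "norm s \<le> 1" by (simp_all add: norm_cscale)
qed

text \<open>Completing k by s = sqrt(1 - k^2) gives the unitary k + is, whose imaginary part has
  norm at most 1; and 1 - k^2 is s^2.\<close>

lemma norm_diff_square_le:
  fixes k :: "'a::unital_cstar"
  assumes "cstar k = k" "norm k \<le> 1"
  shows "norm (1 - k * k) \<le> 1"
proof -
  have "cstar (k * k) = k * k" by (simp add: cstar_mult assms)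
  moreover have "norm (k * k) \<le> 1"
    using assms by (simp add: norm_square_selfadjoint power_le_one)
  ultimately obtain s where s: "cstar s = s" "s * s = 1 - k * k"
    and comm: "\<And>y. y * (k * k) = (k * k) * y \<Longrightarrow> y * s = s * y"
    using one_minus_sqrt by metis
  have "norm s \<le> 1"
    using norm_le_one_of_squares_sum_one(2)[of k s] s assms comm[of k] by (simp add: mult.assoc)
  then show ?thesis
    using norm_square_selfadjoint[OF s(1)] s(2) by (simp add: power_le_one)
qed

lemma norm_diff_square_le_scaled:
  fixes k :: "'a::unital_cstar"
  assumes "cstar k = k"
  shows "norm (of_real ((norm k)\<^sup>2) - k * k) \<le> (norm k)\<^sup>2"
proof (cases "k = 0")
  case False
  define j where "j = (1 / norm k) *\<^sub>R k"
  have "norm (1 - j * j) \<le> 1"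
    by (rule norm_diff_square_le) (use False in \<open>auto simp: j_def assms\<close>)
  moreover have "of_real ((norm k)\<^sup>2) - k * k = (norm k)\<^sup>2 *\<^sub>R (1 - j * j)"
    using False by (simp add: j_def of_real_def algebra_simps power2_eq_square)
  ultimately show ?thesis by (simp add: mult_left_le)
qed simp

lemma cpos_square: "cstar k = k \<Longrightarrow> cpos (k * k :: 'a::unital_cstar)"
  unfolding cpos_def
  by (auto simp: cstar_mult intro!: exI[of _ "(norm k)\<^sup>2"] norm_diff_square_le_scaled)

text \<open>The constant in \<open>cpos\<close> may be taken to be \<open>norm h\<close>: write h as
  the square of a self-adjoint root, whose squared norm is \<open>norm h\<close>. This turns
  positivity into a condition without a quantifier.\<close>

lemma cpos_norm_diff_le: "cpos h \<Longrightarrow> norm (of_real (norm h) - h) \<le> norm (h::'a::unital_cstar)"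
  by (metis cpos_sqrt cpos_selfadjoint norm_diff_square_le_scaled norm_square_selfadjoint)

lemma cpos_iff: "cpos h \<longleftrightarrow> cstar h = h \<and> norm (of_real (norm h) - h) \<le> norm (h::'a::unital_cstar)"
  using cpos_norm_diff_le[of h] unfolding cpos_def by (metis norm_ge_zero)

lemma cpos_of_real: "c \<ge> 0 \<Longrightarrow> cpos (of_real c :: 'a::unital_cstar)"
  by (auto simp: cpos_def intro!: exI[of _ c])

lemma cpos_0 [simp]: "cpos (0::'a::unital_cstar)"
  using cpos_of_real[of 0] by simp

lemma cpos_add:
  assumes "cpos h" "cpos (k::'a::unital_cstar)"
  shows "cpos (h + k)"
proof -
  obtain c d where *: "c \<ge> 0" "norm (of_real c - h) \<le> c" "d \<ge> 0" "norm (of_real d - k) \<le> d"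
    using assms by (auto simp: cpos_def)
  have "norm (of_real (c + d) - (h + k)) \<le> c + d"
    using norm_triangle_ineq[of "of_real c - h" "of_real d - k"] * by (simp add: algebra_simps)
  with * assms show ?thesis
    by (auto simp: cpos_def cstar_add intro!: exI[of _ "c + d"])
qed

lemma cpos_scaleR:
  assumes "r \<ge> 0" "cpos (h::'a::unital_cstar)"
  shows "cpos (r *\<^sub>R h)"
proof -
  obtain s where "cpos s" "s * s = h" using cpos_sqrt[OF assms(2)] by metis
  then show ?thesis
    using cpos_square[of "sqrt r *\<^sub>R s"] assms by (simp add: cpos_selfadjoint)
qed

lemma cpos_sum: "(\<And>i. i \<in> S \<Longrightarrow> cpos (f i)) \<Longrightarrow> cpos (\<Sum>i\<in>S. f i :: 'a::unital_cstar)"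
  by (induction S rule: infinite_finite_induct) (auto intro: cpos_add)

text \<open>In the normalised description \<open>cpos_iff\<close> both sides are continuous in h, so
  the condition is closed.\<close>

lemma cpos_tendsto:
  fixes f :: "'b \<Rightarrow> 'a::unital_cstar"
  assumes "(f \<longlongrightarrow> l) F" "F \<noteq> bot" "eventually (\<lambda>x. cpos (f x)) F"
  shows "cpos l"
proof -
  have "((\<lambda>x. cstar (f x)) \<longlongrightarrow> cstar l) F"
    by (rule bounded_linear.tendsto[OF bounded_linear_cstar assms(1)])
  moreover have "eventually (\<lambda>x. cstar (f x) = f x) F"
    using assms(3) by eventually_elim (rule cpos_selfadjoint)
  ultimately have "(f \<longlongrightarrow> cstar l) F" using Lim_transform_eventually by blast
  then have "cstar l = l" using assms tendsto_unique by blast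
  moreover have "norm (of_real (norm l) - l) \<le> norm l"
    by (rule tendsto_le[OF assms(2) tendsto_norm[OF assms(1)]
          tendsto_norm[OF tendsto_diff[OF tendsto_of_real[OF tendsto_norm[OF assms(1)]] assms(1)]]])
      (rule eventually_mono[OF assms(3) cpos_norm_diff_le])
  ultimately show ?thesis by (simp add: cpos_iff)
qed

text \<open>After scaling to c = 1, commuting roots of x and 1 - x are the real and imaginary parts
  of a unitary, so the root of x is a contraction.\<close>

lemma norm_le_of_cpos:
  fixes x :: "'a::unital_cstar"
  assumes "cpos x" "cpos (of_real c - x)" "c \<ge> 0"
  shows "norm x \<le> c"
proof -
  have pos: "norm x \<le> d" if "cpos (of_real d - x)" "d > 0" for d
  proof -
    define y where "y = (1 / d) *\<^sub>R x"
    have "cpos y" using assms(1) that by (auto simp: y_def intro: cpos_scaleR)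
    then obtain k where k: "cpos k" "k * k = y" and ck: "\<And>z. z * y = y * z \<Longrightarrow> z * k = k * z"
      using cpos_sqrt by metis
    have "1 - y = (1 / d) *\<^sub>R (of_real d - x)"
      using that by (simp add: y_def of_real_def algebra_simps)
    then have "cpos (1 - y)" using that by (auto intro: cpos_scaleR)
    then obtain s where s: "cpos s" "s * s = 1 - y" and cs: "\<And>z. z * (1 - y) = (1 - y) * z \<Longrightarrow> z * s = s * z"
      using cpos_sqrt by metis
    have "k * y = y * k" by (simp add: k(2)[symmetric] mult.assoc)
    then have "k * s = s * k" by (intro cs) (simp add: algebra_simps)
    then have "norm k \<le> 1"
      using norm_le_one_of_squares_sum_one(1)[of k s] k s by (simp add: cpos_selfadjoint)
    then have "norm y \<le> 1"
      using norm_square_selfadjoint[of k] k by (simp add: cpos_selfadjoint power_le_one)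
    then show ?thesis using that by (simp add: y_def divide_simps)
  qed
  \<comment> \<open>Scaling needs a positive constant; the value c = 0 is covered by raising c to c
    + e.\<close>
  show ?thesis
  proof (rule field_le_epsilon)
    fix e :: real assume "e > 0"
    then have "cpos ((of_real c - x) + of_real e)"
      using assms by (intro cpos_add cpos_of_real) auto
    then show "norm x \<le> c + e"
      using \<open>e > 0\<close> assms by (intro pos) (auto simp: algebra_simps)
  qed
qed

lemma cpos_of_real_norm_diff: "cpos h \<Longrightarrow> cpos (of_real (norm h) - h :: 'a::unital_cstar)"
  using cpos_selfadjoint[of h] by (auto simp: cpos_def cstar_diff intro!: exI[of _ "norm h"])

lemma norm_mono_cpos:
  fixes x y :: "'a::unital_cstar"
  assumes "cpos x" "cpos (y - x)"
  shows "norm x \<le> norm y"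
proof (rule norm_le_of_cpos)
  have "cpos y" using cpos_add[OF assms] by simp
  then show "cpos (of_real (norm y) - x)"
    using cpos_add[OF cpos_of_real_norm_diff[OF \<open>cpos y\<close>] assms(2)] by simp
qed (use assms in auto)

text \<open>Each root commutes with whatever commutes with its square, so the two roots commute with
  each other and hk is the square of their self-adjoint product.\<close>

lemma cpos_mult:
  fixes h k :: "'a::unital_cstar"
  assumes "cpos h" "cpos k" "h * k = k * h"
  shows "cpos (h * k)"
proof -
  obtain s where s: "cpos s" "s * s = h" "\<And>y. y * h = h * y \<Longrightarrow> y * s = s * y"
    using cpos_sqrt[OF assms(1)] by metis
  obtain t where t: "cpos t" "t * t = k" "\<And>y. y * k = k * y \<Longrightarrow> y * t = t * y"
    using cpos_sqrt[OF assms(2)] by metis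
  have st: "s * t = t * s" using s(3)[of k] t(3)[of s] assms(3) by simp
  have "h * k = (s * t) * (s * t)"
    unfolding s(2)[symmetric] t(2)[symmetric] by (metis st mult.assoc)
  moreover have "cstar (s * t) = s * t"
    using s(1) t(1) by (simp add: cstar_mult cpos_selfadjoint st)
  ultimately show ?thesis using cpos_square[of "s * t"] by simp
qed

text \<open>Bernoulli's inequality in the order of A supplies linear growth of powers without
  spectral theory. In the induction step all factors commute, so a product of positives stays
  positive.\<close>

lemma cpos_bernoulli:
  fixes q :: "'a::unital_cstar"
  assumes "cpos q"
  shows "cpos ((1 + q) ^ m - 1 - real m *\<^sub>R q)"
proof (induction m)
  case (Suc m)
  let ?w = "(1 + q) ^ m"
  have "cpos (real m *\<^sub>R q)" using cpos_scaleR[OF _ assms] by simp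
  from cpos_add[OF Suc this] have "cpos (?w - 1)" by simp
  moreover have "q * ?w = ?w * q"
    by (metis (no_types, lifting) add.commute distrib_left distrib_right mult.right_neutral mult_1 power_commuting_commutes)
  ultimately have "cpos (q * (?w - 1))"
    using assms by (intro cpos_mult) (auto simp: algebra_simps)
  from cpos_add[OF Suc this] show ?case by (simp add: algebra_simps)
qed simp

lemma selfadjoint_eq_0_of_cube:
  fixes q :: "'a::unital_cstar"
  assumes "cstar q = q" "q * (q * q) = 0"
  shows "q = 0"
proof -
  have "norm ((q * q) * (q * q)) = 0" using assms by (simp add: mult.assoc)
  moreover have "norm ((q * q) * (q * q)) = ((norm q)\<^sup>2)\<^sup>2"
    using assms by (subst norm_square_selfadjoint) (auto simp: cstar_mult norm_square_selfadjoint)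
  ultimately show ?thesis by simp
qed

text \<open>With \<open>r = c c\<^sup>*\<close> and \<open>q = - c\<^sup>* c\<close> one has \<open>(1 - dr)\<^sup>m c = c (1 + dq)\<^sup>m\<close>; the left side stays
  bounded in \<open>m\<close> while the right side grows unless \<open>q = 0\<close>.\<close>

lemma cstar_mult_self_negative_eq_0:
  fixes c :: "'a::unital_cstar"
  assumes q: "cstar c * c = - q" "cpos q" and r: "cpos (c * cstar c)"
  shows "q = 0"
proof (rule ccontr)
  assume "q \<noteq> 0"
  define r where "r = c * cstar c"
  have "c \<noteq> 0" using q \<open>q \<noteq> 0\<close> by auto
  then have r0: "norm r > 0"
    using cstar_identity[of "cstar c"] by (auto simp: r_def cstar_cstar)
  define d where "d = 1 / norm r"
  have d: "d > 0" using r0 by (simp add: d_def)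
  have "1 - d *\<^sub>R r = d *\<^sub>R (of_real (norm r) - r)"
    using r0 by (simp add: d_def of_real_def algebra_simps)
  then have n1: "norm (1 - d *\<^sub>R r) \<le> 1"
    using cpos_norm_diff_le[OF r] r0 by (simp add: d_def r_def divide_simps)
  let ?w = "1 + d *\<^sub>R q"
  have cq: "c * q = - (r * c)"
    using q(1) unfolding r_def by (metis minus_minus mult.assoc mult_minus_right)
  have inter: "(1 - d *\<^sub>R r) ^ m * c = c * ?w ^ m" for m
  proof (induction m)
    case (Suc m)
    have "(1 - d *\<^sub>R r) * c = c * ?w" by (simp add: algebra_simps cq)
    with Suc show ?case by (metis mult.assoc power_Suc)
  qed simp
  have bound: "norm (q * ?w ^ m) \<le> (norm c)\<^sup>2" for m
  proof -
    have "norm ((1 - d *\<^sub>R r) ^ m) \<le> 1"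
      using norm_power_ineq[of "1 - d *\<^sub>R r" m] power_le_one[OF norm_ge_zero n1, of m] by linarith
    then have "norm ((1 - d *\<^sub>R r) ^ m * c) \<le> norm c"
      by (meson mult_right_le_one_le norm_ge_zero norm_mult_ineq mult_left_le_one_le order_trans)
    then have "norm (cstar c * ((1 - d *\<^sub>R r) ^ m * c)) \<le> norm c * norm c"
      using norm_mult_ineq[of "cstar c" "(1 - d *\<^sub>R r) ^ m * c"] mult_left_mono[OF _ norm_ge_zero[of c]]
      by (fastforce intro: order_trans)
    also have "cstar c * ((1 - d *\<^sub>R r) ^ m * c) = - (q * ?w ^ m)"
      unfolding inter by (simp add: q(1) flip: mult.assoc)
    finally show ?thesis by (simp add: power2_eq_square)
  qed
  have dq: "cpos (d *\<^sub>R q)" using q d by (intro cpos_scaleR) auto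
  \<comment> \<open>Multiplying Bernoulli's inequality by the commuting positive q gives q (1 +
    dq)^m \<ge> m d q^2, so the bounded norms would have to grow linearly in m.\<close>
  have "real m * (d * (norm q)\<^sup>2) \<le> (norm c)\<^sup>2" for m
  proof -
    let ?z = "?w ^ m - 1 - real m *\<^sub>R (d *\<^sub>R q)"
    have "q * ?w = ?w * q" by (simp add: algebra_simps)
    then have "q * ?w ^ m = ?w ^ m * q" by (metis power_commuting_commutes)
    then have comm: "q * ?z = ?z * q"
      by (simp add: algebra_simps)
    have "cpos (q * ?z)"
      by (rule cpos_mult[OF q(2) cpos_bernoulli[OF dq] comm])
    moreover have "cpos ((real m * d) *\<^sub>R (q * q))"
      using d q(2) by (intro cpos_scaleR cpos_square cpos_selfadjoint) auto
    moreover have "q * ?w ^ m - (real m * d) *\<^sub>R (q * q) = q * ?z + q"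
      by (simp add: algebra_simps)
    ultimately have "norm ((real m * d) *\<^sub>R (q * q)) \<le> norm (q * ?w ^ m)"
      using q(2) by (intro norm_mono_cpos) (auto intro: cpos_add)
    with bound[of m] show ?thesis
      using d q(2) by (simp add: norm_square_selfadjoint cpos_selfadjoint)
  qed
  moreover obtain m :: nat where "real m * (d * (norm q)\<^sup>2) > (norm c)\<^sup>2"
    using reals_Archimedean3[of "d * (norm q)\<^sup>2"] d \<open>q \<noteq> 0\<close> by auto
  ultimately show False by (meson not_le)
qed

text \<open>With X and Y proportional to the real and imaginary parts of c, X^2 + Y^2 is twice this
  sum. It lets negativity of \<open>cstar c * c\<close> yield positivity of
  \<open>c * cstar c\<close>.\<close>

lemma cpos_cstar_mult_add: "cpos (cstar c * c + c * cstar c :: 'a::unital_cstar)"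
proof -
  let ?X = "c + cstar c" and ?Y = "cscale \<i> (c - cstar c)"
  have "cstar ?X = ?X" by (simp add: cstar_add cstar_cstar)
  moreover have "cstar ?Y = ?Y"
    by (simp add: cstar_cscale cstar_diff cstar_cstar cscale_minus_left flip: cscale_minus_right)
  ultimately have "cpos (?X * ?X + ?Y * ?Y)" by (intro cpos_add cpos_square)
  moreover have "?Y * ?Y = - ((c - cstar c) * (c - cstar c))"
    by (simp add: cscale_ii_ii flip: cscale_left_mult cscale_right_mult)
  ultimately have "cpos (2 *\<^sub>R (cstar c * c + c * cstar c))"
    by (simp add: algebra_simps scaleR_2)
  then show ?thesis using cpos_scaleR[of "1/2" "2 *\<^sub>R (cstar c * c + c * cstar c)"] by simp
qed

text \<open>Take s = |b| for b = \<open>cstar a * a\<close>; then t = s - b is twice the negative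
  part of b. The element c = at has \<open>cstar c * c\<close> = - s t^2, and a negative element of
  this form must vanish. Since t^3 = 2 s t^2, also t vanishes, so b = |b|.\<close>

theorem cpos_cstar_mult_self: "cpos (cstar a * a :: 'a::unital_cstar)"
proof -
  define b where "b = cstar a * a"
  have b: "cstar b = b" by (simp add: b_def cstar_mult cstar_cstar)
  obtain s where s: "cpos s" "s * s = b * b" "\<And>y. y * (b * b) = (b * b) * y \<Longrightarrow> y * s = s * y"
    using cpos_sqrt[OF cpos_square[OF b]] by metis
  have bs: "b * s = s * b" by (rule s(3)) (simp add: mult.assoc)
  have ss: "cstar s = s" by (rule cpos_selfadjoint[OF s(1)])
  define t where "t = s - b"
  have t: "cstar t = t" by (simp add: t_def cstar_diff b ss)
  have bt: "b * t = - (s * t)" by (simp add: t_def algebra_simps bs s(2))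
  have ts: "t * s = s * t" by (simp add: t_def algebra_simps bs)
  define q where "q = s * (t * t)"
  have "cpos q"
    unfolding q_def by (rule cpos_mult[OF s(1) cpos_square[OF t]]) (metis ts mult.assoc)
  have "cstar (a * t) * (a * t) = t * (b * t)" by (simp add: cstar_mult t b_def mult.assoc)
  also have "\<dots> = - q" unfolding bt q_def by (metis ts mult.assoc mult_minus_right)
  finally have c: "cstar (a * t) * (a * t) = - q" .
  \<comment> \<open>Adding q to the positive sum over both orders cancels the summand
    \<open>cstar (a * t) * (a * t) = - q\<close>.\<close>
  have "cpos (a * t * cstar (a * t))"
    using cpos_add[OF cpos_cstar_mult_add[of "a * t"] \<open>cpos q\<close>] unfolding c by simp
  with c \<open>cpos q\<close> have "q = 0" by (rule cstar_mult_self_negative_eq_0)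
  have "t * t = 2 *\<^sub>R (s * t)" by (simp add: t_def algebra_simps bs s(2) scaleR_2)
  then have "t * (t * t) = 2 *\<^sub>R q" by (metis q_def mult_scaleR_right ts mult.assoc mult_scaleR_left)
  then have "t = 0" by (intro selfadjoint_eq_0_of_cube[OF t]) (simp add: \<open>q = 0\<close>)
  then show ?thesis using s(1) by (simp add: t_def b_def)
qed

lemma cpos_conj:
  assumes "cpos (h::'a::unital_cstar)"
  shows "cpos (cstar c * h * c)"
proof -
  obtain s where s: "cpos s" "s * s = h" using cpos_sqrt[OF assms] by metis
  have "cstar c * h * c = cstar (s * c) * (s * c)"
    using s by (simp add: cstar_mult cpos_selfadjoint mult.assoc flip: s(2))
  then show ?thesis by (simp add: cpos_cstar_mult_self)
qed

lemma cpos_norm_square_diff: "cpos (of_real ((norm a)\<^sup>2) - cstar a * a :: 'a::unital_cstar)"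
  using cpos_of_real_norm_diff[OF cpos_cstar_mult_self, of a] by (simp only: cstar_identity)

subsection \<open>Automorphisms\<close>

lemma cstar_aut_one: "cstar_aut \<phi> \<Longrightarrow> \<phi> 1 = (1::'a::unital_cstar)"
  unfolding cstar_aut_def by (metis bij_pointE mult.right_neutral mult_1)

lemma cstar_aut_inv:
  fixes \<phi> :: "'a::unital_cstar \<Rightarrow> 'a"
  assumes "cstar_aut \<phi>"
  shows "cstar_aut (inv \<phi>)"
proof -
  have b: "bij \<phi>" using assms by (simp add: cstar_aut_def)
  have i: "inv \<phi> y = x \<longleftrightarrow> y = \<phi> x" for x y
    using b by (metis bij_inv_eq_iff)
  have s: "\<phi> (inv \<phi> y) = y" for y using i[of y "inv \<phi> y"] by simp
  show ?thesis
    using assms b unfolding cstar_aut_def by (simp add: bij_imp_bij_inv i s)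
qed

lemma cstar_aut_scaleR: "cstar_aut \<phi> \<Longrightarrow> \<phi> (r *\<^sub>R x) = r *\<^sub>R \<phi> (x::'a::unital_cstar)"
  by (metis cstar_aut_def cscale_of_real)

lemma cstar_aut_zero: "cstar_aut \<phi> \<Longrightarrow> \<phi> 0 = (0::'a::unital_cstar)"
  using cstar_aut_scaleR[of \<phi> 0 0] by simp

lemma cstar_aut_diff: "cstar_aut \<phi> \<Longrightarrow> \<phi> (x - y) = \<phi> x - \<phi> (y::'a::unital_cstar)"
  by (metis add_diff_cancel_right' cstar_aut_def diff_add_cancel)

lemma cstar_aut_sum: "cstar_aut \<phi> \<Longrightarrow> \<phi> (\<Sum>i\<in>S. f i) = (\<Sum>i\<in>S. \<phi> (f i :: 'a::unital_cstar))"
  by (induction S rule: infinite_finite_induct) (auto simp: cstar_aut_zero cstar_aut_def)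

lemma cstar_aut_cpos:
  assumes "cstar_aut \<phi>" "cpos (h::'a::unital_cstar)"
  shows "cpos (\<phi> h)"
proof -
  obtain s where "cpos s" "s * s = h" using cpos_sqrt[OF assms(2)] by metis
  then show ?thesis
    using cpos_square[of "\<phi> s"] assms(1) by (metis cpos_selfadjoint cstar_aut_def)
qed

text \<open>\<open>cstar_aut\<close> demands no continuity. A star homomorphism fixing 1 preserves
  the order, so the bound of \<open>cstar y * y\<close> by the scalar \<open>norm y\<close> squared
  carries over to the image; the same for the inverse gives equality.\<close>

lemma cstar_aut_norm:
  assumes "cstar_aut \<phi>"
  shows "norm (\<phi> x) = norm (x::'a::unital_cstar)"
proof -
  have le: "norm (\<psi> y) \<le> norm y" if \<psi>: "cstar_aut \<psi>" for \<psi> and y :: 'a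
  proof -
    have e: "\<psi> (of_real ((norm y)\<^sup>2) - cstar y * y) = of_real ((norm y)\<^sup>2) - cstar (\<psi> y) * \<psi> y"
      using \<psi> unfolding cstar_aut_diff[OF \<psi>] of_real_def cstar_aut_scaleR[OF \<psi>] cstar_aut_one[OF \<psi>]
      by (simp add: cstar_aut_def)
    have "norm (cstar (\<psi> y) * \<psi> y) \<le> (norm y)\<^sup>2"
      by (rule norm_le_of_cpos[OF cpos_cstar_mult_self])
        (use cstar_aut_cpos[OF \<psi> cpos_norm_square_diff[of y]] in \<open>auto simp only: e zero_le_power2\<close>)
    then show ?thesis by (simp add: cstar_identity power_mono_iff)
  qed
  have "inv \<phi> (\<phi> x) = x" using assms by (simp add: cstar_aut_def bij_is_inj)
  with le[OF assms, of x] le[OF cstar_aut_inv[OF assms], of "\<phi> x"] show ?thesis by simp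
qed

subsection \<open>The Cauchy--Schwarz inequality\<close>

text \<open>Insert c = B / a with a slightly above \<open>norm A\<close>, which may be 0. Since A
  \<le> a, the quadratic form leaves \<open>cstar B * B / a \<le> D\<close>. The abstract form
  serves both finite A-valued sums and sums of module inner products.\<close>

lemma cauchy_schwarz_of_quadratic_cpos:
  fixes A B D :: "'a::unital_cstar"
  assumes quad: "\<And>c. cpos (cstar c * A * c - cstar c * B - cstar B * c + D)" and A: "cpos A"
  shows "(norm B)\<^sup>2 \<le> norm A * norm D"
proof -
  have bound: "(norm B)\<^sup>2 \<le> (norm A + e) * norm D" if "e > 0" for e
  proof -
    define a where "a = norm A + e"
    have a: "a > 0" using that by (simp add: a_def add_nonneg_pos)
    let ?c = "(1 / a) *\<^sub>R B"
    have "cpos (of_real a - A)"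
      using cpos_add[OF cpos_of_real_norm_diff[OF A] cpos_of_real[of e]] that
      by (simp add: a_def algebra_simps)
    from cpos_add[OF cpos_conj[OF this, of ?c] quad[of ?c]]
    have "cpos (D - (1 / a) *\<^sub>R (cstar B * B))"
      using a by (simp add: of_real_def algebra_simps)
    then have "norm ((1 / a) *\<^sub>R (cstar B * B)) \<le> norm D"
      using a by (intro norm_mono_cpos cpos_scaleR cpos_cstar_mult_self) auto
    then show ?thesis using a by (simp add: cstar_identity divide_simps mult.commute flip: a_def)
  qed
  show ?thesis
  proof (rule field_le_epsilon)
    fix e :: real assume e: "e > 0"
    have d: "norm D + 1 > 0" by (simp add: add_nonneg_pos)
    have "e / (norm D + 1) * norm D \<le> e"
      using d e by (simp add: divide_simps)
    then show "(norm B)\<^sup>2 \<le> norm A * norm D + e"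
      using bound[of "e / (norm D + 1)"] d e by (simp add: algebra_simps)
  qed
qed

text \<open>The norm of the Hilbert module A^S: squares are summed in A before the norm is taken,
  which in general differs from the Euclidean norm of the coordinate norms.\<close>

definition fnorm :: "'g set \<Rightarrow> ('g \<Rightarrow> 'a::unital_cstar) \<Rightarrow> real" where
  "fnorm S z = sqrt (norm (\<Sum>g\<in>S. cstar (z g) * z g))"

lemma fnorm_nonneg [simp]: "fnorm S z \<ge> 0"
  by (simp add: fnorm_def)

lemma fnorm_power2: "(fnorm S z)\<^sup>2 = norm (\<Sum>g\<in>S. cstar (z g) * z g)"
  by (simp add: fnorm_def)

lemma fnorm_singleton [simp]: "fnorm {g} z = norm (z g)"
  by (simp add: fnorm_def cstar_identity)

lemma fnorm_quadratic_cpos: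
  fixes z w :: "'g \<Rightarrow> 'a::unital_cstar"
  shows "cpos (cstar c * (\<Sum>g\<in>S. cstar (z g) * z g) * c - cstar c * (\<Sum>g\<in>S. cstar (z g) * w g)
    - cstar (\<Sum>g\<in>S. cstar (z g) * w g) * c + (\<Sum>g\<in>S. cstar (w g) * w g))"
proof -
  have "cpos (\<Sum>g\<in>S. cstar (z g * c - w g) * (z g * c - w g))"
    by (intro cpos_sum cpos_cstar_mult_self)
  also have "(\<Sum>g\<in>S. cstar (z g * c - w g) * (z g * c - w g))
     = cstar c * (\<Sum>g\<in>S. cstar (z g) * z g) * c - cstar c * (\<Sum>g\<in>S. cstar (z g) * w g)
    - cstar (\<Sum>g\<in>S. cstar (z g) * w g) * c + (\<Sum>g\<in>S. cstar (w g) * w g)"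
    unfolding sum_distrib_left sum_distrib_right cstar_sum sum_subtractf[symmetric] sum.distrib[symmetric]
    by (intro sum.cong refl) (simp add: cstar_mult cstar_diff cstar_cstar algebra_simps)
  finally show ?thesis .
qed

lemma fnorm_cauchy_schwarz:
  "norm (\<Sum>g\<in>S. cstar (z g) * w g) \<le> fnorm S z * fnorm S (w :: 'g \<Rightarrow> 'a::unital_cstar)"
proof -
  have "(norm (\<Sum>g\<in>S. cstar (z g) * w g))\<^sup>2 \<le> (fnorm S z * fnorm S w)\<^sup>2"
    unfolding power_mult_distrib fnorm_power2
    by (intro cauchy_schwarz_of_quadratic_cpos fnorm_quadratic_cpos cpos_sum cpos_cstar_mult_self)
  then show ?thesis by (rule power2_le_imp_le) simp
qed

lemma fnorm_mono: "finite T \<Longrightarrow> S \<subseteq> T \<Longrightarrow> fnorm S z \<le> fnorm T (z :: 'g \<Rightarrow> 'a::unital_cstar)"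
  unfolding fnorm_def
  by (intro real_sqrt_le_mono norm_mono_cpos cpos_sum cpos_cstar_mult_self)
    (auto simp: sum_diff[symmetric] intro!: cpos_sum cpos_cstar_mult_self)

lemma fnorm_triangle:
  "fnorm S (\<lambda>g. z g + w g) \<le> fnorm S z + fnorm S (w :: 'g \<Rightarrow> 'a::unital_cstar)"
proof (rule power2_le_imp_le)
  let ?i = "\<lambda>z w. \<Sum>g\<in>S. cstar (z g) * w g"
  have "(fnorm S (\<lambda>g. z g + w g))\<^sup>2 = norm ((?i z z + ?i z w) + (?i w z + ?i w w))"
    unfolding fnorm_power2 by (simp add: cstar_add algebra_simps sum.distrib)
  also have "\<dots> \<le> (norm (?i z z) + norm (?i z w)) + (norm (?i w z) + norm (?i w w))"
    by (intro norm_triangle_mono norm_triangle_ineq)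
  also have "\<dots> \<le> (fnorm S z + fnorm S w)\<^sup>2"
    using fnorm_cauchy_schwarz[of z w S] fnorm_cauchy_schwarz[of w z S]
    by (simp add: power2_sum mult.commute flip: fnorm_power2)
  finally show "(fnorm S (\<lambda>g. z g + w g))\<^sup>2 \<le> (fnorm S z + fnorm S w)\<^sup>2" .
qed simp

lemma fnorm_scaleR: "fnorm S (\<lambda>g. r *\<^sub>R z g) = \<bar>r\<bar> * fnorm S (z :: 'g \<Rightarrow> 'a::unital_cstar)"
  unfolding fnorm_def by (simp add: real_sqrt_mult flip: scaleR_sum_right power2_eq_square)

lemma fnorm_minus: "fnorm S (\<lambda>g. - z g) = fnorm S (z :: 'g \<Rightarrow> 'a::unital_cstar)"
  using fnorm_scaleR[of S "- 1" z] by simp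

lemma fnorm_diff_triangle:
  "fnorm S z \<le> fnorm S (\<lambda>g. z g - w g) + fnorm S (w :: 'g \<Rightarrow> 'a::unital_cstar)"
  using fnorm_triangle[of S "\<lambda>g. z g - w g" w] by simp

lemma tendsto_fnorm:
  "(\<And>g. ((\<lambda>n. z n g) \<longlongrightarrow> w g) F) \<Longrightarrow> ((\<lambda>n. fnorm S (z n)) \<longlongrightarrow> fnorm S (w :: 'g \<Rightarrow> 'a::unital_cstar)) F"
  unfolding fnorm_def
  by (intro tendsto_intros bounded_linear.tendsto[OF bounded_linear_cstar])

text \<open>The series of \<open>cstar (z g) * z g\<close> need not converge absolutely for a module
  element z, so summability is decided by small finite tails instead.\<close>

lemma summable_on_Cauchy_iff:
  fixes f :: "'g \<Rightarrow> 'b::banach"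
  shows "f summable_on UNIV \<longleftrightarrow>
    (\<forall>e>0. \<exists>S0. finite S0 \<and> (\<forall>S. finite S \<and> S \<inter> S0 = {} \<longrightarrow> norm (sum f S) < e))"
    (is "_ \<longleftrightarrow> ?C")
proof
  assume "f summable_on UNIV"
  then obtain s where s: "(sum f \<longlongrightarrow> s) (finite_subsets_at_top UNIV)"
    by (auto simp: summable_on_def has_sum_def)
  show ?C
  proof (intro allI impI)
    fix e :: real assume "e > 0"
    then have "\<forall>\<^sub>F S in finite_subsets_at_top UNIV. dist (sum f S) s < e / 2"
      using s unfolding tendsto_iff by (meson half_gt_zero)
    then obtain S0 where S0: "finite S0" "\<And>S. finite S \<Longrightarrow> S0 \<subseteq> S \<Longrightarrow> dist (sum f S) s < e / 2"
      by (auto simp: eventually_finite_subsets_at_top)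
    have "norm (sum f S) < e" if "finite S" "S \<inter> S0 = {}" for S
    proof -
      have "sum f S = sum f (S0 \<union> S) - sum f S0"
        using that S0(1) by (subst sum.union_disjoint) auto
      moreover have "dist (sum f (S0 \<union> S)) (sum f S0) < e"
        by (rule dist_triangle_half_l[OF S0(2) S0(2)]) (use S0(1) that in auto)
      ultimately show ?thesis by (simp add: dist_norm)
    qed
    with S0(1) show "\<exists>S0. finite S0 \<and> (\<forall>S. finite S \<and> S \<inter> S0 = {} \<longrightarrow> norm (sum f S) < e)" by auto
  qed
next
  assume C: ?C
  have "\<exists>P. eventually P (finite_subsets_at_top UNIV) \<and>
      (\<forall>x y. P x \<and> P y \<longrightarrow> dist (sum f x) (sum f y) < e)" if e: "e > 0" for e
  proof -
    obtain S0 where S0: "finite S0" "\<And>S. finite S \<Longrightarrow> S \<inter> S0 = {} \<Longrightarrow> norm (sum f S) < e / 2"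
      using C[rule_format, of "e / 2"] e by auto
    have *: "dist (sum f S) (sum f S0) < e / 2" if "finite S" "S0 \<subseteq> S" for S
      using S0(2)[of "S - S0"] that by (simp add: dist_norm sum_diff) blast
    show ?thesis
    proof (intro exI conjI allI impI)
      show "\<forall>\<^sub>F S in finite_subsets_at_top UNIV. finite S \<and> S0 \<subseteq> S"
        using S0(1) by (auto simp: eventually_finite_subsets_at_top)
      show "dist (sum f x) (sum f y) < e" if "(finite x \<and> S0 \<subseteq> x) \<and> finite y \<and> S0 \<subseteq> y" for x y
        by (rule dist_triangle_half_l[OF * *]) (use that in auto)
    qed
  qed
  then have "cauchy_filter (filtermap (sum f) (finite_subsets_at_top UNIV))"
    by (simp add: cauchy_filter_metric_filtermap)
  then obtain s where "(sum f \<longlongrightarrow> s) (finite_subsets_at_top UNIV)"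
    using cauchy_filter_convergent by (auto simp: convergent_filter_iff filterlim_def)
  then show "f summable_on UNIV" by (auto simp: summable_on_def has_sum_def)
qed

subsection \<open>The standard Hilbert module\<close>

definition l2_set :: "('g \<Rightarrow> 'a::unital_cstar) set" where
  "l2_set = {z. (\<lambda>g. cstar (z g) * z g) summable_on UNIV}"

text \<open>Passing to \<open>fnorm\<close> puts the tail condition into a form to which the
  triangle inequality applies; the sums of squares themselves do not satisfy one.\<close>

lemma l2_set_iff:
  "z \<in> l2_set \<longleftrightarrow> (\<forall>e>0. \<exists>S0. finite S0 \<and> (\<forall>S. finite S \<and> S \<inter> S0 = {} \<longrightarrow> fnorm S z < e))"
proof -
  have *: "norm (\<Sum>g\<in>S. cstar (z g) * z g) < e\<^sup>2 \<longleftrightarrow> fnorm S z < e" if "e > 0" for S e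
    unfolding fnorm_power2[symmetric] using that by (auto intro: power2_less_imp_less power_strict_mono)
  have **: "norm (\<Sum>g\<in>S. cstar (z g) * z g) < e \<longleftrightarrow> fnorm S z < sqrt e" if "e > 0" for S e
    using *[of "sqrt e" S] that by simp
  show ?thesis
    unfolding l2_set_def mem_Collect_eq summable_on_Cauchy_iff
  proof (intro iffI allI impI)
    fix e :: real
    assume "e > 0" and "\<forall>e>0. \<exists>S0. finite S0 \<and> (\<forall>S. finite S \<and> S \<inter> S0 = {} \<longrightarrow> norm (\<Sum>g\<in>S. cstar (z g) * z g) < e)"
    then show "\<exists>S0. finite S0 \<and> (\<forall>S. finite S \<and> S \<inter> S0 = {} \<longrightarrow> fnorm S z < e)"
      using *[OF \<open>e > 0\<close>] by (metis zero_less_power)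
  next
    fix e :: real
    assume "e > 0" and "\<forall>e>0. \<exists>S0. finite S0 \<and> (\<forall>S. finite S \<and> S \<inter> S0 = {} \<longrightarrow> fnorm S z < e)"
    then show "\<exists>S0. finite S0 \<and> (\<forall>S. finite S \<and> S \<inter> S0 = {} \<longrightarrow> norm (\<Sum>g\<in>S. cstar (z g) * z g) < e)"
      using **[OF \<open>e > 0\<close>] by (metis real_sqrt_gt_zero)
  qed
qed

lemma l2_set_zero: "(\<lambda>_. 0) \<in> l2_set"
  by (simp add: l2_set_def)

lemma l2_set_add:
  assumes "z \<in> l2_set" "w \<in> l2_set"
  shows "(\<lambda>g. z g + w g) \<in> l2_set"
  unfolding l2_set_iff
proof (intro allI impI)
  fix e :: real assume "e > 0"
  then obtain S0 S1 where S: "finite S0" "\<And>S. finite S \<Longrightarrow> S \<inter> S0 = {} \<Longrightarrow> fnorm S z < e / 2"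
    "finite S1" "\<And>S. finite S \<Longrightarrow> S \<inter> S1 = {} \<Longrightarrow> fnorm S w < e / 2"
    using assms[unfolded l2_set_iff, THEN spec, of "e / 2"] by auto
  have "fnorm S (\<lambda>g. z g + w g) < e" if "finite S" "S \<inter> (S0 \<union> S1) = {}" for S
    using fnorm_triangle[of S z w] S(2)[of S] S(4)[of S] that by (simp add: Int_Un_distrib)
  with S show "\<exists>S0. finite S0 \<and> (\<forall>S. finite S \<and> S \<inter> S0 = {} \<longrightarrow> fnorm S (\<lambda>g. z g + w g) < e)"
    by (intro exI[of _ "S0 \<union> S1"]) auto
qed

lemma l2_set_dominated:
  assumes "z \<in> l2_set" and "\<And>S. finite S \<Longrightarrow> fnorm S w \<le> C * fnorm S z"
  shows "w \<in> l2_set"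
  unfolding l2_set_iff
proof (intro allI impI)
  fix e :: real assume "e > 0"
  \<comment> \<open>The bound C may be zero or negative; \<open>\<bar>C\<bar> + 1\<close> is a safe
    divisor.\<close>
  then have "e / (\<bar>C\<bar> + 1) > 0" by simp
  then obtain S0 where S0: "finite S0" "\<And>S. finite S \<Longrightarrow> S \<inter> S0 = {} \<Longrightarrow> fnorm S z < e / (\<bar>C\<bar> + 1)"
    using assms(1)[unfolded l2_set_iff, THEN spec, of "e / (\<bar>C\<bar> + 1)"] by blast
  have "fnorm S w < e" if "finite S" "S \<inter> S0 = {}" for S
  proof -
    have "fnorm S w \<le> (\<bar>C\<bar> + 1) * fnorm S z"
      by (rule order_trans[OF assms(2)[OF that(1)]]) (auto intro: mult_right_mono)
    also have "\<dots> < e" using S0(2)[OF that] by (simp add: field_simps)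
    finally show ?thesis .
  qed
  with S0(1) show "\<exists>S0. finite S0 \<and> (\<forall>S. finite S \<and> S \<inter> S0 = {} \<longrightarrow> fnorm S w < e)" by blast
qed

lemma l2_set_scaleR: "z \<in> l2_set \<Longrightarrow> (\<lambda>g. r *\<^sub>R z g) \<in> l2_set"
  by (erule l2_set_dominated[where C="\<bar>r\<bar>"]) (simp add: fnorm_scaleR)

lemma l2_set_minus: "z \<in> l2_set \<Longrightarrow> (\<lambda>g. - z g) \<in> l2_set"
  by (erule l2_set_dominated[where C=1]) (simp add: fnorm_minus)

lemma l2_set_inner_summable:
  assumes "z \<in> l2_set" "w \<in> l2_set"
  shows "(\<lambda>g. cstar (z g) * w g) summable_on UNIV"
  unfolding summable_on_Cauchy_iff
proof (intro allI impI)
  fix e :: real assume "e > 0"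
  then obtain S0 S1 where S: "finite S0" "\<And>S. finite S \<Longrightarrow> S \<inter> S0 = {} \<Longrightarrow> fnorm S z < 1"
    "finite S1" "\<And>S. finite S \<Longrightarrow> S \<inter> S1 = {} \<Longrightarrow> fnorm S w < e"
    using assms(1)[unfolded l2_set_iff, THEN spec, of 1] assms(2)[unfolded l2_set_iff, THEN spec, of e] by auto
  have "norm (\<Sum>g\<in>S. cstar (z g) * w g) < e" if "finite S" "S \<inter> (S0 \<union> S1) = {}" for S
  proof -
    have "norm (\<Sum>g\<in>S. cstar (z g) * w g) \<le> fnorm S z * fnorm S w" by (rule fnorm_cauchy_schwarz)
    also have "\<dots> \<le> 1 * fnorm S w"
      using S(2)[of S] that by (intro mult_right_mono) (auto simp: Int_Un_distrib)
    also have "\<dots> < e" using S(4)[of S] that by auto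
    finally show ?thesis .
  qed
  with S show "\<exists>S0. finite S0 \<and> (\<forall>S. finite S \<and> S \<inter> S0 = {} \<longrightarrow> norm (\<Sum>g\<in>S. cstar (z g) * w g) < e)"
    by (intro exI[of _ "S0 \<union> S1"]) auto
qed

text \<open>A type rather than a carrier set, so that completeness and the limit rules of normed
  spaces are available for the gliding hump argument.\<close>

typedef (overloaded) ('g, 'a::unital_cstar) l2 = "l2_set :: ('g \<Rightarrow> 'a) set"
  morphisms l2_fun Abs_l2
  using l2_set_zero by blast

setup_lifting type_definition_l2

lift_definition l2_inner :: "('g, 'a::unital_cstar) l2 \<Rightarrow> ('g, 'a) l2 \<Rightarrow> 'a"
  is "\<lambda>z w. infsum (\<lambda>g. cstar (z g) * w g) UNIV" .

lemma l2_inner_tendsto: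
  "((\<lambda>S. \<Sum>g\<in>S. cstar (l2_fun z g) * l2_fun w g) \<longlongrightarrow> l2_inner z w) (finite_subsets_at_top UNIV)"
  using has_sum_infsum[OF l2_set_inner_summable[OF l2_fun l2_fun, of z w]]
  by (simp add: has_sum_def l2_inner.rep_eq)

instantiation l2 :: (type, unital_cstar) real_normed_vector
begin

lift_definition zero_l2 :: "('a, 'b) l2" is "\<lambda>_. 0" by (rule l2_set_zero)
lift_definition plus_l2 :: "('a, 'b) l2 \<Rightarrow> ('a, 'b) l2 \<Rightarrow> ('a, 'b) l2" is "\<lambda>z w g. z g + w g"
  by (rule l2_set_add)
lift_definition uminus_l2 :: "('a, 'b) l2 \<Rightarrow> ('a, 'b) l2" is "\<lambda>z g. - z g" by (rule l2_set_minus)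
lift_definition minus_l2 :: "('a, 'b) l2 \<Rightarrow> ('a, 'b) l2 \<Rightarrow> ('a, 'b) l2" is "\<lambda>z w g. z g - w g"
  using l2_set_add l2_set_minus by fastforce
lift_definition scaleR_l2 :: "real \<Rightarrow> ('a, 'b) l2 \<Rightarrow> ('a, 'b) l2" is "\<lambda>r z g. r *\<^sub>R z g"
  by (rule l2_set_scaleR)

definition norm_l2 :: "('a, 'b) l2 \<Rightarrow> real" where "norm_l2 z = sqrt (norm (l2_inner z z))"
definition dist_l2 :: "('a, 'b) l2 \<Rightarrow> ('a, 'b) l2 \<Rightarrow> real" where "dist_l2 z w = norm (z - w)"
definition sgn_l2 :: "('a, 'b) l2 \<Rightarrow> ('a, 'b) l2" where "sgn_l2 z = inverse (norm z) *\<^sub>R z"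
definition uniformity_l2 :: "(('a, 'b) l2 \<times> ('a, 'b) l2) filter" where
  "uniformity_l2 = (INF e\<in>{0<..}. principal {(x, y). dist x y < e})"
definition open_l2 :: "('a, 'b) l2 set \<Rightarrow> bool" where
  "open_l2 S = (\<forall>x\<in>S. \<forall>\<^sub>F (x', y) in uniformity. x' = x \<longrightarrow> y \<in> S)"

lemma fnorm_tendsto_norm_l2:
  fixes z :: "('a, 'b) l2"
  shows "((\<lambda>S. fnorm S (l2_fun z)) \<longlongrightarrow> norm z) (finite_subsets_at_top UNIV)"
  unfolding fnorm_def norm_l2_def by (intro tendsto_intros l2_inner_tendsto)

lemma fnorm_le_norm_l2:
  fixes z :: "('a, 'b) l2"
  assumes "finite S" shows "fnorm S (l2_fun z) \<le> norm z"
  by (rule tendsto_lowerbound[OF fnorm_tendsto_norm_l2])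
    (use assms in \<open>auto simp: eventually_finite_subsets_at_top intro!: exI[of _ S] fnorm_mono\<close>)

lemma norm_l2_le:
  fixes z :: "('a, 'b) l2"
  assumes "\<And>S. finite S \<Longrightarrow> fnorm S (l2_fun z) \<le> c" shows "norm z \<le> c"
  by (rule tendsto_upperbound[OF fnorm_tendsto_norm_l2])
    (use assms in \<open>auto intro!: eventually_finite_subsets_at_top_weakI\<close>)

instance
proof
  fix z w :: "('a, 'b) l2" and r :: real
  show "norm z = 0 \<longleftrightarrow> z = 0"
  proof
    assume "norm z = 0"
    then have "norm (l2_fun z g) \<le> 0" for g using fnorm_le_norm_l2[of "{g}" z] by simp
    then show "z = 0" by transfer auto
  next
    assume "z = 0"
    then show "norm z = 0" unfolding norm_l2_def by transfer simp
  qed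
  show "norm (z + w) \<le> norm z + norm w"
  proof (rule norm_l2_le)
    fix S :: "'a set" assume S: "finite S"
    have "fnorm S (l2_fun (z + w)) \<le> fnorm S (l2_fun z) + fnorm S (l2_fun w)"
      by (simp add: plus_l2.rep_eq fnorm_triangle)
    with fnorm_le_norm_l2[OF S, of z] fnorm_le_norm_l2[OF S, of w]
    show "fnorm S (l2_fun (z + w)) \<le> norm z + norm w" by linarith
  qed
  have "((\<lambda>S. fnorm S (l2_fun (r *\<^sub>R z))) \<longlongrightarrow> \<bar>r\<bar> * norm z) (finite_subsets_at_top UNIV)"
    unfolding scaleR_l2.rep_eq fnorm_scaleR by (intro tendsto_intros fnorm_tendsto_norm_l2)
  from tendsto_unique[OF _ fnorm_tendsto_norm_l2 this] show "norm (r *\<^sub>R z) = \<bar>r\<bar> * norm z" by simp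
qed (transfer; simp add: algebra_simps dist_l2_def sgn_l2_def uniformity_l2_def open_l2_def; fail)+

end

lemma norm_l2_fun_le: "norm (l2_fun z g) \<le> norm z"
  using fnorm_le_norm_l2[of "{g}" z] by simp

text \<open>Coordinates are dominated by the norm, so coordinatewise limits exist. The estimate
  \<open>approx\<close> is uniform in the finite set S, and this uniformity gives both membership of
  the limit and convergence in norm.\<close>

instance l2 :: (type, unital_cstar) banach
proof
  fix X :: "nat \<Rightarrow> ('a, 'b) l2"
  assume X: "Cauchy X"
  have "Cauchy (\<lambda>n. l2_fun (X n) g)" for g
    unfolding Cauchy_iff
  proof (intro allI impI)
    fix e :: real assume "e > 0"
    then obtain M where M: "\<And>m n. m \<ge> M \<Longrightarrow> n \<ge> M \<Longrightarrow> norm (X m - X n) < e"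
      using X unfolding Cauchy_iff by blast
    have "norm (l2_fun (X m) g - l2_fun (X n) g) < e" if "m \<ge> M" "n \<ge> M" for m n
      using norm_l2_fun_le[of "X m - X n" g] M[OF that] by (simp add: minus_l2.rep_eq)
    then show "\<exists>M. \<forall>m\<ge>M. \<forall>n\<ge>M. norm (l2_fun (X m) g - l2_fun (X n) g) < e" by blast
  qed
  then have "\<exists>l. (\<lambda>n. l2_fun (X n) g) \<longlonglongrightarrow> l" for g
    by (simp add: Cauchy_convergent_iff convergent_def)
  then obtain z where z: "\<And>g. (\<lambda>n. l2_fun (X n) g) \<longlonglongrightarrow> z g" by metis
  have approx: "\<exists>M. \<forall>n\<ge>M. \<forall>S. finite S \<longrightarrow> fnorm S (\<lambda>g. z g - l2_fun (X n) g) \<le> e" if "e > 0" for e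
  proof -
    obtain M where M: "\<And>m n. m \<ge> M \<Longrightarrow> n \<ge> M \<Longrightarrow> norm (X m - X n) < e"
      using X \<open>e > 0\<close> unfolding Cauchy_iff by blast
    have "fnorm S (\<lambda>g. z g - l2_fun (X n) g) \<le> e" if "n \<ge> M" "finite S" for n S
    proof (rule tendsto_upperbound)
      show "(\<lambda>m. fnorm S (\<lambda>g. l2_fun (X m) g - l2_fun (X n) g)) \<longlonglongrightarrow> fnorm S (\<lambda>g. z g - l2_fun (X n) g)"
        by (intro tendsto_fnorm tendsto_intros z)
      show "\<forall>\<^sub>F m in sequentially. fnorm S (\<lambda>g. l2_fun (X m) g - l2_fun (X n) g) \<le> e"
        unfolding eventually_sequentially
      proof (intro exI allI impI)
        fix m assume "M \<le> m"
        then show "fnorm S (\<lambda>g. l2_fun (X m) g - l2_fun (X n) g) \<le> e"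
          using fnorm_le_norm_l2[OF \<open>finite S\<close>, of "X m - X n"] M[of m n] \<open>n \<ge> M\<close>
          by (simp add: minus_l2.rep_eq)
      qed
    qed simp
    then show ?thesis by blast
  qed
  have zl: "z \<in> l2_set"
    unfolding l2_set_iff
  proof (intro allI impI)
    fix e :: real assume e: "e > 0"
    obtain n where n: "\<And>S. finite S \<Longrightarrow> fnorm S (\<lambda>g. z g - l2_fun (X n) g) \<le> e / 2"
      using approx[of "e / 2"] e by auto
    obtain S0 where S0: "finite S0" "\<And>S. finite S \<Longrightarrow> S \<inter> S0 = {} \<Longrightarrow> fnorm S (l2_fun (X n)) < e / 2"
      using l2_fun[of "X n", unfolded l2_set_iff, THEN spec, of "e / 2"] e by auto
    have "fnorm S z < e" if "finite S" "S \<inter> S0 = {}" for S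
      using fnorm_diff_triangle[of S z "l2_fun (X n)"] n[OF that(1)] S0(2)[OF that] by simp
    with S0(1) show "\<exists>S0. finite S0 \<and> (\<forall>S. finite S \<and> S \<inter> S0 = {} \<longrightarrow> fnorm S z < e)" by blast
  qed
  have "X \<longlonglongrightarrow> Abs_l2 z"
  proof (rule LIMSEQ_I)
    fix e :: real assume e: "e > 0"
    obtain M where M: "\<And>n S. n \<ge> M \<Longrightarrow> finite S \<Longrightarrow> fnorm S (\<lambda>g. z g - l2_fun (X n) g) \<le> e / 2"
      using approx[of "e / 2"] e by auto
    have "norm (Abs_l2 z - X n) \<le> e / 2" if "n \<ge> M" for n
      by (rule norm_l2_le) (use M[OF that] in \<open>simp add: minus_l2.rep_eq Abs_l2_inverse[OF zl]\<close>)
    then have "norm (X n - Abs_l2 z) < e" if "n \<ge> M" for n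
      using that e by (fastforce simp: norm_minus_commute intro: order_le_less_trans)
    then show "\<exists>M. \<forall>n\<ge>M. norm (X n - Abs_l2 z) < e" by blast
  qed
  then show "convergent X" by (auto simp: convergent_def)
qed

lemma l2_inner_eqI:
  assumes "((\<lambda>S. \<Sum>g\<in>S. cstar (l2_fun z g) * l2_fun w g) \<longlongrightarrow> a) (finite_subsets_at_top UNIV)"
  shows "l2_inner z w = a"
  using tendsto_unique[OF _ l2_inner_tendsto assms] by simp

lemma cstar_l2_inner: "cstar (l2_inner z w) = l2_inner w z"
  by (rule l2_inner_eqI[symmetric])
    (use bounded_linear.tendsto[OF bounded_linear_cstar l2_inner_tendsto[of z w]]
      in \<open>simp add: cstar_sum cstar_mult cstar_cstar\<close>)

lemma l2_inner_add_right: "l2_inner z (w + v) = l2_inner z w + l2_inner z v"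
  by (rule l2_inner_eqI)
    (use tendsto_add[OF l2_inner_tendsto[of z w] l2_inner_tendsto[of z v]]
      in \<open>simp add: plus_l2.rep_eq algebra_simps sum.distrib\<close>)

lemma l2_inner_scaleR_right: "l2_inner z (r *\<^sub>R w) = r *\<^sub>R l2_inner z w"
  by (rule l2_inner_eqI)
    (use tendsto_scaleR[OF tendsto_const l2_inner_tendsto[of z w], of r]
      in \<open>simp add: scaleR_l2.rep_eq scaleR_sum_right\<close>)

lemma l2_inner_diff_right: "l2_inner z (w - v) = l2_inner z w - l2_inner z v"
  using l2_inner_add_right[of z "w - v" v] by simp

lemma l2_inner_add_left: "l2_inner (z + w) v = l2_inner z v + l2_inner w v"
  by (metis cstar_add cstar_l2_inner l2_inner_add_right)

lemma l2_inner_diff_left: "l2_inner (z - w) v = l2_inner z v - l2_inner w v"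
  by (metis cstar_diff cstar_l2_inner l2_inner_diff_right)

lemma l2_inner_scaleR_left: "l2_inner (r *\<^sub>R z) w = r *\<^sub>R l2_inner z w"
  by (metis cstar_scaleR cstar_l2_inner l2_inner_scaleR_right)

lemma norm_l2_power2: "(norm z)\<^sup>2 = norm (l2_inner z z)"
  by (simp add: norm_l2_def)

lemma l2_inner_self_cpos: "cpos (l2_inner z z)"
  by (rule cpos_tendsto[OF l2_inner_tendsto])
    (auto intro!: eventually_finite_subsets_at_top_weakI cpos_sum cpos_cstar_mult_self)

lemma l2_inner_quadratic_cpos:
  "cpos (cstar c * l2_inner z z * c - cstar c * l2_inner z w - cstar (l2_inner z w) * c + l2_inner w w)"
  by (rule cpos_tendsto[OF tendsto_add[OF tendsto_diff[OF tendsto_diff[OF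
      tendsto_mult[OF tendsto_mult[OF tendsto_const l2_inner_tendsto] tendsto_const]
      tendsto_mult[OF tendsto_const l2_inner_tendsto]]
      tendsto_mult[OF bounded_linear.tendsto[OF bounded_linear_cstar l2_inner_tendsto] tendsto_const]]
      l2_inner_tendsto]])
    (auto intro!: fnorm_quadratic_cpos)

text \<open>Cauchy-Schwarz in the direct sum of copies of the module indexed by K. Applied term by
  term, the inequality would leave sums of norms, which the later count of overlaps cannot
  control.\<close>

lemma l2_sum_cauchy_schwarz:
  "(norm (\<Sum>k\<in>K. l2_inner (u k) (v k)))\<^sup>2
    \<le> norm (\<Sum>k\<in>K. l2_inner (u k) (u k)) * norm (\<Sum>k\<in>K. l2_inner (v k) (v k))"
proof (rule cauchy_schwarz_of_quadratic_cpos)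
  fix c
  have "cpos (\<Sum>k\<in>K. cstar c * l2_inner (u k) (u k) * c - cstar c * l2_inner (u k) (v k)
      - cstar (l2_inner (u k) (v k)) * c + l2_inner (v k) (v k))"
    by (intro cpos_sum l2_inner_quadratic_cpos)
  then show "cpos (cstar c * (\<Sum>k\<in>K. l2_inner (u k) (u k)) * c - cstar c * (\<Sum>k\<in>K. l2_inner (u k) (v k))
      - cstar (\<Sum>k\<in>K. l2_inner (u k) (v k)) * c + (\<Sum>k\<in>K. l2_inner (v k) (v k)))"
    by (simp add: sum.distrib sum_subtractf sum_distrib_left sum_distrib_right cstar_sum)
qed (intro cpos_sum l2_inner_self_cpos)

lemma l2_cauchy_schwarz: "norm (l2_inner z w) \<le> norm z * norm w"
proof (rule power2_le_imp_le)
  show "(norm (l2_inner z w))\<^sup>2 \<le> (norm z * norm w)\<^sup>2"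
    using l2_sum_cauchy_schwarz[of "\<lambda>_. z" "\<lambda>_. w" "{()}"]
    by (simp add: power_mult_distrib norm_l2_power2)
qed simp

lemma l2_eqI: "(\<And>v. l2_inner v z = l2_inner v w) \<Longrightarrow> z = w"
  using norm_l2_power2[of "z - w"] by (simp add: l2_inner_diff_right)

lemma l2_norm_le_of_inner:
  assumes "norm (l2_inner z z) \<le> C * norm z" "C \<ge> 0"
  shows "norm z \<le> C"
  using assms by (cases "norm z = 0") (auto simp: norm_l2_power2[symmetric] power2_eq_square)

subsection \<open>Adjointable operators\<close>

text \<open>Neither linearity nor boundedness is demanded of the two maps; both are consequences of
  the relation.\<close>

definition l2_adjoint :: "(('g, 'a::unital_cstar) l2 \<Rightarrow> ('g, 'a) l2) \<Rightarrow> (('g, 'a) l2 \<Rightarrow> ('g, 'a) l2) \<Rightarrow> bool" where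
  "l2_adjoint S T \<longleftrightarrow> (\<forall>z w. l2_inner (T z) w = l2_inner z (S w))"

lemma l2_adjointD: "l2_adjoint S T \<Longrightarrow> l2_inner (T z) w = l2_inner z (S w)"
  by (simp add: l2_adjoint_def)

lemma l2_adjoint_sym: "l2_adjoint S T \<Longrightarrow> l2_adjoint T S"
  unfolding l2_adjoint_def by (metis cstar_l2_inner)

lemma l2_adjoint_add:
  assumes "l2_adjoint S T" shows "T (z + w) = T z + T w"
  by (rule l2_eqI) (simp add: l2_adjointD[OF l2_adjoint_sym[OF assms], symmetric] l2_inner_add_right)

lemma l2_adjoint_scaleR:
  assumes "l2_adjoint S T" shows "T (r *\<^sub>R z) = r *\<^sub>R T z"
  by (rule l2_eqI)
    (simp add: l2_adjointD[OF l2_adjoint_sym[OF assms], symmetric] l2_inner_scaleR_right)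

lemma l2_adjoint_zero: "l2_adjoint S T \<Longrightarrow> T 0 = 0"
  using l2_adjoint_scaleR[of S T 0 0] by simp

text \<open>Gliding hump: if \<open>T\<close> is unbounded along unit vectors \<open>y n\<close>, then the value of \<open>S\<close> at a suitably signed sum
  of the vectors \<open>(1/3)\<^sup>n T (y n) / \<parallel>T (y n)\<parallel>\<close> would have arbitrarily large norm.\<close>

theorem l2_adjoint_bounded:
  fixes T S :: "('g, 'a::unital_cstar) l2 \<Rightarrow> ('g, 'a) l2"
  assumes adj: "l2_adjoint S T"
  shows "\<exists>C\<ge>0. \<forall>z. norm (T z) \<le> C * norm z"
proof (rule ccontr)
  assume "\<not> ?thesis"
  then have unb: "\<exists>z. norm (T z) > C * norm z" if "C \<ge> 0" for C
    using that by (meson not_le)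
  \<comment> \<open>Growth 4^n is played against weights 3^-n. Step n forces a value of at least
    \<open>(1/3)^n * b n\<close>, which exceeds (4/3)^n, while all later steps together move the
    point by at most \<open>3/2 * (1/3)^(n+1)\<close>, half of \<open>(1/3)^n\<close>. Hence half of
    the value survives in the limit.\<close>
  have "\<exists>y. norm y = 1 \<and> norm (T y) > 4 ^ n" for n :: nat
  proof -
    obtain z where z: "norm (T z) > 4 ^ n * norm z" using unb[of "4 ^ n"] by auto
    then have "z \<noteq> 0" using l2_adjoint_zero[OF adj] by auto
    with z show ?thesis
      by (intro exI[of _ "(1 / norm z) *\<^sub>R z"]) (simp add: l2_adjoint_scaleR[OF adj] divide_simps)
  qed
  then obtain y where y: "\<And>n. norm (y n) = 1" "\<And>n::nat. norm (T (y n)) > 4 ^ n" by metis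
  define b where "b n = norm (T (y n))" for n
  have b: "b n > 4 ^ n" for n using y(2) by (simp add: b_def)
  have b0: "b n > 0" for n using b[of n] less_trans[of 0 "4 ^ n" "b n"] by simp
  define f where "f n x = l2_inner (T (y n)) x" for n x
  have f_le: "norm (f n x) \<le> norm (S x)" for n x
    using l2_cauchy_schwarz[of "y n" "S x"] by (simp add: f_def l2_adjointD[OF adj] y)
  define d where "d n = ((1/3) ^ n / b n) *\<^sub>R T (y n)" for n
  have nd: "norm (d n) = (1/3) ^ n" for n using b0[of n] by (simp add: d_def flip: b_def)
  have fd: "norm (f n (d n)) = (1/3) ^ n * b n" for n
    using b0[of n]
    by (simp add: d_def f_def l2_inner_scaleR_right norm_l2_power2[symmetric] flip: b_def)
      (simp add: power2_eq_square)
  define x where "x = rec_nat 0 (\<lambda>n v. if norm (f n (v + d n)) \<ge> norm (f n (d n)) then v + d n else v - d n)"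
  have x_Suc: "x (Suc n) = (if norm (f n (x n + d n)) \<ge> norm (f n (d n)) then x n + d n else x n - d n)" for n
    by (simp add: x_def)
  have fx: "norm (f n (x (Suc n))) \<ge> (1/3) ^ n * b n" for n
  proof -
    \<comment> \<open>The values at the two candidates differ by 2 f(d), so at least one of them is
      no smaller in norm than f(d).\<close>
    have "f n (x n + d n) - f n (x n - d n) = 2 *\<^sub>R f n (d n)"
      by (simp add: f_def l2_inner_add_right l2_inner_diff_right scaleR_2)
    then have "2 * norm (f n (d n)) \<le> norm (f n (x n + d n)) + norm (f n (x n - d n))"
      using norm_triangle_ineq4[of "f n (x n + d n)" "f n (x n - d n)"] by simp
    then show ?thesis unfolding x_Suc fd[symmetric] by auto
  qed
  have step: "norm (x (Suc n) - x n) \<le> (1/3) ^ n" for n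
    by (simp add: x_Suc nd)
  have tail: "norm (x (n + k) - x n) \<le> 3/2 * ((1/3) ^ n - (1/3) ^ (n + k))" for n k
  proof (induction k)
    case (Suc k)
    have "norm (x (n + Suc k) - x n) \<le> norm (x (Suc (n + k)) - x (n + k)) + norm (x (n + k) - x n)"
      using norm_triangle_ineq[of "x (Suc (n + k)) - x (n + k)" "x (n + k) - x n"] by simp
    also have "\<dots> \<le> (1/3) ^ (n + k) + 3/2 * ((1/3) ^ n - (1/3) ^ (n + k))"
      using step Suc by (intro add_mono) auto
    finally show ?case by (simp add: algebra_simps)
  qed simp
  have tail': "norm (x m - x n) \<le> 3/2 * (1/3) ^ n" if "m \<ge> n" for m n
    using tail[of n "m - n"] that by (simp add: order_trans[OF _ diff_left_mono] algebra_simps)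
      (smt (verit) zero_le_power divide_nonneg_pos)
  have "Cauchy x"
  proof (rule metric_CauchyI)
    fix e :: real assume "e > 0"
    then obtain N where "(1/3::real) ^ N < e / 3"
      using real_arch_pow_inv[of "e / 3" "1/3"] by auto
    then have "dist (x m) (x n) < e" if "m \<ge> N" "n \<ge> N" for m n
      using norm_triangle_ineq4[of "x m - x N" "x n - x N"] tail'[OF that(1)] tail'[OF that(2)]
      by (simp add: dist_norm)
    then show "\<exists>M. \<forall>m\<ge>M. \<forall>n\<ge>M. dist (x m) (x n) < e" by blast
  qed
  then obtain l where l: "x \<longlonglongrightarrow> l" by (auto simp: Cauchy_convergent_iff convergent_def)
  have lx: "norm (l - x n) \<le> 3/2 * (1/3) ^ n" for n
    by (rule tendsto_upperbound[OF tendsto_norm[OF tendsto_diff[OF l tendsto_const]]])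
      (use tail' in \<open>auto simp: eventually_sequentially\<close>)
  have big: "(4/3) ^ n / 2 \<le> norm (S l)" for n
  proof -
    have "norm (f n (l - x (Suc n))) \<le> b n * (3/2 * (1/3) ^ Suc n)"
      unfolding f_def b_def
      by (rule order_trans[OF l2_cauchy_schwarz mult_left_mono[OF lx norm_ge_zero]])
    moreover have "norm (f n (x (Suc n))) \<le> norm (f n l) + norm (f n (l - x (Suc n)))"
      using norm_triangle_ineq4[of "f n l" "f n (l - x (Suc n))"]
      by (simp add: f_def l2_inner_diff_right)
    ultimately have "(1/3) ^ n * b n / 2 \<le> norm (f n l)"
      using fx[of n] by (simp add: algebra_simps)
    moreover have "(1/3) ^ n * 4 ^ n \<le> (1/3) ^ n * b n"
      using b[of n] by (intro mult_left_mono) auto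
    then have "(4/3) ^ n \<le> (1/3) ^ n * b n" by (simp flip: power_mult_distrib)
    ultimately show ?thesis using f_le[of n l] by linarith
  qed
  obtain n where "(4/3::real) ^ n > 2 * norm (S l)"
    using real_arch_pow[of "4/3" "2 * norm (S l)"] by auto
  with big[of n] show False by simp
qed

text \<open>Test the adjoint against itself:
  \<open>\<langle>S w, S w\<rangle> = \<langle>T (S w), w\<rangle>\<close>; then apply
  Cauchy-Schwarz and cancel one factor \<open>norm (S w)\<close>.\<close>

lemma l2_adjoint_norm_le:
  assumes adj: "l2_adjoint S T" and C: "C \<ge> 0" "\<And>z. norm (T z) \<le> C * norm z"
  shows "norm (S w) \<le> C * norm w"
proof (rule l2_norm_le_of_inner)
  have "norm (l2_inner (T (S w)) w) \<le> norm (T (S w)) * norm w" by (rule l2_cauchy_schwarz)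
  also have "\<dots> \<le> C * norm (S w) * norm w" by (intro mult_right_mono C) auto
  finally show "norm (l2_inner (S w) (S w)) \<le> C * norm w * norm (S w)"
    by (simp add: l2_adjointD[OF adj] ac_simps)
qed (use C in auto)

text \<open>With \<open>y = T\<^sup>* T\<close> scaled to a contraction, \<open>\<langle>y\<^sup>k z - z, y\<^sup>k z - z\<rangle> \<ge> 0\<close> says that
  \<open>d k = \<langle>z, z\<rangle> - \<langle>z, y\<^sup>k z\<rangle>\<close> satisfies \<open>d (2k) \<le> 2 d k\<close>; since \<open>d\<close> is bounded, \<open>d 1 \<ge> 0\<close>.\<close>

theorem l2_adjoint_inner_le:
  assumes adj: "l2_adjoint S T" and C: "C \<ge> 0" "\<And>z. norm (T z) \<le> C * norm z"
  shows "cpos (C\<^sup>2 *\<^sub>R l2_inner z z - l2_inner (T z) (T z))"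
proof (cases "C = 0")
  case True
  then have "T z = 0" using C(2)[of z] by simp
  then show ?thesis using True l2_inner_scaleR_left[of 0 "T z" "T z"] by simp
next
  case False
  define Y where "Y v = (1 / C\<^sup>2) *\<^sub>R S (T v)" for v
  have Y_norm: "norm (Y v) \<le> norm v" for v
  proof -
    have "norm (S (T v)) \<le> C * (C * norm v)"
      using l2_adjoint_norm_le[OF adj C, of "T v"] C by (meson mult_left_mono order_trans)
    then show ?thesis using False C by (simp add: Y_def divide_simps power2_eq_square ac_simps)
  qed
  have Y_adj: "l2_inner (Y v) w = l2_inner v (Y w)" for v w
    by (simp add: Y_def l2_inner_scaleR_left l2_inner_scaleR_right l2_adjointD[OF adj]
        l2_adjointD[OF l2_adjoint_sym[OF adj]])
  have Yk_norm: "norm ((Y ^^ k) z) \<le> norm z" for k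
    by (induction k) (auto intro: order_trans[OF Y_norm])
  have Yk_adj: "l2_inner ((Y ^^ k) v) w = l2_inner v ((Y ^^ k) w)" for k v w
    by (induction k arbitrary: w) (simp_all add: Y_adj, simp add: funpow_swap1)
  define d where "d k = l2_inner z z - l2_inner z ((Y ^^ k) z)" for k
  have double: "cpos (2 *\<^sub>R d k - d (2 * k))" for k
  proof -
    have "l2_inner ((Y ^^ k) z - z) ((Y ^^ k) z - z) = 2 *\<^sub>R d k - d (2 * k)"
      by (simp add: d_def l2_inner_diff_left l2_inner_diff_right Yk_adj scaleR_2 mult_2 funpow_add)
    then show ?thesis using l2_inner_self_cpos by metis
  qed
  have pos: "cpos (d 1 - (1/2) ^ n *\<^sub>R d (2 ^ n))" for n
  proof (induction n)
    case (Suc n)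
    have "cpos ((1/2) ^ Suc n *\<^sub>R (2 *\<^sub>R d (2 ^ n) - d (2 ^ Suc n)))"
      using double[of "2 ^ n"] by (intro cpos_scaleR) auto
    from cpos_add[OF Suc this] show ?case by (simp add: algebra_simps)
  qed simp
  have lim: "(\<lambda>n. d 1 - (1/2) ^ n *\<^sub>R d (2 ^ n)) \<longlonglongrightarrow> d 1 - 0"
  proof (rule tendsto_diff[OF tendsto_const tendsto_norm_zero_cancel])
    have bd: "norm (d k) \<le> 2 * (norm z)\<^sup>2" for k
    proof -
      have "norm (l2_inner z ((Y ^^ k) z)) \<le> norm z * norm z"
        by (rule order_trans[OF l2_cauchy_schwarz mult_left_mono[OF Yk_norm norm_ge_zero]])
      then show ?thesis
        using norm_triangle_ineq4[of "l2_inner z z" "l2_inner z ((Y ^^ k) z)"]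
        by (simp add: d_def norm_l2_power2[symmetric] power2_eq_square)
    qed
    have b1: "norm (norm ((1/2) ^ n *\<^sub>R d (2 ^ n))) \<le> (1/2) ^ n * (2 * (norm z)\<^sup>2)" for n
      using mult_left_mono[OF bd[of "2 ^ n"], of "(1/2) ^ n"] by simp
    have b2: "(\<lambda>n. (1/2) ^ n * (2 * (norm z)\<^sup>2)) \<longlonglongrightarrow> 0"
      by (rule tendsto_mult_left_zero[OF LIMSEQ_power_zero]) simp
    show "(\<lambda>n. norm ((1/2) ^ n *\<^sub>R d (2 ^ n))) \<longlonglongrightarrow> 0"
      by (rule Lim_null_comparison[OF always_eventually b2]) (rule allI, rule b1)
  qed
  have "cpos (d 1 - 0)"
    by (rule cpos_tendsto[OF lim sequentially_bot always_eventually]) (rule allI, rule pos)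
  then have "cpos (d 1)" by simp
  then have "cpos (C\<^sup>2 *\<^sub>R d 1)" by (intro cpos_scaleR) auto
  then show ?thesis
    using False by (simp add: d_def Y_def l2_inner_scaleR_right scaleR_diff_right l2_adjointD[OF adj])
qed

section \<open>Coordinatewise multiplication and restriction\<close>

lemma l2_fun_zero [simp]: "l2_fun 0 g = 0"
  by (simp add: zero_l2.rep_eq)

text \<open>Conjugating the positive element \<open>C^2 - cstar (c g) * c g\<close> by
  \<open>z g\<close> keeps it positive in every coordinate. Letting c depend on g covers left
  multiplication by a, where coordinate g sees the inverse automorphism applied to a, as well as
  truncation, where c is 0 or 1.\<close>

lemma fnorm_mult_left_le:
  fixes z :: "'g \<Rightarrow> 'a::unital_cstar"
  assumes "C \<ge> 0" "\<And>g. norm (c g) \<le> C"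
  shows "fnorm S (\<lambda>g. c g * z g) \<le> C * fnorm S z"
proof (rule power2_le_imp_le)
  have c: "cpos (of_real (C\<^sup>2) - cstar (c g) * c g)" for g
  proof -
    have "(norm (c g))\<^sup>2 \<le> C\<^sup>2" using assms(2)[of g] by (intro power_mono) auto
    then have "cpos (of_real (C\<^sup>2 - (norm (c g))\<^sup>2) :: 'a)" by (intro cpos_of_real) simp
    from cpos_add[OF this cpos_norm_square_diff[of "c g"]] show ?thesis by simp
  qed
  have "cpos (\<Sum>g\<in>S. cstar (z g) * (of_real (C\<^sup>2) - cstar (c g) * c g) * z g)"
    by (intro cpos_sum cpos_conj c)
  also have "(\<Sum>g\<in>S. cstar (z g) * (of_real (C\<^sup>2) - cstar (c g) * c g) * z g)
      = C\<^sup>2 *\<^sub>R (\<Sum>g\<in>S. cstar (z g) * z g) - (\<Sum>g\<in>S. cstar (c g * z g) * (c g * z g))"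
    unfolding scaleR_sum_right sum_subtractf[symmetric]
    by (intro sum.cong refl) (simp add: cstar_mult of_real_def algebra_simps)
  finally have "norm (\<Sum>g\<in>S. cstar (c g * z g) * (c g * z g)) \<le> norm (C\<^sup>2 *\<^sub>R (\<Sum>g\<in>S. cstar (z g) * z g))"
    by (intro norm_mono_cpos cpos_sum cpos_cstar_mult_self)
  then show "(fnorm S (\<lambda>g. c g * z g))\<^sup>2 \<le> (C * fnorm S z)\<^sup>2"
    by (simp add: fnorm_power2 power_mult_distrib)
qed (use assms in simp)

lemma l2_set_restrict: "z \<in> l2_set \<Longrightarrow> (\<lambda>g. if g \<in> B then z g else 0) \<in> l2_set"
proof (erule l2_set_dominated)
  fix S :: "'a set"
  have "(\<lambda>g. if g \<in> B then z g else 0) = (\<lambda>g. (if g \<in> B then 1 else 0) * z g)" by auto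
  then show "fnorm S (\<lambda>g. if g \<in> B then z g else 0) \<le> 1 * fnorm S z"
    using fnorm_mult_left_le[of 1 "\<lambda>g. if g \<in> B then 1 else 0" S z] by (simp del: mult_1_left mult_1)
qed

lift_definition l2_restrict :: "'g set \<Rightarrow> ('g, 'a::unital_cstar) l2 \<Rightarrow> ('g, 'a) l2"
  is "\<lambda>B z g. if g \<in> B then z g else 0"
  by (rule l2_set_restrict)

text \<open>Interchanging the sums counts, for each coordinate h, the sets \<open>B k\<close> that
  contain h. As the comparison takes place in the order of A, only the overlap number n enters and
  not the size of K.\<close>

lemma l2_restrict_sum_inner_le:
  assumes "finite K" "\<And>h. card {k \<in> K. h \<in> B k} \<le> n"
  shows "cpos (real n *\<^sub>R l2_inner z z - (\<Sum>k\<in>K. l2_inner (l2_restrict (B k) z) (l2_restrict (B k) z)))"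
proof (rule cpos_tendsto)
  let ?q = "\<lambda>h. cstar (l2_fun z h) * l2_fun z h"
  show "((\<lambda>S. real n *\<^sub>R (\<Sum>h\<in>S. ?q h) - (\<Sum>k\<in>K. \<Sum>h\<in>S.
      cstar (l2_fun (l2_restrict (B k) z) h) * l2_fun (l2_restrict (B k) z) h))
      \<longlongrightarrow> real n *\<^sub>R l2_inner z z - (\<Sum>k\<in>K. l2_inner (l2_restrict (B k) z) (l2_restrict (B k) z)))
      (finite_subsets_at_top UNIV)"
    by (intro tendsto_diff tendsto_scaleR tendsto_const tendsto_sum l2_inner_tendsto)
  have "cpos (real n *\<^sub>R (\<Sum>h\<in>S. ?q h) - (\<Sum>k\<in>K. \<Sum>h\<in>S.
      cstar (l2_fun (l2_restrict (B k) z) h) * l2_fun (l2_restrict (B k) z) h))" for S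
  proof -
    have "(\<Sum>k\<in>K. \<Sum>h\<in>S. cstar (l2_fun (l2_restrict (B k) z) h) * l2_fun (l2_restrict (B k) z) h)
        = (\<Sum>h\<in>S. \<Sum>k\<in>K. if h \<in> B k then ?q h else 0)"
      by (subst sum.swap) (auto simp: l2_restrict.rep_eq intro!: sum.cong)
    also have "\<dots> = (\<Sum>h\<in>S. real (card {k \<in> K. h \<in> B k}) *\<^sub>R ?q h)"
      using assms(1) by (simp add: sum.inter_filter[symmetric] scaleR_conv_of_real)
    finally have "real n *\<^sub>R (\<Sum>h\<in>S. ?q h) - (\<Sum>k\<in>K. \<Sum>h\<in>S.
        cstar (l2_fun (l2_restrict (B k) z) h) * l2_fun (l2_restrict (B k) z) h)
        = (\<Sum>h\<in>S. (real n - real (card {k \<in> K. h \<in> B k})) *\<^sub>R ?q h)"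
      by (simp add: scaleR_sum_right sum_subtractf scaleR_diff_left)
    then show ?thesis
      using assms(2) by (auto intro!: cpos_sum cpos_scaleR cpos_cstar_mult_self)
  qed
  then show "\<forall>\<^sub>F S in finite_subsets_at_top UNIV. cpos (real n *\<^sub>R (\<Sum>h\<in>S. ?q h) - (\<Sum>k\<in>K. \<Sum>h\<in>S.
      cstar (l2_fun (l2_restrict (B k) z) h) * l2_fun (l2_restrict (B k) z) h))"
    by simp
qed simp

section \<open>Automorphisms and cocycle of a twisted system\<close>

locale twisted =
  fixes \<alpha> :: "'g::group_add \<Rightarrow> 'a::unital_cstar \<Rightarrow> 'a" and \<sigma> :: "'g \<Rightarrow> 'g \<Rightarrow> 'a"
  assumes twisted: "twisted_system \<alpha> \<sigma>"
begin

abbreviation \<beta> :: "'g \<Rightarrow> 'a \<Rightarrow> 'a" where "\<beta> g \<equiv> inv (\<alpha> g)"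

lemma aut: "cstar_aut (\<alpha> g)"
  using twisted by (simp add: twisted_system_def)

lemma aut_inv: "cstar_aut (\<beta> g)"
  by (rule cstar_aut_inv[OF aut])

lemma \<alpha>_hom [simp]:
  "\<alpha> g 0 = 0" "\<alpha> g 1 = 1" "\<alpha> g (x + y) = \<alpha> g x + \<alpha> g y" "\<alpha> g (x - y) = \<alpha> g x - \<alpha> g y"
  "\<alpha> g (x * y) = \<alpha> g x * \<alpha> g y" "\<alpha> g (r *\<^sub>R x) = r *\<^sub>R \<alpha> g x" "\<alpha> g (cscale c x) = cscale c (\<alpha> g x)"
  "\<alpha> g (cstar x) = cstar (\<alpha> g x)" "norm (\<alpha> g x) = norm x"
  using aut[of g] by (simp_all add: cstar_aut_zero cstar_aut_one cstar_aut_diff cstar_aut_scaleR cstar_aut_norm)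
    (simp_all add: cstar_aut_def)

lemma \<beta>_hom [simp]:
  "\<beta> g 0 = 0" "\<beta> g 1 = 1" "\<beta> g (x + y) = \<beta> g x + \<beta> g y" "\<beta> g (x - y) = \<beta> g x - \<beta> g y"
  "\<beta> g (x * y) = \<beta> g x * \<beta> g y" "\<beta> g (r *\<^sub>R x) = r *\<^sub>R \<beta> g x" "\<beta> g (cscale c x) = cscale c (\<beta> g x)"
  "\<beta> g (cstar x) = cstar (\<beta> g x)" "norm (\<beta> g x) = norm x"
  using aut_inv[of g] by (simp_all add: cstar_aut_zero cstar_aut_one cstar_aut_diff cstar_aut_scaleR cstar_aut_norm)
    (simp_all add: cstar_aut_def)

lemma bij_\<alpha>: "bij (\<alpha> g)"
  using aut[of g] by (simp add: cstar_aut_def)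

lemma \<alpha>_\<beta> [simp]: "\<alpha> g (\<beta> g x) = x"
  using bij_\<alpha> by (simp add: bij_is_surj surj_f_inv_f)

lemma \<beta>_\<alpha> [simp]: "\<beta> g (\<alpha> g x) = x"
  using bij_\<alpha> by (simp add: bij_is_inj)

lemma \<sigma>_unitary [simp]:
  "\<sigma> g h * cstar (\<sigma> g h) = 1" "cstar (\<sigma> g h) * \<sigma> g h = 1"
  "\<sigma> g h * (cstar (\<sigma> g h) * x) = x" "cstar (\<sigma> g h) * (\<sigma> g h * x) = x"
proof -
  show *: "\<sigma> g h * cstar (\<sigma> g h) = 1" "cstar (\<sigma> g h) * \<sigma> g h = 1"
    using twisted by (simp_all add: twisted_system_def unitary_def)
  then show "\<sigma> g h * (cstar (\<sigma> g h) * x) = x" "cstar (\<sigma> g h) * (\<sigma> g h * x) = x"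
    by (metis mult.assoc mult_1)+
qed

lemma \<alpha>_\<alpha>: "\<alpha> g (\<alpha> h a) = \<sigma> g h * \<alpha> (g + h) a * cstar (\<sigma> g h)"
  using twisted by (simp add: twisted_system_def)

lemma cocycle: "\<sigma> g h * \<sigma> (g + h) k = \<alpha> g (\<sigma> h k) * \<sigma> g (h + k)"
  using twisted by (simp add: twisted_system_def)

lemma \<sigma>_zero [simp]: "\<sigma> g 0 = 1" "\<sigma> 0 g = 1"
  using twisted by (simp_all add: twisted_system_def)

lemma \<alpha>_zero [simp]: "\<alpha> 0 x = x"
  using \<alpha>_\<alpha>[of 0 0 x] by simp (metis \<beta>_\<alpha>)

text \<open>Inverse form of the twisted composition law. The factor
  \<open>cstar (\<sigma> g h)\<close> stands on the left because \<open>lamb\<close> produces it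
  there in inner products.\<close>

lemma \<beta>_add: "\<beta> (g + h) (cstar (\<sigma> g h) * x) = \<beta> h (\<beta> g (x * cstar (\<sigma> g h)))"
proof -
  let ?c = "\<beta> h (\<beta> g (x * cstar (\<sigma> g h)))"
  have "\<sigma> g h * \<alpha> (g + h) ?c * cstar (\<sigma> g h) = x * cstar (\<sigma> g h)"
    unfolding \<alpha>_\<alpha>[symmetric] by (simp del: \<beta>_hom)
  then have "cstar (\<sigma> g h) * (\<sigma> g h * \<alpha> (g + h) ?c * cstar (\<sigma> g h)) * \<sigma> g h
      = cstar (\<sigma> g h) * (x * cstar (\<sigma> g h)) * \<sigma> g h" by simp
  then have "\<alpha> (g + h) ?c = cstar (\<sigma> g h) * x" by (simp add: mult.assoc del: \<beta>_hom \<alpha>_hom)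
  then show ?thesis by (metis \<beta>_\<alpha>)
qed

subsection \<open>Identification of the module with the standard one\<close>

definition to_l2 :: "('g \<Rightarrow> 'a) \<Rightarrow> ('g, 'a) l2" where
  "to_l2 \<xi> = Abs_l2 (\<lambda>g. \<beta> g (\<xi> g))"

definition of_l2 :: "('g, 'a) l2 \<Rightarrow> ('g \<Rightarrow> 'a)" where
  "of_l2 z = (\<lambda>g. \<alpha> g (l2_fun z g))"

lemma modset_iff: "\<xi> \<in> modset \<alpha> \<longleftrightarrow> (\<lambda>g. \<beta> g (\<xi> g)) \<in> l2_set"
  by (simp add: modset_def l2_set_def)

lemma l2_fun_to_l2 [simp]: "\<xi> \<in> modset \<alpha> \<Longrightarrow> l2_fun (to_l2 \<xi>) = (\<lambda>g. \<beta> g (\<xi> g))"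
  by (simp add: to_l2_def modset_iff Abs_l2_inverse)

lemma of_l2_in_modset [simp]: "of_l2 z \<in> modset \<alpha>"
  using l2_fun[of z] by (simp add: modset_iff of_l2_def)

lemma to_l2_of_l2 [simp]: "to_l2 (of_l2 z) = z"
  by (simp add: to_l2_def of_l2_def l2_fun_inverse)

lemma of_l2_to_l2 [simp]: "\<xi> \<in> modset \<alpha> \<Longrightarrow> of_l2 (to_l2 \<xi>) = \<xi>"
  by (simp add: of_l2_def)

lemma minner_eq: "\<xi> \<in> modset \<alpha> \<Longrightarrow> \<eta> \<in> modset \<alpha> \<Longrightarrow> minner \<alpha> \<xi> \<eta> = l2_inner (to_l2 \<xi>) (to_l2 \<eta>)"
  by (simp add: minner_def l2_inner.rep_eq)

lemma mnorm_eq: "\<xi> \<in> modset \<alpha> \<Longrightarrow> mnorm \<alpha> \<xi> = norm (to_l2 \<xi>)"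
  by (simp add: mnorm_def minner_eq norm_l2_def)

lemma to_l2_inject: "\<xi> \<in> modset \<alpha> \<Longrightarrow> \<eta> \<in> modset \<alpha> \<Longrightarrow> to_l2 \<xi> = to_l2 \<eta> \<Longrightarrow> \<xi> = \<eta>"
  by (metis of_l2_to_l2)

lemma modset_zero [simp]: "(\<lambda>_. 0) \<in> modset \<alpha>"
  by (simp add: modset_iff l2_set_zero)

lemma modset_add: "\<xi> \<in> modset \<alpha> \<Longrightarrow> \<eta> \<in> modset \<alpha> \<Longrightarrow> (\<lambda>h. \<xi> h + \<eta> h) \<in> modset \<alpha>"
  by (simp add: modset_iff l2_set_add)

lemma modset_scaleR: "\<xi> \<in> modset \<alpha> \<Longrightarrow> (\<lambda>h. r *\<^sub>R \<xi> h) \<in> modset \<alpha>"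
  by (simp add: modset_iff l2_set_scaleR)

lemma modset_diff: "\<xi> \<in> modset \<alpha> \<Longrightarrow> \<eta> \<in> modset \<alpha> \<Longrightarrow> (\<lambda>h. \<xi> h - \<eta> h) \<in> modset \<alpha>"
  using modset_add[of \<xi> "\<lambda>h. (- 1) *\<^sub>R \<eta> h"] modset_scaleR[of \<eta> "- 1"] by simp

lemma modset_restrict: "\<xi> \<in> modset \<alpha> \<Longrightarrow> (\<lambda>h. if h \<in> B then \<xi> h else 0) \<in> modset \<alpha>"
  using l2_set_restrict[of "\<lambda>g. \<beta> g (\<xi> g)" B] by (simp add: modset_iff if_distrib cong: if_cong)

lemma modset_mult_left:
  assumes "\<xi> \<in> modset \<alpha>"
  shows "(\<lambda>h. a * \<xi> h) \<in> modset \<alpha>" "mnorm \<alpha> (\<lambda>h. a * \<xi> h) \<le> norm a * mnorm \<alpha> \<xi>"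
proof -
  have *: "fnorm S (\<lambda>g. \<beta> g (a * \<xi> g)) \<le> norm a * fnorm S (\<lambda>g. \<beta> g (\<xi> g))" for S
    using fnorm_mult_left_le[of "norm a" "\<lambda>g. \<beta> g a" S "\<lambda>g. \<beta> g (\<xi> g)"] by simp
  show m: "(\<lambda>h. a * \<xi> h) \<in> modset \<alpha>"
    using assms unfolding modset_iff by (rule l2_set_dominated) (rule *)
  show "mnorm \<alpha> (\<lambda>h. a * \<xi> h) \<le> norm a * mnorm \<alpha> \<xi>"
    unfolding mnorm_eq[OF m] mnorm_eq[OF assms]
  proof (rule norm_l2_le)
    fix S :: "'g set" assume "finite S"
    then have "fnorm S (\<lambda>g. \<beta> g (\<xi> g)) \<le> norm (to_l2 \<xi>)"
      using fnorm_le_norm_l2[of S "to_l2 \<xi>"] assms by simp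
    with * show "fnorm S (l2_fun (to_l2 (\<lambda>h. a * \<xi> h))) \<le> norm a * norm (to_l2 \<xi>)"
      unfolding l2_fun_to_l2[OF m] by (meson mult_left_mono norm_ge_zero order_trans)
  qed
qed

lemma to_l2_add: "\<xi> \<in> modset \<alpha> \<Longrightarrow> \<eta> \<in> modset \<alpha> \<Longrightarrow> to_l2 (\<lambda>h. \<xi> h + \<eta> h) = to_l2 \<xi> + to_l2 \<eta>"
  by (intro l2_fun_inject[THEN iffD1]) (simp add: modset_add plus_l2.rep_eq)

lemma to_l2_diff: "\<xi> \<in> modset \<alpha> \<Longrightarrow> \<eta> \<in> modset \<alpha> \<Longrightarrow> to_l2 (\<lambda>h. \<xi> h - \<eta> h) = to_l2 \<xi> - to_l2 \<eta>"
  by (intro l2_fun_inject[THEN iffD1]) (simp add: modset_diff minus_l2.rep_eq)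

lemma to_l2_scaleR: "\<xi> \<in> modset \<alpha> \<Longrightarrow> to_l2 (\<lambda>h. r *\<^sub>R \<xi> h) = r *\<^sub>R to_l2 \<xi>"
  by (intro l2_fun_inject[THEN iffD1]) (simp add: modset_scaleR scaleR_l2.rep_eq)

lemma to_l2_restrict:
  "\<xi> \<in> modset \<alpha> \<Longrightarrow> to_l2 (\<lambda>h. if h \<in> B then \<xi> h else 0) = l2_restrict B (to_l2 \<xi>)"
  by (intro l2_fun_inject[THEN iffD1]) (auto simp: modset_restrict l2_restrict.rep_eq)

lemma mnorm_zero [simp]: "mnorm \<alpha> (\<lambda>_. 0) = 0"
  by (simp add: mnorm_def minner_def)

lemma mnorm_nonneg [simp]: "mnorm \<alpha> \<xi> \<ge> 0"
  by (simp add: mnorm_def)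

lemma mnorm_add_le:
  "\<xi> \<in> modset \<alpha> \<Longrightarrow> \<eta> \<in> modset \<alpha> \<Longrightarrow> mnorm \<alpha> (\<lambda>h. \<xi> h + \<eta> h) \<le> mnorm \<alpha> \<xi> + mnorm \<alpha> \<eta>"
  by (simp add: mnorm_eq modset_add to_l2_add norm_triangle_ineq)

lemma mnorm_scaleR: "\<xi> \<in> modset \<alpha> \<Longrightarrow> mnorm \<alpha> (\<lambda>h. r *\<^sub>R \<xi> h) = \<bar>r\<bar> * mnorm \<alpha> \<xi>"
  by (simp add: mnorm_eq modset_scaleR to_l2_scaleR)

lemma mnorm_diff_commute:
  "\<xi> \<in> modset \<alpha> \<Longrightarrow> \<eta> \<in> modset \<alpha> \<Longrightarrow> mnorm \<alpha> (\<lambda>h. \<xi> h - \<eta> h) = mnorm \<alpha> (\<lambda>h. \<eta> h - \<xi> h)"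
  by (simp add: mnorm_eq modset_diff to_l2_diff norm_minus_commute)

lemma mnorm_eq_0D: "\<xi> \<in> modset \<alpha> \<Longrightarrow> mnorm \<alpha> \<xi> = 0 \<Longrightarrow> \<xi> = (\<lambda>_. 0)"
  by (metis l2_fun_zero mnorm_eq norm_eq_zero of_l2_def of_l2_to_l2 \<alpha>_hom(1))

lemma norm_le_mnorm: "\<xi> \<in> modset \<alpha> \<Longrightarrow> norm (\<xi> g) \<le> mnorm \<alpha> \<xi>"
  using norm_l2_fun_le[of "to_l2 \<xi>" g] by (simp add: mnorm_eq)

section \<open>Adjointable operators on the module and their norm\<close>

definition lift :: "(('g \<Rightarrow> 'a) \<Rightarrow> ('g \<Rightarrow> 'a)) \<Rightarrow> ('g, 'a) l2 \<Rightarrow> ('g, 'a) l2" where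
  "lift T z = to_l2 (T (of_l2 z))"

lemma adjointable_modset: "adjointable \<alpha> T \<Longrightarrow> \<xi> \<in> modset \<alpha> \<Longrightarrow> T \<xi> \<in> modset \<alpha>"
  by (simp add: adjointable_def)

lemma adjointable_outside: "adjointable \<alpha> T \<Longrightarrow> \<xi> \<notin> modset \<alpha> \<Longrightarrow> T \<xi> = (\<lambda>_. 0)"
  by (simp add: adjointable_def op_ext_def)

lemma l2_adjoint_lift:
  assumes "is_adjoint_of \<alpha> S T" "\<And>\<xi>. \<xi> \<in> modset \<alpha> \<Longrightarrow> T \<xi> \<in> modset \<alpha>"
  shows "l2_adjoint (lift S) (lift T)"
  unfolding l2_adjoint_def
proof (intro allI)
  fix z w
  have "minner \<alpha> (T (of_l2 z)) (of_l2 w) = minner \<alpha> (of_l2 z) (S (of_l2 w))"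
    using assms(1) by (simp add: is_adjoint_of_def)
  moreover have "S (of_l2 w) \<in> modset \<alpha>" using assms(1) by (simp add: is_adjoint_of_def)
  ultimately show "l2_inner (lift T z) w = l2_inner z (lift S w)"
    by (simp add: minner_eq assms(2) lift_def)
qed

lemma adjointable_l2_adjoint:
  assumes "adjointable \<alpha> T"
  obtains S where "l2_adjoint S (lift T)"
  using assms l2_adjoint_lift unfolding adjointable_def by metis

lemma to_l2_op: "adjointable \<alpha> T \<Longrightarrow> \<xi> \<in> modset \<alpha> \<Longrightarrow> to_l2 (T \<xi>) = lift T (to_l2 \<xi>)"
  by (simp add: lift_def)

lemma adjointable_bounded:
  assumes "adjointable \<alpha> T"
  obtains C where "C \<ge> 0" "\<And>\<xi>. \<xi> \<in> modset \<alpha> \<Longrightarrow> mnorm \<alpha> (T \<xi>) \<le> C * mnorm \<alpha> \<xi>"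
proof -
  obtain S where "l2_adjoint S (lift T)" using adjointable_l2_adjoint[OF assms] .
  then obtain C where "C \<ge> 0" "\<And>z. norm (lift T z) \<le> C * norm z"
    using l2_adjoint_bounded by blast
  then show ?thesis
    using assms by (intro that[of C]) (simp_all add: mnorm_eq adjointable_modset to_l2_op)
qed

lemma adjointable_add:
  assumes T: "adjointable \<alpha> T" and m: "\<xi> \<in> modset \<alpha>" "\<eta> \<in> modset \<alpha>"
  shows "T (\<lambda>h. \<xi> h + \<eta> h) = (\<lambda>h. T \<xi> h + T \<eta> h)"
proof -
  obtain S where "l2_adjoint S (lift T)" using adjointable_l2_adjoint[OF T] .
  then show ?thesis
    using T m by (intro to_l2_inject)
      (simp_all add: adjointable_modset modset_add to_l2_op to_l2_add l2_adjoint_add)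
qed

lemma adjointable_scaleR:
  assumes T: "adjointable \<alpha> T" and m: "\<xi> \<in> modset \<alpha>"
  shows "T (\<lambda>h. r *\<^sub>R \<xi> h) = (\<lambda>h. r *\<^sub>R T \<xi> h)"
proof -
  obtain S where "l2_adjoint S (lift T)" using adjointable_l2_adjoint[OF T] .
  then show ?thesis
    using T m by (intro to_l2_inject)
      (simp_all add: adjointable_modset modset_scaleR to_l2_op to_l2_scaleR l2_adjoint_scaleR)
qed

lemma adjointable_zero: "adjointable \<alpha> T \<Longrightarrow> T (\<lambda>_. 0) = (\<lambda>_. 0)"
  using adjointable_scaleR[of T "\<lambda>_. 0" 0] by simp

lemma adjointable_diff:
  assumes T: "adjointable \<alpha> T" and m: "\<xi> \<in> modset \<alpha>" "\<eta> \<in> modset \<alpha>"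
  shows "T (\<lambda>h. \<xi> h - \<eta> h) = (\<lambda>h. T \<xi> h - T \<eta> h)"
  using adjointable_add[OF T m(1) modset_scaleR[OF m(2)], of "- 1"] adjointable_scaleR[OF T m(2), of "- 1"]
  by simp

lemma opnorm_le:
  assumes "C \<ge> 0" "\<And>\<xi>. \<xi> \<in> modset \<alpha> \<Longrightarrow> mnorm \<alpha> (T \<xi>) \<le> C * mnorm \<alpha> \<xi>"
  shows "opnorm \<alpha> T \<le> C"
  unfolding opnorm_def
proof (rule cSup_least)
  show "(\<lambda>\<xi>. mnorm \<alpha> (T \<xi>)) ` {\<xi> \<in> modset \<alpha>. mnorm \<alpha> \<xi> \<le> 1} \<noteq> {}"
    using modset_zero by fastforce
  fix x assume "x \<in> (\<lambda>\<xi>. mnorm \<alpha> (T \<xi>)) ` {\<xi> \<in> modset \<alpha>. mnorm \<alpha> \<xi> \<le> 1}"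
  then obtain \<xi> where \<xi>: "\<xi> \<in> modset \<alpha>" "mnorm \<alpha> \<xi> \<le> 1" "x = mnorm \<alpha> (T \<xi>)" by auto
  have "C * mnorm \<alpha> \<xi> \<le> C" using \<xi> assms(1) by (simp add: mult_left_le)
  with assms(2)[OF \<xi>(1)] \<xi> show "x \<le> C" by simp
qed

text \<open>A supremum bounds its members only if the set is bounded above; here the automatic
  boundedness of adjointable operators enters.\<close>

lemma mnorm_le_opnorm_unit:
  assumes T: "adjointable \<alpha> T" and "\<eta> \<in> modset \<alpha>" "mnorm \<alpha> \<eta> \<le> 1"
  shows "mnorm \<alpha> (T \<eta>) \<le> opnorm \<alpha> T"
proof -
  obtain C where C: "C \<ge> 0" "\<And>\<xi>. \<xi> \<in> modset \<alpha> \<Longrightarrow> mnorm \<alpha> (T \<xi>) \<le> C * mnorm \<alpha> \<xi>"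
    using adjointable_bounded[OF T] by blast
  have "bdd_above ((\<lambda>\<xi>. mnorm \<alpha> (T \<xi>)) ` {\<xi> \<in> modset \<alpha>. mnorm \<alpha> \<xi> \<le> 1})"
  proof (rule bdd_aboveI2)
    fix \<zeta> assume "\<zeta> \<in> {\<xi> \<in> modset \<alpha>. mnorm \<alpha> \<xi> \<le> 1}"
    then show "mnorm \<alpha> (T \<zeta>) \<le> C"
      using C(2)[of \<zeta>] mult_left_le[of "mnorm \<alpha> \<zeta>" C] C(1) by auto
  qed
  then show ?thesis unfolding opnorm_def by (rule cSup_upper[rotated]) (use assms in auto)
qed

lemma opnorm_nonneg: "adjointable \<alpha> T \<Longrightarrow> opnorm \<alpha> T \<ge> 0"
  using mnorm_le_opnorm_unit[of T "\<lambda>_. 0"] by (simp add: adjointable_zero)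

lemma mnorm_le_opnorm:
  assumes T: "adjointable \<alpha> T" and m: "\<xi> \<in> modset \<alpha>"
  shows "mnorm \<alpha> (T \<xi>) \<le> opnorm \<alpha> T * mnorm \<alpha> \<xi>"
proof (cases "mnorm \<alpha> \<xi> = 0")
  case True
  then have "\<xi> = (\<lambda>_. 0)" by (rule mnorm_eq_0D[OF m])
  then show ?thesis by (simp add: adjointable_zero[OF T])
next
  case False
  then have pos: "mnorm \<alpha> \<xi> > 0" using mnorm_nonneg[of \<xi>] by linarith
  have "mnorm \<alpha> (T (\<lambda>h. (1 / mnorm \<alpha> \<xi>) *\<^sub>R \<xi> h)) \<le> opnorm \<alpha> T"
    using m pos by (intro mnorm_le_opnorm_unit[OF T]) (simp_all add: modset_scaleR mnorm_scaleR)
  then show ?thesis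
    using pos by (simp add: adjointable_scaleR[OF T m] mnorm_scaleR adjointable_modset[OF T m] divide_simps)
qed

lemma adjointableI:
  assumes "\<And>\<xi>. \<xi> \<notin> modset \<alpha> \<Longrightarrow> T \<xi> = (\<lambda>_. 0)" "\<And>\<xi>. \<xi> \<in> modset \<alpha> \<Longrightarrow> T \<xi> \<in> modset \<alpha>"
    "is_adjoint_of \<alpha> S T"
  shows "adjointable \<alpha> T"
  using assms by (auto simp: adjointable_def op_ext_def)

lemma is_adjoint_of_op_add:
  assumes "is_adjoint_of \<alpha> S1 T1" "is_adjoint_of \<alpha> S2 T2" "adjointable \<alpha> T1" "adjointable \<alpha> T2"
  shows "is_adjoint_of \<alpha> (op_add S1 S2) (op_add T1 T2)"
  using assms(1,2) unfolding is_adjoint_of_def op_add_def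
  by (simp add: modset_add minner_eq to_l2_add l2_inner_add_left l2_inner_add_right
      adjointable_modset[OF assms(3)] adjointable_modset[OF assms(4)])

lemma is_adjoint_of_comp:
  assumes "is_adjoint_of \<alpha> S1 T1" "is_adjoint_of \<alpha> S2 T2" "adjointable \<alpha> T2"
  shows "is_adjoint_of \<alpha> (S2 \<circ> S1) (T1 \<circ> T2)"
  using assms(1,2) unfolding is_adjoint_of_def by (simp add: adjointable_modset[OF assms(3)])

lemma adjointable_op_add:
  assumes "adjointable \<alpha> T1" "adjointable \<alpha> T2" shows "adjointable \<alpha> (op_add T1 T2)"
proof -
  obtain S1 S2 where "is_adjoint_of \<alpha> S1 T1" "is_adjoint_of \<alpha> S2 T2"
    using assms unfolding adjointable_def by blast
  from is_adjoint_of_op_add[OF this assms] show ?thesis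
    by (intro adjointableI) (simp_all add: op_add_def adjointable_outside[OF assms(1)]
        adjointable_outside[OF assms(2)] modset_add adjointable_modset[OF assms(1)] adjointable_modset[OF assms(2)])
qed

lemma adjointable_comp:
  assumes "adjointable \<alpha> T1" "adjointable \<alpha> T2" shows "adjointable \<alpha> (T1 \<circ> T2)"
proof -
  obtain S1 S2 where "is_adjoint_of \<alpha> S1 T1" "is_adjoint_of \<alpha> S2 T2"
    using assms unfolding adjointable_def by blast
  from is_adjoint_of_comp[OF this assms(2)] show ?thesis
    by (intro adjointableI) (simp_all add: adjointable_outside[OF assms(2)] adjointable_zero[OF assms(1)]
        adjointable_modset[OF assms(1)] adjointable_modset[OF assms(2)])
qed

lemma is_adjoint_of_lmult: "is_adjoint_of \<alpha> (lmult \<alpha> (cstar a)) (lmult \<alpha> a)"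
  unfolding is_adjoint_of_def by (simp add: lmult_def modset_mult_left minner_def cstar_mult mult.assoc)

lemma adjointable_lmult: "adjointable \<alpha> (lmult \<alpha> a)"
  by (rule adjointableI[OF _ _ is_adjoint_of_lmult]) (simp_all add: lmult_def modset_mult_left)

text \<open>Complex scalars act as left multiplication by c times the unit, so adjointability of
  \<open>op_scale\<close> reduces to that of \<open>lmult\<close> and of compositions.\<close>

lemma op_scale_eq_lmult_comp:
  assumes "adjointable \<alpha> T"
  shows "op_scale c T = lmult \<alpha> (cscale c 1) \<circ> T"
proof
  fix \<xi>
  have "T \<xi> \<in> modset \<alpha>"
    by (cases "\<xi> \<in> modset \<alpha>") (simp_all add: adjointable_modset[OF assms] adjointable_outside[OF assms])
  then show "op_scale c T \<xi> = (lmult \<alpha> (cscale c 1) \<circ> T) \<xi>"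
    by (simp add: op_scale_def lmult_def flip: cscale_left_mult)
qed

lemma adjointable_op_scale: "adjointable \<alpha> T \<Longrightarrow> adjointable \<alpha> (op_scale c T)"
  by (simp add: op_scale_eq_lmult_comp adjointable_comp adjointable_lmult)

lemma op_diff_eq: "op_diff T S = op_add T (op_scale (- 1) S)"
  by (simp add: op_diff_def op_add_def op_scale_def cscale_minus_one)

lemma adjointable_op_diff: "adjointable \<alpha> T \<Longrightarrow> adjointable \<alpha> S \<Longrightarrow> adjointable \<alpha> (op_diff T S)"
  by (simp add: op_diff_eq adjointable_op_add adjointable_op_scale)

section \<open>Translation operators and their adjoints\<close>

text \<open>The inverse of \<open>lamb \<alpha> \<sigma> g\<close>, found by solving
  \<open>lamb_shift\<close> for \<xi>. It is not cut off outside the module, since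
  \<open>is_adjoint_of\<close> tests module elements only.\<close>

definition lamb_star :: "'g \<Rightarrow> ('g \<Rightarrow> 'a) \<Rightarrow> ('g \<Rightarrow> 'a)" where
  "lamb_star g \<eta> = (\<lambda>h. \<beta> g (\<eta> (g + h) * cstar (\<sigma> g h)))"

lemma bij_shift: "bij_betw ((+) (g::'g)) UNIV UNIV"
  by (rule bij_betwI[where g="(+) (- g)"]) (auto simp: add.assoc[symmetric])

lemma lamb_shift: "\<xi> \<in> modset \<alpha> \<Longrightarrow> lamb \<alpha> \<sigma> g \<xi> (g + h) = \<alpha> g (\<xi> h) * \<sigma> g h"
  by (simp add: lamb_def add.assoc[symmetric])

text \<open>After the substitution k = g + h the inner products match term by term, so the isometry
  of \<open>lamb\<close> and its adjoint relation both follow by reindexing the series.\<close>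

lemma lamb_inner_shift:
  assumes "\<xi> \<in> modset \<alpha>"
  shows "\<beta> (g + h) (cstar (lamb \<alpha> \<sigma> g \<xi> (g + h)) * y) = \<beta> h (cstar (\<xi> h) * \<beta> g (y * cstar (\<sigma> g h)))"
proof -
  have "\<beta> (g + h) (cstar (lamb \<alpha> \<sigma> g \<xi> (g + h)) * y)
      = \<beta> (g + h) (cstar (\<sigma> g h) * (\<alpha> g (cstar (\<xi> h)) * y))"
    by (simp add: lamb_shift[OF assms] cstar_mult mult.assoc del: \<beta>_hom)
  also have "\<dots> = \<beta> h (\<beta> g (\<alpha> g (cstar (\<xi> h)) * y * cstar (\<sigma> g h)))" by (rule \<beta>_add)
  also have "\<dots> = \<beta> h (cstar (\<xi> h) * \<beta> g (y * cstar (\<sigma> g h)))"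
    by (simp add: mult.assoc \<beta>_hom(5)[of g "\<alpha> g (cstar (\<xi> h))"] del: \<beta>_hom \<alpha>_hom)
  finally show ?thesis .
qed

lemma lamb_modset:
  assumes "\<xi> \<in> modset \<alpha>"
  shows "lamb \<alpha> \<sigma> g \<xi> \<in> modset \<alpha>" "mnorm \<alpha> (lamb \<alpha> \<sigma> g \<xi>) = mnorm \<alpha> \<xi>"
proof -
  let ?f = "\<lambda>k. \<beta> k (cstar (lamb \<alpha> \<sigma> g \<xi> k) * lamb \<alpha> \<sigma> g \<xi> k)"
  have *: "?f (g + h) = \<beta> h (cstar (\<xi> h) * \<xi> h)" for h
    by (subst lamb_inner_shift[OF assms]) (simp add: lamb_shift[OF assms] mult.assoc del: \<beta>_hom \<alpha>_hom)
  show "lamb \<alpha> \<sigma> g \<xi> \<in> modset \<alpha>"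
    using assms summable_on_reindex_bij_betw[OF bij_shift[of g], of ?f]
    unfolding modset_def * by simp
  show "mnorm \<alpha> (lamb \<alpha> \<sigma> g \<xi>) = mnorm \<alpha> \<xi>"
    using infsum_reindex_bij_betw[OF bij_shift[of g], of ?f]
    unfolding mnorm_def minner_def * by simp
qed

lemma lamb_star_modset:
  assumes "\<eta> \<in> modset \<alpha>"
  shows "lamb_star g \<eta> \<in> modset \<alpha>"
proof -
  let ?f = "\<lambda>k. \<beta> k (cstar (\<eta> k) * \<eta> k)"
  have "\<beta> h (cstar (lamb_star g \<eta> h) * lamb_star g \<eta> h) = ?f (g + h)" for h
  proof -
    have "\<beta> h (cstar (lamb_star g \<eta> h) * lamb_star g \<eta> h)
        = \<beta> h (\<beta> g ((\<sigma> g h * (cstar (\<eta> (g + h)) * \<eta> (g + h))) * cstar (\<sigma> g h)))"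
      by (simp add: lamb_star_def cstar_mult cstar_cstar mult.assoc)
    also have "\<dots> = ?f (g + h)" unfolding \<beta>_add[symmetric] by simp
    finally show ?thesis .
  qed
  then show ?thesis
    using assms summable_on_reindex_bij_betw[OF bij_shift[of g], of ?f] by (simp add: modset_def)
qed

lemma is_adjoint_of_lamb_star: "is_adjoint_of \<alpha> (lamb_star g) (lamb \<alpha> \<sigma> g)"
  unfolding is_adjoint_of_def
proof (intro conjI ballI lamb_star_modset)
  fix \<xi> \<eta> assume m: "\<xi> \<in> modset \<alpha>" "\<eta> \<in> modset \<alpha>"
  let ?f = "\<lambda>k. \<beta> k (cstar (lamb \<alpha> \<sigma> g \<xi> k) * \<eta> k)"
  have "minner \<alpha> (lamb \<alpha> \<sigma> g \<xi>) \<eta> = infsum (\<lambda>h. ?f (g + h)) UNIV"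
    unfolding minner_def by (rule infsum_reindex_bij_betw[OF bij_shift, symmetric])
  also have "\<dots> = minner \<alpha> \<xi> (lamb_star g \<eta>)"
    unfolding lamb_inner_shift[OF m(1)] by (simp add: minner_def lamb_star_def del: \<beta>_hom)
  finally show "minner \<alpha> (lamb \<alpha> \<sigma> g \<xi>) \<eta> = minner \<alpha> \<xi> (lamb_star g \<eta>)" .
qed

lemma adjointable_lamb: "adjointable \<alpha> (lamb \<alpha> \<sigma> g)"
  by (rule adjointableI[OF _ lamb_modset(1) is_adjoint_of_lamb_star]) (simp add: lamb_def)

lemma cred_adjointable: "T \<in> cred \<alpha> \<sigma> \<Longrightarrow> adjointable \<alpha> T"
  by (induction rule: cred.induct)
    (blast intro: adjointable_lmult adjointable_lamb adjointable_op_add adjointable_op_scale adjointable_comp)+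

subsection \<open>Finitely supported elements\<close>

definition zero_op :: "('g \<Rightarrow> 'a) \<Rightarrow> 'g \<Rightarrow> 'a" where
  "zero_op = (\<lambda>_ _. 0)"

definition monom_op :: "'a \<Rightarrow> 'g \<Rightarrow> ('g \<Rightarrow> 'a) \<Rightarrow> ('g \<Rightarrow> 'a)" where
  "monom_op a g = lmult \<alpha> a \<circ> lamb \<alpha> \<sigma> g"

lemma monom_op_apply:
  "\<xi> \<in> modset \<alpha> \<Longrightarrow> monom_op a g \<xi> h = a * (\<alpha> g (\<xi> (- g + h)) * \<sigma> g (- g + h))"
  using lamb_modset(1)[of \<xi> g] by (simp add: monom_op_def lmult_def lamb_def)

lemma monom_op_zero [simp]: "monom_op 0 g \<xi> h = 0"
  by (simp add: monom_op_def lmult_def)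

lemma adjointable_monom_op: "adjointable \<alpha> (monom_op a g)"
  unfolding monom_op_def by (intro adjointable_comp adjointable_lmult adjointable_lamb)

lemma zero_op_adjoint: "is_adjoint_of \<alpha> zero_op zero_op"
  by (simp add: zero_op_def is_adjoint_of_def minner_def)

lemma adjointable_zero_op: "adjointable \<alpha> zero_op"
  by (rule adjointableI[OF _ _ zero_op_adjoint]) (simp_all add: zero_op_def)

lemma mnorm_monom_op_le: "\<xi> \<in> modset \<alpha> \<Longrightarrow> mnorm \<alpha> (monom_op a g \<xi>) \<le> norm a * mnorm \<alpha> \<xi>"
  using modset_mult_left(2)[OF lamb_modset(1), of \<xi> a g] lamb_modset[of \<xi> g]
  by (simp add: monom_op_def lmult_def)

text \<open>\<open>Lam\<close> sums over the exact support of f, which varies under addition and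
  scaling. A common finite superset makes the dependence on f visibly linear.\<close>

lemma Lam_eq_sum_monom_op:
  assumes "finite S" "{g. f g \<noteq> 0} \<subseteq> S"
  shows "Lam \<alpha> \<sigma> f = (\<lambda>\<xi> h. \<Sum>g\<in>S. monom_op (f g) g \<xi> h)"
proof (intro ext)
  fix \<xi> h
  have "Lam \<alpha> \<sigma> f \<xi> h = (\<Sum>g\<in>{g. f g \<noteq> 0}. monom_op (f g) g \<xi> h)"
    by (simp add: Lam_def monom_op_def)
  also have "\<dots> = (\<Sum>g\<in>S. monom_op (f g) g \<xi> h)"
    by (rule sum.mono_neutral_left) (use assms in auto)
  finally show "Lam \<alpha> \<sigma> f \<xi> h = (\<Sum>g\<in>S. monom_op (f g) g \<xi> h)" .
qed

lemma sum_monom_op_induct: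
  assumes "finite S" "P zero_op" "\<And>a g. P (monom_op a g)" "\<And>T1 T2. P T1 \<Longrightarrow> P T2 \<Longrightarrow> P (op_add T1 T2)"
  shows "P (\<lambda>\<xi> h. \<Sum>g\<in>S. monom_op (f g) g \<xi> h)"
  using assms(1)
proof (induction S)
  case empty
  then show ?case using assms(2) by (simp add: zero_op_def)
next
  case (insert g S)
  then have "(\<lambda>\<xi> h. \<Sum>g\<in>insert g S. monom_op (f g) g \<xi> h)
      = op_add (monom_op (f g) g) (\<lambda>\<xi> h. \<Sum>g\<in>S. monom_op (f g) g \<xi> h)" by (simp add: op_add_def)
  with insert assms(3,4) show ?case by simp
qed

lemma Lam_induct:
  assumes "cc_fun f" "P zero_op" "\<And>a g. P (monom_op a g)" "\<And>T1 T2. P T1 \<Longrightarrow> P T2 \<Longrightarrow> P (op_add T1 T2)"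
  shows "P (Lam \<alpha> \<sigma> f)"
  using sum_monom_op_induct[of "{g. f g \<noteq> 0}" P f] assms
  by (simp add: Lam_eq_sum_monom_op[of "{g. f g \<noteq> 0}"] cc_fun_def)

lemma cc_fun_add: "cc_fun f \<Longrightarrow> cc_fun f' \<Longrightarrow> cc_fun (\<lambda>g. f g + f' g :: 'a)"
  unfolding cc_fun_def by (rule finite_subset[of _ "{g. f g \<noteq> 0} \<union> {g. f' g \<noteq> 0}"]) auto

lemma Lam_add:
  assumes "cc_fun f" "cc_fun f'"
  shows "Lam \<alpha> \<sigma> (\<lambda>g. f g + f' g) = op_add (Lam \<alpha> \<sigma> f) (Lam \<alpha> \<sigma> f')"
proof -
  let ?S = "{g. f g \<noteq> 0} \<union> {g. f' g \<noteq> 0}"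
  have S: "finite ?S" using assms by (simp add: cc_fun_def)
  have m: "monom_op (a + b) g \<xi> h = monom_op a g \<xi> h + monom_op b g \<xi> h" for a b g \<xi> h
    by (cases "lamb \<alpha> \<sigma> g \<xi> \<in> modset \<alpha>") (simp_all add: monom_op_def lmult_def algebra_simps)
  have "Lam \<alpha> \<sigma> (\<lambda>g. f g + f' g) = (\<lambda>\<xi> h. \<Sum>g\<in>?S. monom_op (f g + f' g) g \<xi> h)"
    by (rule Lam_eq_sum_monom_op[OF S]) auto
  moreover have "Lam \<alpha> \<sigma> f = (\<lambda>\<xi> h. \<Sum>g\<in>?S. monom_op (f g) g \<xi> h)"
    by (rule Lam_eq_sum_monom_op[OF S]) auto
  moreover have "Lam \<alpha> \<sigma> f' = (\<lambda>\<xi> h. \<Sum>g\<in>?S. monom_op (f' g) g \<xi> h)"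
    by (rule Lam_eq_sum_monom_op[OF S]) auto
  ultimately show ?thesis by (simp add: op_add_def m sum.distrib)
qed

lemma cc_fun_cscale: "cc_fun f \<Longrightarrow> cc_fun (\<lambda>g. cscale c (f g :: 'a))"
  unfolding cc_fun_def by (erule rev_finite_subset) auto

lemma Lam_cscale:
  assumes "cc_fun f"
  shows "Lam \<alpha> \<sigma> (\<lambda>g. cscale c (f g)) = op_scale c (Lam \<alpha> \<sigma> f)"
proof -
  let ?S = "{g. f g \<noteq> 0}"
  have S: "finite ?S" using assms by (simp add: cc_fun_def)
  have m: "monom_op (cscale c a) g \<xi> h = cscale c (monom_op a g \<xi> h)" for a g \<xi> h
    by (cases "lamb \<alpha> \<sigma> g \<xi> \<in> modset \<alpha>") (simp_all add: monom_op_def lmult_def cscale_left_mult)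
  have s: "(\<Sum>g\<in>S. cscale c (x g)) = cscale c (\<Sum>g\<in>S. x g)" for S and x :: "'g \<Rightarrow> 'a"
    by (induction S rule: infinite_finite_induct) (simp_all add: cscale_add_right)
  have "Lam \<alpha> \<sigma> (\<lambda>g. cscale c (f g)) = (\<lambda>\<xi> h. \<Sum>g\<in>?S. monom_op (cscale c (f g)) g \<xi> h)"
    by (rule Lam_eq_sum_monom_op[OF S]) auto
  moreover have "Lam \<alpha> \<sigma> f = (\<lambda>\<xi> h. \<Sum>g\<in>?S. monom_op (f g) g \<xi> h)"
    by (rule Lam_eq_sum_monom_op[OF S]) auto
  ultimately show ?thesis by (simp add: op_scale_def m s)
qed

abbreviation fin_ops :: "(('g \<Rightarrow> 'a) \<Rightarrow> ('g \<Rightarrow> 'a)) set" where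
  "fin_ops \<equiv> Lam \<alpha> \<sigma> ` {f. cc_fun f}"

lemma fin_ops_induct:
  assumes "T \<in> fin_ops" "P zero_op" "\<And>a g. P (monom_op a g)" "\<And>T1 T2. P T1 \<Longrightarrow> P T2 \<Longrightarrow> P (op_add T1 T2)"
  shows "P T"
  using assms Lam_induct by blast

lemma zero_op_in_fin_ops: "zero_op \<in> fin_ops"
  by (rule image_eqI[of _ _ "\<lambda>_. 0"]) (simp_all add: zero_op_def Lam_def cc_fun_def)

lemma monom_op_in_fin_ops: "monom_op a g \<in> fin_ops"
proof (rule image_eqI)
  show "monom_op a g = Lam \<alpha> \<sigma> (\<lambda>k. if k = g then a else 0)"
    by (subst Lam_eq_sum_monom_op[of "{g}"]) auto
  show "(\<lambda>k. if k = g then a else 0) \<in> {f. cc_fun f}" by (simp add: cc_fun_def)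
qed

lemma op_add_in_fin_ops: "T1 \<in> fin_ops \<Longrightarrow> T2 \<in> fin_ops \<Longrightarrow> op_add T1 T2 \<in> fin_ops"
  by (auto simp: cc_fun_add simp flip: Lam_add intro!: imageI)

lemma op_scale_in_fin_ops: "T \<in> fin_ops \<Longrightarrow> op_scale c T \<in> fin_ops"
  by (auto simp: cc_fun_cscale simp flip: Lam_cscale intro!: imageI)

lemma fin_ops_cred: "T \<in> fin_ops \<Longrightarrow> T \<in> cred \<alpha> \<sigma>"
proof (erule fin_ops_induct)
  have "zero_op = op_scale 0 (lmult \<alpha> 0)"
    by (auto simp: zero_op_def op_scale_def lmult_def)
  then show "zero_op \<in> cred \<alpha> \<sigma>" using cred.scale[OF cred.gen_A] by metis
qed (simp_all only: monom_op_def cred.add cred.comp cred.gen_A cred.gen_lamb)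

lemma fin_ops_adjointable: "T \<in> fin_ops \<Longrightarrow> adjointable \<alpha> T"
  by (intro cred_adjointable fin_ops_cred)

text \<open>Covariance moves b past the translation by g and the cocycle identity merges the two
  translations. Hence finitely supported elements are closed under composition.\<close>

lemma monom_op_comp_monom_op: "monom_op a g \<circ> monom_op b h = monom_op (a * \<alpha> g b * \<sigma> g h) (g + h)"
proof (intro ext)
  fix \<xi> k
  show "(monom_op a g \<circ> monom_op b h) \<xi> k = monom_op (a * \<alpha> g b * \<sigma> g h) (g + h) \<xi> k"
  proof (cases "\<xi> \<in> modset \<alpha>")
    case True
    \<comment> \<open>The common argument at which both sides evaluate \<xi>.\<close>
    define m where "m = - h + (- g + k)"
    have m: "- (g + h) + k = m" "- g + k = h + m"
      by (simp_all add: m_def minus_add add.assoc del: add_uminus_conv_diff)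
    have "(monom_op a g \<circ> monom_op b h) \<xi> k
        = a * (\<alpha> g (b * (\<alpha> h (\<xi> m) * \<sigma> h m)) * \<sigma> g (h + m))"
      using True adjointable_modset[OF adjointable_monom_op True] m_def
      by (simp add: monom_op_apply m add.assoc[symmetric])
    also have "\<dots> = a * \<alpha> g b * (\<alpha> g (\<alpha> h (\<xi> m)) * (\<alpha> g (\<sigma> h m) * \<sigma> g (h + m)))"
      by (simp add: mult.assoc)
    also have "\<dots> = a * \<alpha> g b * \<sigma> g h * (\<alpha> (g + h) (\<xi> m) * \<sigma> (g + h) m)"
      unfolding cocycle[symmetric] \<alpha>_\<alpha> by (simp add: mult.assoc)
    finally show ?thesis using True by (simp add: monom_op_apply m)
  next
    case False
    then show ?thesis
      using adjointable_zero[OF adjointable_monom_op] adjointable_outside[OF adjointable_monom_op] by simp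
  qed
qed

lemma comp_in_fin_ops:
  assumes "T1 \<in> fin_ops" "T2 \<in> fin_ops"
  shows "T1 \<circ> T2 \<in> fin_ops"
  using assms(1)
proof (rule fin_ops_induct)
  show "zero_op \<circ> T2 \<in> fin_ops" using zero_op_in_fin_ops by (simp add: zero_op_def o_def)
  show "op_add S1 S2 \<circ> T2 \<in> fin_ops" if "S1 \<circ> T2 \<in> fin_ops" "S2 \<circ> T2 \<in> fin_ops" for S1 S2
    using op_add_in_fin_ops[OF that] by (simp add: op_add_def o_def)
  show "monom_op a g \<circ> T2 \<in> fin_ops" for a g
  proof -
    \<comment> \<open>Splitting a sum in the right factor uses additivity of
      \<open>monom_op a g\<close> on the module, so adjointability of the right factor is carried
      through the induction to keep its values there.\<close>
    have "monom_op a g \<circ> T2 \<in> fin_ops \<and> adjointable \<alpha> T2"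
      using assms(2)
    proof (rule fin_ops_induct)
      show "monom_op a g \<circ> zero_op \<in> fin_ops \<and> adjointable \<alpha> zero_op"
        using zero_op_in_fin_ops adjointable_zero[OF adjointable_monom_op] adjointable_zero_op
        by (simp add: zero_op_def o_def)
      show "monom_op a g \<circ> monom_op b h \<in> fin_ops \<and> adjointable \<alpha> (monom_op b h)" for b h
        unfolding monom_op_comp_monom_op using monom_op_in_fin_ops adjointable_monom_op by blast
      fix S1 S2 assume S: "monom_op a g \<circ> S1 \<in> fin_ops \<and> adjointable \<alpha> S1" "monom_op a g \<circ> S2 \<in> fin_ops \<and> adjointable \<alpha> S2"
      have m: "S1 \<xi> \<in> modset \<alpha>" "S2 \<xi> \<in> modset \<alpha>" for \<xi>
        using S adjointable_modset adjointable_outside by (metis modset_zero)+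
      have "monom_op a g \<circ> op_add S1 S2 = op_add (monom_op a g \<circ> S1) (monom_op a g \<circ> S2)"
        by (simp add: op_add_def o_def adjointable_add[OF adjointable_monom_op m])
      then show "monom_op a g \<circ> op_add S1 S2 \<in> fin_ops \<and> adjointable \<alpha> (op_add S1 S2)"
        using op_add_in_fin_ops S adjointable_op_add by auto
    qed
    then show ?thesis by simp
  qed
qed

text \<open>The inverse automorphism is rewritten through \<open>\<alpha> (- g)\<close>, so that the
  adjoint of a monomial at g can be recognised as a monomial at \<open>- g\<close>.\<close>

lemma \<beta>_eq: "\<beta> g y = cstar (\<sigma> (- g) g) * \<alpha> (- g) y * \<sigma> (- g) g"
proof -
  have "\<alpha> (- g) y = \<sigma> (- g) g * \<beta> g y * cstar (\<sigma> (- g) g)"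
    using \<alpha>_\<alpha>[of "- g" g "\<beta> g y"] by simp
  then show ?thesis by (simp add: mult.assoc)
qed

text \<open>The adjoint of the translation by g is \<open>cstar (\<sigma> (- g) g)\<close> times the
  translation by \<open>- g\<close>; moving \<open>cstar a\<close> to its left applies
  \<open>\<alpha> (- g)\<close> and yields the stated coefficient. The cocycle identity at (- g, g,
  h) matches the remaining unitaries.\<close>

lemma monom_op_adjoint:
  "is_adjoint_of \<alpha> (monom_op (cstar (\<sigma> (- g) g) * \<alpha> (- g) (cstar a)) (- g)) (monom_op a g)"
proof -
  have eq: "monom_op (cstar (\<sigma> (- g) g) * \<alpha> (- g) (cstar a)) (- g) \<eta> = (lamb_star g \<circ> lmult \<alpha> (cstar a)) \<eta>"
    if m: "\<eta> \<in> modset \<alpha>" for \<eta>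
  proof
    fix h
    have u: "cstar (\<alpha> (- g) (\<sigma> g h)) * (\<alpha> (- g) (\<sigma> g h) * x) = x" for x
      by (metis \<alpha>_hom(2,5,8) \<sigma>_unitary(2) mult.assoc mult_1)
    have s: "cstar (\<alpha> (- g) (\<sigma> g h)) * \<sigma> (- g) g = \<sigma> (- g) (g + h)"
      using cocycle[of "- g" g h] u by simp
    have "(lamb_star g \<circ> lmult \<alpha> (cstar a)) \<eta> h
        = cstar (\<sigma> (- g) g) * (\<alpha> (- g) (cstar a) * (\<alpha> (- g) (\<eta> (g + h)) * (cstar (\<alpha> (- g) (\<sigma> g h)) * \<sigma> (- g) g)))"
      using m by (simp add: lmult_def lamb_star_def \<beta>_eq mult.assoc del: \<beta>_hom)
    then show "monom_op (cstar (\<sigma> (- g) g) * \<alpha> (- g) (cstar a)) (- g) \<eta> h = (lamb_star g \<circ> lmult \<alpha> (cstar a)) \<eta> h"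
      using m by (simp add: monom_op_apply s mult.assoc)
  qed
  have "is_adjoint_of \<alpha> (lamb_star g \<circ> lmult \<alpha> (cstar a)) (monom_op a g)"
    unfolding monom_op_def by (intro is_adjoint_of_comp is_adjoint_of_lmult is_adjoint_of_lamb_star adjointable_lamb)
  then show ?thesis unfolding is_adjoint_of_def by (simp add: eq del: \<alpha>_hom o_apply)
qed

lemma fin_ops_adjoint:
  assumes "T \<in> fin_ops"
  obtains S where "S \<in> fin_ops" "is_adjoint_of \<alpha> S T"
proof -
  have "adjointable \<alpha> T \<and> (\<exists>S\<in>fin_ops. is_adjoint_of \<alpha> S T)"
    using assms
  proof (rule fin_ops_induct)
    show "adjointable \<alpha> zero_op \<and> (\<exists>S\<in>fin_ops. is_adjoint_of \<alpha> S zero_op)"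
      by (rule conjI[OF adjointable_zero_op], rule bexI, rule zero_op_adjoint, rule zero_op_in_fin_ops)
    show "adjointable \<alpha> (monom_op a g) \<and> (\<exists>S\<in>fin_ops. is_adjoint_of \<alpha> S (monom_op a g))" for a g
      by (rule conjI[OF adjointable_monom_op], rule bexI, rule monom_op_adjoint, rule monom_op_in_fin_ops)
    fix T1 T2
    assume T1: "adjointable \<alpha> T1 \<and> (\<exists>S\<in>fin_ops. is_adjoint_of \<alpha> S T1)"
      and T2: "adjointable \<alpha> T2 \<and> (\<exists>S\<in>fin_ops. is_adjoint_of \<alpha> S T2)"
    then obtain S1 S2 where S: "S1 \<in> fin_ops" "is_adjoint_of \<alpha> S1 T1" "S2 \<in> fin_ops" "is_adjoint_of \<alpha> S2 T2"
      by (elim conjE bexE)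
    show "adjointable \<alpha> (op_add T1 T2) \<and> (\<exists>S\<in>fin_ops. is_adjoint_of \<alpha> S (op_add T1 T2))"
      using T1 T2 is_adjoint_of_op_add[OF S(2,4)] op_add_in_fin_ops[OF S(1,3)] adjointable_op_add[of T1 T2]
      by (metis (no_types))
  qed
  then show ?thesis by (elim conjE bexE) (rule that)
qed

end

lemma l2_inner_finite:
  assumes "finite S" "\<And>g. g \<notin> S \<Longrightarrow> l2_fun w g = 0"
  shows "l2_inner z w = (\<Sum>g\<in>S. cstar (l2_fun z g) * l2_fun w g)"
  unfolding l2_inner.rep_eq using assms
  by (intro infsumI has_sum_finite_neutralI[of S]) auto

context twisted
begin

section \<open>Approximation in operator norm and density\<close>

text \<open>Vectorwise form of a bound e on the operator norm of T - S, so that estimates can be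
  combined without handling suprema.\<close>

definition approximates :: "(('g \<Rightarrow> 'a) \<Rightarrow> ('g \<Rightarrow> 'a)) \<Rightarrow> real \<Rightarrow> (('g \<Rightarrow> 'a) \<Rightarrow> ('g \<Rightarrow> 'a)) \<Rightarrow> bool" where
  "approximates S e T \<longleftrightarrow> (\<forall>\<xi>\<in>modset \<alpha>. mnorm \<alpha> (op_diff T S \<xi>) \<le> e * mnorm \<alpha> \<xi>)"

lemma approximatesD: "approximates S e T \<Longrightarrow> \<xi> \<in> modset \<alpha> \<Longrightarrow> mnorm \<alpha> (op_diff T S \<xi>) \<le> e * mnorm \<alpha> \<xi>"
  by (simp add: approximates_def)

lemma approximates_refl: "e \<ge> 0 \<Longrightarrow> approximates T e T"
  by (simp add: approximates_def op_diff_def)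

lemma op_diff_modset:
  "adjointable \<alpha> T \<Longrightarrow> adjointable \<alpha> S \<Longrightarrow> \<xi> \<in> modset \<alpha> \<Longrightarrow> op_diff T S \<xi> \<in> modset \<alpha>"
  by (rule adjointable_modset[OF adjointable_op_diff])

lemma approximates_op_add:
  assumes "approximates S1 e1 T1" "approximates S2 e2 T2"
    and adj: "adjointable \<alpha> S1" "adjointable \<alpha> T1" "adjointable \<alpha> S2" "adjointable \<alpha> T2"
  shows "approximates (op_add S1 S2) (e1 + e2) (op_add T1 T2)"
  unfolding approximates_def
proof
  fix \<xi> assume m: "\<xi> \<in> modset \<alpha>"
  have "op_diff (op_add T1 T2) (op_add S1 S2) \<xi> = (\<lambda>h. op_diff T1 S1 \<xi> h + op_diff T2 S2 \<xi> h)"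
    by (simp add: op_diff_def op_add_def algebra_simps)
  then have "mnorm \<alpha> (op_diff (op_add T1 T2) (op_add S1 S2) \<xi>)
      \<le> mnorm \<alpha> (op_diff T1 S1 \<xi>) + mnorm \<alpha> (op_diff T2 S2 \<xi>)"
    using mnorm_add_le[OF op_diff_modset op_diff_modset] adj m by simp
  with approximatesD[OF assms(1) m] approximatesD[OF assms(2) m]
  show "mnorm \<alpha> (op_diff (op_add T1 T2) (op_add S1 S2) \<xi>) \<le> (e1 + e2) * mnorm \<alpha> \<xi>"
    by (simp add: algebra_simps)
qed

lemma approximates_trans:
  assumes "approximates S e1 T" "approximates T e2 R"
    and adj: "adjointable \<alpha> S" "adjointable \<alpha> T" "adjointable \<alpha> R"
  shows "approximates S (e1 + e2) R"
  unfolding approximates_def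
proof
  fix \<xi> assume m: "\<xi> \<in> modset \<alpha>"
  have "op_diff R S \<xi> = (\<lambda>h. op_diff T S \<xi> h + op_diff R T \<xi> h)"
    by (simp add: op_diff_def)
  then have "mnorm \<alpha> (op_diff R S \<xi>) \<le> mnorm \<alpha> (op_diff T S \<xi>) + mnorm \<alpha> (op_diff R T \<xi>)"
    using mnorm_add_le[OF op_diff_modset op_diff_modset] adj m by simp
  with approximatesD[OF assms(1) m] approximatesD[OF assms(2) m]
  show "mnorm \<alpha> (op_diff R S \<xi>) \<le> (e1 + e2) * mnorm \<alpha> \<xi>"
    by (simp add: algebra_simps)
qed

lemma approximates_opnorm:
  assumes "adjointable \<alpha> S" "adjointable \<alpha> T"
  shows "approximates S (opnorm \<alpha> (op_diff T S)) T"
  unfolding approximates_def using mnorm_le_opnorm[OF adjointable_op_diff[OF assms(2,1)]] by blast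

lemma opnorm_op_diff_le: "approximates S e T \<Longrightarrow> e \<ge> 0 \<Longrightarrow> opnorm \<alpha> (op_diff T S) \<le> e"
  by (rule opnorm_le) (simp_all add: approximates_def)

lemma approximates_sym:
  assumes "approximates S e T" "adjointable \<alpha> S" "adjointable \<alpha> T"
  shows "approximates T e S"
  using assms mnorm_diff_commute[OF adjointable_modset adjointable_modset, of T _ S]
  by (simp add: approximates_def op_diff_def)

lemma approximates_mono: "approximates S e T \<Longrightarrow> e \<le> e' \<Longrightarrow> approximates S e' T"
  unfolding approximates_def by (meson mnorm_nonneg mult_right_mono order_trans)

lemma approximates_op_scale:
  assumes "approximates S e T" and adj: "adjointable \<alpha> S" "adjointable \<alpha> T"
  shows "approximates (op_scale c S) (cmod c * e) (op_scale c T)"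
  unfolding approximates_def
proof
  fix \<xi> assume m: "\<xi> \<in> modset \<alpha>"
  have "op_diff (op_scale c T) (op_scale c S) \<xi> = (\<lambda>h. cscale c 1 * op_diff T S \<xi> h)"
    by (simp add: op_diff_def op_scale_def cscale_left_mult[symmetric] diff_conv_add_uminus
        cscale_add_right cscale_minus_right del: add_uminus_conv_diff)
  then have "mnorm \<alpha> (op_diff (op_scale c T) (op_scale c S) \<xi>) \<le> cmod c * mnorm \<alpha> (op_diff T S \<xi>)"
    using modset_mult_left(2)[OF op_diff_modset[OF adj(2,1) m], of "cscale c 1"] by (simp add: norm_cscale)
  also have "\<dots> \<le> cmod c * (e * mnorm \<alpha> \<xi>)"
    using approximatesD[OF assms(1) m] by (rule mult_left_mono) simp
  finally show "mnorm \<alpha> (op_diff (op_scale c T) (op_scale c S) \<xi>) \<le> cmod c * e * mnorm \<alpha> \<xi>"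
    by (simp add: mult.assoc)
qed

text \<open>Uses T1 T2 - S1 S2 = (T1 - S1) T2 + S1 (T2 - S2). The second error is weighted by the
  approximant S1 and not by T1.\<close>

lemma approximates_comp:
  assumes a: "approximates S1 e1 T1" "approximates S2 e2 T2"
    and adj: "adjointable \<alpha> S1" "adjointable \<alpha> T1" "adjointable \<alpha> S2" "adjointable \<alpha> T2"
    and e: "e1 \<ge> 0"
  shows "approximates (S1 \<circ> S2) (e1 * opnorm \<alpha> T2 + opnorm \<alpha> S1 * e2) (T1 \<circ> T2)"
  unfolding approximates_def
proof
  fix \<xi> assume m: "\<xi> \<in> modset \<alpha>"
  have m2: "T2 \<xi> \<in> modset \<alpha>" "S2 \<xi> \<in> modset \<alpha>" "op_diff T2 S2 \<xi> \<in> modset \<alpha>"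
    using adj m by (simp_all add: adjointable_modset op_diff_modset)
  have "op_diff (T1 \<circ> T2) (S1 \<circ> S2) \<xi> = (\<lambda>h. op_diff T1 S1 (T2 \<xi>) h + S1 (op_diff T2 S2 \<xi>) h)"
    using adjointable_diff[OF adj(1) m2(1,2)] by (simp add: op_diff_def)
  then have "mnorm \<alpha> (op_diff (T1 \<circ> T2) (S1 \<circ> S2) \<xi>)
      \<le> mnorm \<alpha> (op_diff T1 S1 (T2 \<xi>)) + mnorm \<alpha> (S1 (op_diff T2 S2 \<xi>))"
    using mnorm_add_le[OF op_diff_modset[OF adj(2,1) m2(1)] adjointable_modset[OF adj(1) m2(3)]] by simp
  also have "\<dots> \<le> e1 * (opnorm \<alpha> T2 * mnorm \<alpha> \<xi>) + opnorm \<alpha> S1 * (e2 * mnorm \<alpha> \<xi>)"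
  proof (rule add_mono)
    show "mnorm \<alpha> (op_diff T1 S1 (T2 \<xi>)) \<le> e1 * (opnorm \<alpha> T2 * mnorm \<alpha> \<xi>)"
      using approximatesD[OF a(1) m2(1)] mult_left_mono[OF mnorm_le_opnorm[OF adj(4) m] e] by linarith
    show "mnorm \<alpha> (S1 (op_diff T2 S2 \<xi>)) \<le> opnorm \<alpha> S1 * (e2 * mnorm \<alpha> \<xi>)"
      using mnorm_le_opnorm[OF adj(1) m2(3)]
        mult_left_mono[OF approximatesD[OF a(2) m] opnorm_nonneg[OF adj(1)]] by linarith
  qed
  finally show "mnorm \<alpha> (op_diff (T1 \<circ> T2) (S1 \<circ> S2) \<xi>) \<le> (e1 * opnorm \<alpha> T2 + opnorm \<alpha> S1 * e2) * mnorm \<alpha> \<xi>"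
    by (simp add: algebra_simps)
qed

lemma approximates_adjoint:
  assumes a: "approximates S e T" and e: "e \<ge> 0"
    and adj: "adjointable \<alpha> S" "adjointable \<alpha> T" "adjointable \<alpha> S'" "adjointable \<alpha> T'"
    and star: "is_adjoint_of \<alpha> S' S" "is_adjoint_of \<alpha> T' T"
  shows "approximates S' e T'"
  unfolding approximates_def
proof
  fix \<xi> assume m: "\<xi> \<in> modset \<alpha>"
  have "is_adjoint_of \<alpha> (op_diff T' S') (op_diff T S)"
    using star unfolding is_adjoint_of_def op_diff_def
    by (simp add: modset_diff minner_eq to_l2_diff l2_inner_diff_left l2_inner_diff_right
        adjointable_modset[OF adj(1)] adjointable_modset[OF adj(2)])
  then have l: "l2_adjoint (lift (op_diff T' S')) (lift (op_diff T S))"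
    by (rule l2_adjoint_lift) (rule op_diff_modset[OF adj(2,1)])
  have b: "norm (lift (op_diff T S) z) \<le> e * norm z" for z
    using approximatesD[OF a, of "of_l2 z"] op_diff_modset[OF adj(2,1), of "of_l2 z"]
    by (simp add: lift_def mnorm_eq)
  show "mnorm \<alpha> (op_diff T' S' \<xi>) \<le> e * mnorm \<alpha> \<xi>"
    using l2_adjoint_norm_le[OF l e b, of "to_l2 \<xi>"] op_diff_modset[OF adj(4,3) m] m
    by (simp add: lift_def mnorm_eq)
qed

text \<open>The finitely supported elements contain the generators and are closed under sums,
  scalars, composition and adjoints, and each of these operations, like norm limits, respects
  approximation. Induction over the generation of \<open>cred\<close> then suffices.\<close>

theorem fin_ops_dense:
  assumes "T \<in> cred \<alpha> \<sigma>" "e > 0"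
  obtains S where "S \<in> fin_ops" "approximates S e T"
proof -
  have "\<forall>e>0. \<exists>S\<in>fin_ops. approximates S e T"
    using assms(1)
  proof (induction rule: cred.induct)
    case (gen_A a)
    have "lamb \<alpha> \<sigma> 0 \<xi> = (if \<xi> \<in> modset \<alpha> then \<xi> else (\<lambda>_. 0))" for \<xi>
      by (simp add: lamb_def)
    then have "lmult \<alpha> a = monom_op a 0"
      by (auto simp: monom_op_def lmult_def)
    then have "lmult \<alpha> a \<in> fin_ops" using monom_op_in_fin_ops[of a 0] by argo
    then show ?case using approximates_refl by (meson less_imp_le)
  next
    case (gen_lamb g)
    have "lamb \<alpha> \<sigma> g = monom_op 1 g"
    proof
      fix \<xi> show "lamb \<alpha> \<sigma> g \<xi> = monom_op 1 g \<xi>"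
        by (cases "\<xi> \<in> modset \<alpha>") (simp_all add: monom_op_def lmult_def lamb_modset, simp add: lamb_def)
    qed
    then have "lamb \<alpha> \<sigma> g \<in> fin_ops" using monom_op_in_fin_ops[of 1 g] by argo
    then show ?case using approximates_refl by (meson less_imp_le)
  next
    case (add T1 T2)
    show ?case
    proof (intro allI impI)
      fix e :: real assume "e > 0"
      then obtain S1 S2 where S: "S1 \<in> fin_ops" "approximates S1 (e / 2) T1" "S2 \<in> fin_ops" "approximates S2 (e / 2) T2"
        using add.IH by (meson half_gt_zero)
      have "approximates (op_add S1 S2) (e / 2 + e / 2) (op_add T1 T2)"
        by (intro approximates_op_add S fin_ops_adjointable cred_adjointable add.hyps)
      then show "\<exists>S\<in>fin_ops. approximates S e (op_add T1 T2)"
        using op_add_in_fin_ops[OF S(1,3)] by (metis field_sum_of_halves)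
    qed
  next
    case (scale T c)
    show ?case
    proof (intro allI impI)
      fix e :: real assume e: "e > 0"
      then have "e / (cmod c + 1) > 0" by (simp add: add_nonneg_pos)
      then obtain S where S: "S \<in> fin_ops" "approximates S (e / (cmod c + 1)) T"
        using scale.IH by meson
      have "approximates (op_scale c S) (cmod c * (e / (cmod c + 1))) (op_scale c T)"
        by (intro approximates_op_scale S fin_ops_adjointable cred_adjointable scale.hyps)
      moreover have "cmod c * (e / (cmod c + 1)) \<le> e"
        using e by (simp add: divide_simps add_nonneg_pos)
      ultimately show "\<exists>S\<in>fin_ops. approximates S e (op_scale c T)"
        using op_scale_in_fin_ops[OF S(1)] approximates_mono by meson
    qed
  next
    case (comp T1 T2)
    note adj = cred_adjointable[OF comp.hyps(1)] cred_adjointable[OF comp.hyps(2)]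
    show ?case
    proof (intro allI impI)
      fix e :: real assume e: "e > 0"
      let ?b = "opnorm \<alpha> T2 + 1"
      have b: "?b > 0" using opnorm_nonneg[OF adj(2)] by simp
      then have "e / 2 / ?b > 0" using e by simp
      then obtain S1 where S1: "S1 \<in> fin_ops" "approximates S1 (e / 2 / ?b) T1"
        using comp.IH(1) by meson
      \<comment> \<open>The tolerance for T2 depends on the norm of the S1 just chosen, so S2 can
        only be picked afterwards.\<close>
      let ?c = "opnorm \<alpha> S1 + 1"
      have c: "?c > 0" using opnorm_nonneg[OF fin_ops_adjointable[OF S1(1)]] by simp
      then have "e / 2 / ?c > 0" using e by simp
      then obtain S2 where S2: "S2 \<in> fin_ops" "approximates S2 (e / 2 / ?c) T2"
        using comp.IH(2) by meson
      have "approximates (S1 \<circ> S2) (e / 2 / ?b * opnorm \<alpha> T2 + opnorm \<alpha> S1 * (e / 2 / ?c)) (T1 \<circ> T2)"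
        using b e by (intro approximates_comp S1 S2 fin_ops_adjointable adj) auto
      moreover have "e / 2 / ?b * opnorm \<alpha> T2 \<le> e / 2" "opnorm \<alpha> S1 * (e / 2 / ?c) \<le> e / 2"
        using b c e by (simp_all add: divide_simps)
      then have "e / 2 / ?b * opnorm \<alpha> T2 + opnorm \<alpha> S1 * (e / 2 / ?c) \<le> e" by linarith
      ultimately show "\<exists>S\<in>fin_ops. approximates S e (T1 \<circ> T2)"
        using comp_in_fin_ops[OF S1(1) S2(1)] approximates_mono by meson
    qed
  next
    case (adj T T')
    show ?case
    proof (intro allI impI)
      fix e :: real assume e: "e > 0"
      then obtain S where S: "S \<in> fin_ops" "approximates S e T" using adj.IH by meson
      obtain S' where S': "S' \<in> fin_ops" "is_adjoint_of \<alpha> S' S" using fin_ops_adjoint[OF S(1)] .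
      have "approximates S' e T'"
        by (rule approximates_adjoint[OF S(2)])
          (use e adj S S' in \<open>simp_all only: fin_ops_adjointable cred_adjointable less_imp_le\<close>)
      with S'(1) show "\<exists>S\<in>fin_ops. approximates S e T'" by meson
    qed
  next
    case (lim X T)
    show ?case
    proof (intro allI impI)
      fix e :: real assume e: "e > 0"
      then obtain n where n: "\<bar>opnorm \<alpha> (op_diff (X n) T)\<bar> < e / 2"
        using LIMSEQ_D[OF lim.hyps(3), of "e / 2"] by auto
      note Xn = cred_adjointable[OF lim.hyps(1), of n]
      have "approximates T (e / 2) (X n)"
        by (rule approximates_mono[OF approximates_opnorm[OF lim.hyps(2) Xn]]) (use n in simp)
      then have 1: "approximates (X n) (e / 2) T" by (rule approximates_sym[OF _ lim.hyps(2) Xn])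
      obtain S where S: "S \<in> fin_ops" "approximates S (e / 2) (X n)"
        using lim.IH e by (meson half_gt_zero)
      have "approximates S (e / 2 + e / 2) T"
        by (rule approximates_trans[OF S(2) 1 fin_ops_adjointable[OF S(1)] Xn lim.hyps(2)])
      with S(1) show "\<exists>S\<in>fin_ops. approximates S e T" by (metis field_sum_of_halves)
    qed
  qed
  with assms(2) show ?thesis using that by meson
qed

end

lemma scaleR_cscale_commute: "r *\<^sub>R cscale c x = cscale c (r *\<^sub>R (x::'a::unital_cstar))"
  by (simp add: cscale_cscale mult.commute flip: cscale_of_real)

context twisted
begin

subsection \<open>Fourier coefficients\<close>

lemma xi0_modset: "xi0 \<in> modset \<alpha>" "mnorm \<alpha> xi0 = 1"
proof -
  have "((\<lambda>g. \<beta> g (cstar (xi0 g) * xi0 g)) has_sum 1) UNIV"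
    by (rule has_sum_finite_neutralI[of "{0}"]) (auto simp: xi0_def)
  then show "xi0 \<in> modset \<alpha>" "mnorm \<alpha> xi0 = 1"
    by (auto simp: modset_def mnorm_def minner_def infsumI has_sum_imp_summable simp del: \<beta>_hom)
qed

lemma norm_fourier_le: "adjointable \<alpha> x \<Longrightarrow> norm (fourier x g) \<le> opnorm \<alpha> x"
  using norm_le_mnorm[OF adjointable_modset[OF _ xi0_modset(1)], of x g]
    mnorm_le_opnorm[OF _ xi0_modset(1), of x]
  by (simp add: fourier_def xi0_modset)

lemma fourier_Lam:
  assumes "cc_fun f"
  shows "fourier (Lam \<alpha> \<sigma> f) = f"
proof
  fix h
  let ?S = "insert h {g. f g \<noteq> 0}"
  have S: "finite ?S" using assms by (simp add: cc_fun_def)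
  have "monom_op (f g) g xi0 h = (if g = h then f g else 0)" for g
  proof -
    have "- g + h = 0 \<longleftrightarrow> g = h" by (metis add.inverse_inverse add_eq_0_iff left_minus)
    then show ?thesis unfolding monom_op_apply[OF xi0_modset(1)] by (simp add: xi0_def)
  qed
  then show "fourier (Lam \<alpha> \<sigma> f) h = f h"
    unfolding fourier_def Lam_eq_sum_monom_op[OF S subset_insertI] using S by (simp add: sum.delta)
qed

lemma mnorm_sum_monom_op_le:
  assumes "finite S" and m: "\<xi> \<in> modset \<alpha>"
  shows "(\<lambda>h. \<Sum>g\<in>S. monom_op (f g) g \<xi> h) \<in> modset \<alpha> \<and>
    mnorm \<alpha> (\<lambda>h. \<Sum>g\<in>S. monom_op (f g) g \<xi> h) \<le> (\<Sum>g\<in>S. norm (f g)) * mnorm \<alpha> \<xi>"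
  using assms(1)
proof (induction S)
  case (insert g S)
  let ?s = "\<lambda>h. \<Sum>g\<in>S. monom_op (f g) g \<xi> h"
  have mm: "monom_op (f g) g \<xi> \<in> modset \<alpha>" by (rule adjointable_modset[OF adjointable_monom_op m])
  have "mnorm \<alpha> (\<lambda>h. monom_op (f g) g \<xi> h + ?s h) \<le> mnorm \<alpha> (monom_op (f g) g \<xi>) + mnorm \<alpha> ?s"
    using insert.IH mm by (intro mnorm_add_le) auto
  with insert mnorm_monom_op_le[OF m, of "f g" g] modset_add[OF mm, of ?s] show ?case
    by (simp add: algebra_simps)
qed simp

lemma mnorm_Lam_le:
  assumes "finite S" "{g. f g \<noteq> 0} \<subseteq> S" "\<xi> \<in> modset \<alpha>"
  shows "mnorm \<alpha> (Lam \<alpha> \<sigma> f \<xi>) \<le> (\<Sum>g\<in>S. norm (f g)) * mnorm \<alpha> \<xi>"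
  using mnorm_sum_monom_op_le[OF assms(1,3), of f] by (simp add: Lam_eq_sum_monom_op[OF assms(1,2)])

lemma opnorm_Lam_le:
  assumes "finite S" "{g. f g \<noteq> 0} \<subseteq> S"
  shows "opnorm \<alpha> (Lam \<alpha> \<sigma> f) \<le> (\<Sum>g\<in>S. norm (f g))"
  by (rule opnorm_le[OF sum_nonneg[OF norm_ge_zero] mnorm_Lam_le[OF assms]])

subsection \<open>Multipliers\<close>

lemma op_diff_in_cred: "x \<in> cred \<alpha> \<sigma> \<Longrightarrow> y \<in> cred \<alpha> \<sigma> \<Longrightarrow> op_diff x y \<in> cred \<alpha> \<sigma>"
  by (simp add: op_diff_eq cred.add cred.scale)

lemma is_mult_map_op_diff:
  assumes "is_mult_map \<alpha> \<sigma> T M" "x \<in> cred \<alpha> \<sigma>" "y \<in> cred \<alpha> \<sigma>"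
  shows "M (op_diff x y) = op_diff (M x) (M y)"
  using assms cred.scale[OF assms(3), of "- 1"] by (simp add: is_mult_map_def op_diff_eq)

lemma is_mult_map_bounded:
  assumes "is_mult_map \<alpha> \<sigma> T M"
  obtains K where "K \<ge> 0" "\<And>x. x \<in> cred \<alpha> \<sigma> \<Longrightarrow> opnorm \<alpha> (M x) \<le> K * opnorm \<alpha> x"
proof -
  have "\<exists>K. \<forall>x\<in>cred \<alpha> \<sigma>. opnorm \<alpha> (M x) \<le> K * opnorm \<alpha> x"
    using assms by (simp add: is_mult_map_def)
  then obtain K where K: "\<And>x. x \<in> cred \<alpha> \<sigma> \<Longrightarrow> opnorm \<alpha> (M x) \<le> K * opnorm \<alpha> x" by blast
  show ?thesis
  proof (rule that[of "\<bar>K\<bar>"])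
    fix x assume x: "x \<in> cred \<alpha> \<sigma>"
    have "K * opnorm \<alpha> x \<le> \<bar>K\<bar> * opnorm \<alpha> x"
      using opnorm_nonneg[OF cred_adjointable[OF x]] by (intro mult_right_mono) auto
    with K[OF x] show "opnorm \<alpha> (M x) \<le> \<bar>K\<bar> * opnorm \<alpha> x" by linarith
  qed simp
qed

lemma is_mult_map_approximates:
  assumes M: "is_mult_map \<alpha> \<sigma> T M" and x: "x \<in> cred \<alpha> \<sigma>" and y: "y \<in> cred \<alpha> \<sigma>"
    and a: "approximates y e x" "e \<ge> 0" and K: "K \<ge> 0" "\<And>x. x \<in> cred \<alpha> \<sigma> \<Longrightarrow> opnorm \<alpha> (M x) \<le> K * opnorm \<alpha> x"
  shows "approximates (M y) (K * e) (M x)"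
proof -
  have c: "M x \<in> cred \<alpha> \<sigma>" "M y \<in> cred \<alpha> \<sigma>" using M x y by (simp_all add: is_mult_map_def)
  have "opnorm \<alpha> (op_diff (M x) (M y)) \<le> K * opnorm \<alpha> (op_diff x y)"
    using K(2)[OF op_diff_in_cred[OF x y]] is_mult_map_op_diff[OF M x y] by simp
  also have "\<dots> \<le> K * e" using opnorm_op_diff_le[OF a] K(1) by (intro mult_left_mono)
  finally show ?thesis
    using approximates_mono[OF approximates_opnorm[OF cred_adjointable[OF c(2)] cred_adjointable[OF c(1)]]]
    by blast
qed

text \<open>Two bounded maps that agree on the dense set of finitely supported elements agree
  everywhere. This is what allows \<open>M_T\<close>, defined by choice, to be computed.\<close>

lemma is_mult_map_unique:
  assumes M: "is_mult_map \<alpha> \<sigma> T M" and M': "is_mult_map \<alpha> \<sigma> T M'" and x: "x \<in> cred \<alpha> \<sigma>"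
  shows "M x = M' x"
proof -
  obtain K where K: "K \<ge> 0" "\<And>x. x \<in> cred \<alpha> \<sigma> \<Longrightarrow> opnorm \<alpha> (M x) \<le> K * opnorm \<alpha> x"
    using is_mult_map_bounded[OF M] by blast
  obtain K' where K': "K' \<ge> 0" "\<And>x. x \<in> cred \<alpha> \<sigma> \<Longrightarrow> opnorm \<alpha> (M' x) \<le> K' * opnorm \<alpha> x"
    using is_mult_map_bounded[OF M'] by blast
  have adj: "adjointable \<alpha> (M x)" "adjointable \<alpha> (M' x)"
    using M M' x by (simp_all add: is_mult_map_def cred_adjointable)
  have approx: "approximates (M' x) ((K + K') * e) (M x)" if e: "e > 0" for e
  proof -
    obtain y where y: "y \<in> fin_ops" "approximates y e x" using fin_ops_dense[OF x e] .
    note yc = fin_ops_cred[OF y(1)]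
    have "M y = M' y" using y(1) M M' by (auto simp: is_mult_map_def)
    have adjy: "adjointable \<alpha> (M y)" using M yc by (simp add: is_mult_map_def cred_adjointable)
    have 1: "approximates (M y) (K * e) (M x)"
      by (rule is_mult_map_approximates[OF M x yc y(2) _ K]) (use e in simp_all)
    have "approximates (M' y) (K' * e) (M' x)"
      by (rule is_mult_map_approximates[OF M' x yc y(2) _ K']) (use e in simp_all)
    then have "approximates (M' x) (K' * e) (M y)"
      unfolding \<open>M y = M' y\<close>[symmetric] by (rule approximates_sym[OF _ adjy adj(2)])
    from approximates_trans[OF this 1 adj(2) adjy adj(1)] show ?thesis by (simp add: algebra_simps)
  qed
  show ?thesis
  proof
    fix \<xi>
    show "M x \<xi> = M' x \<xi>"
    proof (cases "\<xi> \<in> modset \<alpha>")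
      case True
      let ?c = "(K + K') * mnorm \<alpha> \<xi> + 1"
      have c: "?c > 0" using K(1) K'(1) by (simp add: add_nonneg_pos)
      have "mnorm \<alpha> (op_diff (M x) (M' x) \<xi>) \<le> 0 + e" if e: "e > 0" for e
      proof -
        have "mnorm \<alpha> (op_diff (M x) (M' x) \<xi>) \<le> (K + K') * (e / ?c) * mnorm \<alpha> \<xi>"
          by (rule approximatesD[OF approx True]) (use e c in simp)
        also have "\<dots> \<le> e" using e c by (simp add: divide_simps)
        finally show ?thesis by simp
      qed
      then have "mnorm \<alpha> (op_diff (M x) (M' x) \<xi>) \<le> 0" by (rule field_le_epsilon)
      then have "mnorm \<alpha> (op_diff (M x) (M' x) \<xi>) = 0"
        using mnorm_nonneg[of "op_diff (M x) (M' x) \<xi>"] by linarith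
      then have "op_diff (M x) (M' x) \<xi> = (\<lambda>_. 0)"
        by (rule mnorm_eq_0D[OF op_diff_modset[OF adj True]])
      then show ?thesis by (auto simp: op_diff_def fun_eq_iff)
    qed (simp add: adjointable_outside[OF adj(1)] adjointable_outside[OF adj(2)])
  qed
qed

text \<open>Reading the multiplier off the Fourier coefficients gives, for finitely supported
  \<phi>, a map on the whole algebra with no extension by continuity.\<close>

definition fin_mult :: "('g \<Rightarrow> real) \<Rightarrow> (('g \<Rightarrow> 'a) \<Rightarrow> ('g \<Rightarrow> 'a)) \<Rightarrow> ('g \<Rightarrow> 'a) \<Rightarrow> ('g \<Rightarrow> 'a)" where
  "fin_mult \<phi> x = Lam \<alpha> \<sigma> (\<lambda>g. \<phi> g *\<^sub>R fourier x g)"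

lemma cc_fun_fin_mult: "finite {g. \<phi> g \<noteq> (0::real)} \<Longrightarrow> cc_fun (\<lambda>g. \<phi> g *\<^sub>R (f g :: 'a))"
  unfolding cc_fun_def by (erule rev_finite_subset) auto

lemma fin_mult_in_fin_ops: "finite {g. \<phi> g \<noteq> 0} \<Longrightarrow> fin_mult \<phi> x \<in> fin_ops"
  by (simp add: fin_mult_def cc_fun_fin_mult)

text \<open>Each Fourier coefficient is bounded by the operator norm, which gives the crude constant
  \<open>\<Sum>g. \<bar>\<phi> g\<bar>\<close>. It only shows that the map is bounded; contractivity
  in the Foelner case needs a separate argument.\<close>

lemma fin_mult_is_mult_map:
  assumes fin: "finite {g. \<phi> g \<noteq> 0}"
  shows "is_mult_map \<alpha> \<sigma> (\<lambda>g a. \<phi> g *\<^sub>R a) (fin_mult \<phi>)"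
  unfolding is_mult_map_def
proof (intro conjI ballI allI impI exI)
  show "fin_mult \<phi> x \<in> cred \<alpha> \<sigma>" for x
    by (rule fin_ops_cred[OF fin_mult_in_fin_ops[OF fin]])
  show "fin_mult \<phi> (op_add x y) = op_add (fin_mult \<phi> x) (fin_mult \<phi> y)" for x y
    unfolding fin_mult_def Lam_add[OF cc_fun_fin_mult[OF fin] cc_fun_fin_mult[OF fin], symmetric]
    by (simp add: fourier_def op_add_def scaleR_add_right)
  show "fin_mult \<phi> (op_scale c x) = op_scale c (fin_mult \<phi> x)" for c x
    unfolding fin_mult_def Lam_cscale[OF cc_fun_fin_mult[OF fin], symmetric]
    by (simp add: fourier_def op_scale_def scaleR_cscale_commute)
  show "fin_mult \<phi> (Lam \<alpha> \<sigma> f) = Lam \<alpha> \<sigma> (Tdot (\<lambda>g a. \<phi> g *\<^sub>R a) f)" if "cc_fun f" for f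
    by (simp add: fin_mult_def fourier_Lam[OF that] Tdot_def)
  fix x assume x: "x \<in> cred \<alpha> \<sigma>"
  have "opnorm \<alpha> (fin_mult \<phi> x) \<le> (\<Sum>g\<in>{g. \<phi> g \<noteq> 0}. norm (\<phi> g *\<^sub>R fourier x g))"
    unfolding fin_mult_def by (rule opnorm_Lam_le[OF fin]) auto
  also have "\<dots> \<le> (\<Sum>g\<in>{g. \<phi> g \<noteq> 0}. \<bar>\<phi> g\<bar> * opnorm \<alpha> x)"
    using norm_fourier_le[OF cred_adjointable[OF x]] by (intro sum_mono) (simp add: mult_left_mono)
  finally show "opnorm \<alpha> (fin_mult \<phi> x) \<le> (\<Sum>g\<in>{g. \<phi> g \<noteq> 0}. \<bar>\<phi> g\<bar>) * opnorm \<alpha> x"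
    by (simp add: sum_distrib_right)
qed

lemma M_T_eq_fin_mult:
  assumes "finite {g. \<phi> g \<noteq> 0}" "x \<in> cred \<alpha> \<sigma>"
  shows "M_T \<alpha> \<sigma> (\<lambda>g a. \<phi> g *\<^sub>R a) x = fin_mult \<phi> x"
  using is_mult_map_unique[OF someI[of "is_mult_map \<alpha> \<sigma> (\<lambda>g a. \<phi> g *\<^sub>R a)"] fin_mult_is_mult_map]
    fin_mult_is_mult_map assms unfolding M_T_def by blast

text \<open>The Fourier partial sums equal x as soon as the index set contains the support.\<close>

lemma fin_ops_CF:
  assumes "x \<in> fin_ops"
  shows "x \<in> CF \<alpha> \<sigma>"
proof -
  obtain f where f: "cc_fun f" "x = Lam \<alpha> \<sigma> f" using assms by auto
  have "opnorm \<alpha> (op_diff (Lam \<alpha> \<sigma> (\<lambda>g. if g \<in> F then fourier x g else 0)) x) < e"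
    if "e > 0" "{g. f g \<noteq> 0} \<subseteq> F" for e F
  proof -
    have "fourier x = f" using fourier_Lam[OF f(1)] f(2) by simp
    then have "(\<lambda>g. if g \<in> F then fourier x g else 0) = f"
      using that(2) by (auto simp: fun_eq_iff)
    then have "opnorm \<alpha> (op_diff (Lam \<alpha> \<sigma> (\<lambda>g. if g \<in> F then fourier x g else 0)) x) \<le> 0"
      unfolding f(2) by (intro opnorm_op_diff_le) (simp_all add: approximates_refl)
    with that(1) show ?thesis by simp
  qed
  then show ?thesis
    using fin_ops_cred[OF assms] fin_ops_adjointable[OF assms] f(1)
    unfolding CF_def mem_Collect_eq cc_fun_def by blast
qed

lemma fin_mult_in_MCF:
  assumes "finite {g. \<phi> g \<noteq> 0}"
  shows "(\<lambda>g a. \<phi> g *\<^sub>R a) \<in> MCF \<alpha> \<sigma>"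
  unfolding MCF_def MA_def mem_Collect_eq
proof (intro conjI ballI)
  show "\<exists>M. is_mult_map \<alpha> \<sigma> (\<lambda>g a. \<phi> g *\<^sub>R a) M" using fin_mult_is_mult_map[OF assms] by blast
  show "M_T \<alpha> \<sigma> (\<lambda>g a. \<phi> g *\<^sub>R a) x \<in> CF \<alpha> \<sigma>" if "x \<in> cred \<alpha> \<sigma>" for x
    unfolding M_T_eq_fin_mult[OF assms that] by (rule fin_ops_CF[OF fin_mult_in_fin_ops[OF assms]])
qed (simp_all add: scaleR_add_right scaleR_cscale_commute)


subsection \<open>Foelner multipliers\<close>

text \<open>For \<open>h \<in> S\<close>, the number of \<open>k\<close> with \<open>h + k \<in> F\<close> and \<open>- g + h + k \<in> F\<close> is \<open>card ((+) g ` F \<inter> F)\<close>,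
  independently of \<open>h\<close>. Hence the multiplier is an average of compressions of \<open>Lam f\<close> to the sets
  \<open>{h. h + k \<in> F}\<close>, each point lying in at most \<open>card F\<close> of them.\<close>

lemma folner_compression:
  fixes F S :: "'g set"
  defines "K \<equiv> (\<Union>h\<in>S. (\<lambda>x. - h + x) ` F)"
  assumes F: "finite F" "F \<noteq> {}" and S: "finite S" and f: "cc_fun f" and m: "\<xi> \<in> modset \<alpha>" and h: "h \<in> S"
    and \<phi>: "\<And>g. \<phi> g = real (card ((+) g ` F \<inter> F)) / real (card F)"
  shows "real (card F) *\<^sub>R Lam \<alpha> \<sigma> (\<lambda>g. \<phi> g *\<^sub>R f g) \<xi> h
    = (\<Sum>k\<in>K. if h + k \<in> F then Lam \<alpha> \<sigma> f (\<lambda>l. if l + k \<in> F then \<xi> l else 0) h else 0)"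
proof -
  have K: "finite K" using F S by (simp add: K_def)
  have c0: "real (card F) \<noteq> 0" using F by simp
  define G where "G = {g. f g \<noteq> 0}"
  have G: "finite G" using f by (simp add: G_def cc_fun_def)
  define U where "U g = f g * (\<alpha> g (\<xi> (- g + h)) * \<sigma> g (- g + h))" for g
  have mk: "(\<lambda>l. if l + k \<in> F then \<xi> l else 0) \<in> modset \<alpha>" for k
    using modset_restrict[OF m, of "{l. l + k \<in> F}"] by simp
  have L: "Lam \<alpha> \<sigma> f (\<lambda>l. if l + k \<in> F then \<xi> l else 0) h = (\<Sum>g\<in>G. if - g + h + k \<in> F then U g else 0)" for k
    unfolding Lam_eq_sum_monom_op[OF G equalityD1[OF G_def[symmetric]]]
    by (rule sum.cong[OF refl]) (simp add: monom_op_apply[OF mk] U_def)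
  have count: "card {k \<in> K. h + k \<in> F \<and> - g + h + k \<in> F} = card ((+) g ` F \<inter> F)" for g
  proof (rule bij_betw_same_card[of "(+) h"], rule bij_betwI[where g="(+) (- h)"])
    show "(+) h \<in> {k \<in> K. h + k \<in> F \<and> - g + h + k \<in> F} \<rightarrow> (+) g ` F \<inter> F"
    proof
      fix k assume k: "k \<in> {k \<in> K. h + k \<in> F \<and> - g + h + k \<in> F}"
      have "h + k = g + (- g + h + k)" by (simp add: add.assoc)
      with k show "h + k \<in> (+) g ` F \<inter> F" by blast
    qed
    \<comment> \<open>Surjectivity uses that h lies in S: then K contains every k with
      \<open>h + k \<in> F\<close>.\<close>
    show "(+) (- h) \<in> (+) g ` F \<inter> F \<rightarrow> {k \<in> K. h + k \<in> F \<and> - g + h + k \<in> F}"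
      using h by (auto simp: K_def add.assoc intro!: bexI[of _ h])
  qed (simp_all add: add.assoc[symmetric])
  have "(\<Sum>k\<in>K. if h + k \<in> F then Lam \<alpha> \<sigma> f (\<lambda>l. if l + k \<in> F then \<xi> l else 0) h else 0)
      = (\<Sum>k\<in>K. \<Sum>g\<in>G. if h + k \<in> F \<and> - g + h + k \<in> F then U g else 0)"
    by (rule sum.cong[OF refl]) (simp add: L)
  also have "\<dots> = (\<Sum>g\<in>G. \<Sum>k\<in>K. if h + k \<in> F \<and> - g + h + k \<in> F then U g else 0)"
    by (rule sum.swap)
  also have "\<dots> = (\<Sum>g\<in>G. real (card ((+) g ` F \<inter> F)) *\<^sub>R U g)"
    using K by (simp add: sum.inter_filter[symmetric] scaleR_conv_of_real count)
  also have "\<dots> = real (card F) *\<^sub>R (\<Sum>g\<in>G. \<phi> g *\<^sub>R U g)"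
    using c0 by (simp add: scaleR_sum_right \<phi>)
  also have "(\<Sum>g\<in>G. \<phi> g *\<^sub>R U g) = Lam \<alpha> \<sigma> (\<lambda>g. \<phi> g *\<^sub>R f g) \<xi> h"
  proof -
    have "{g. \<phi> g *\<^sub>R f g \<noteq> 0} \<subseteq> G" by (auto simp: G_def)
    from Lam_eq_sum_monom_op[OF G this] show ?thesis by (simp add: monom_op_apply[OF m] U_def)
  qed
  finally show ?thesis by simp
qed

text \<open>Let \<zeta> be the image of \<xi> and Q its inner square over a finite S. The
  compression formula writes n Q, with n the size of F, as the sum over k of
  \<open>\<langle>u k, v k\<rangle>\<close>, where \<open>u k\<close> is the operator applied to the
  k-th truncation of \<xi> and \<open>v k\<close> is the k-th truncation of \<zeta> on S. By
  Cauchy-Schwarz the square of \<open>n * norm Q\<close> is at most C^2 n \<open>norm \<xi>\<close>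
  squared times \<open>n * norm Q\<close>; cancelling n^2 and one factor \<open>norm Q\<close>
  leaves the claim.\<close>

theorem folner_multiplier_contractive:
  fixes F :: "'g set"
  assumes F: "finite F" "F \<noteq> {}" and f: "cc_fun f"
    and \<phi>: "\<And>g. \<phi> g = real (card ((+) g ` F \<inter> F)) / real (card F)"
    and C: "C \<ge> 0" "\<And>\<xi>. \<xi> \<in> modset \<alpha> \<Longrightarrow> mnorm \<alpha> (Lam \<alpha> \<sigma> f \<xi>) \<le> C * mnorm \<alpha> \<xi>"
    and m: "\<xi> \<in> modset \<alpha>"
  shows "mnorm \<alpha> (Lam \<alpha> \<sigma> (\<lambda>g. \<phi> g *\<^sub>R f g) \<xi>) \<le> C * mnorm \<alpha> \<xi>"
proof -
  let ?T = "Lam \<alpha> \<sigma> f"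
  define n where "n = card F"
  have n: "real n > 0" using F by (simp add: n_def card_gt_0_iff)
  have T: "adjointable \<alpha> ?T" using f by (intro fin_ops_adjointable) simp
  have "{g. \<phi> g *\<^sub>R f g \<noteq> 0} \<subseteq> {g. f g \<noteq> 0}" by auto
  then have "cc_fun (\<lambda>g. \<phi> g *\<^sub>R f g)" using f unfolding cc_fun_def by (rule finite_subset)
  then have adj: "adjointable \<alpha> (Lam \<alpha> \<sigma> (\<lambda>g. \<phi> g *\<^sub>R f g))" by (intro fin_ops_adjointable) simp
  define \<zeta> where "\<zeta> = Lam \<alpha> \<sigma> (\<lambda>g. \<phi> g *\<^sub>R f g) \<xi>"
  have z: "\<zeta> \<in> modset \<alpha>" unfolding \<zeta>_def by (rule adjointable_modset[OF adj m])
  have "norm (to_l2 \<zeta>) \<le> C * norm (to_l2 \<xi>)"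
  proof (rule norm_l2_le)
    fix S :: "'g set" assume S: "finite S"
    \<comment> \<open>Only translates meeting S matter, so testing on a finite S keeps the average
      finite even when the group is infinite.\<close>
    define K where "K = (\<Union>h\<in>S. (\<lambda>x. - h + x) ` F)"
    have K: "finite K" using F S by (simp add: K_def)
    define B where "B k = {h. h + k \<in> F}" for k
    have B: "card {k \<in> K. h \<in> B k} \<le> n" for h
      unfolding n_def
      by (rule card_inj_on_le[of "(+) h"]) (use F in \<open>auto simp: B_def inj_on_def\<close>)
    define x where "x = to_l2 \<xi>"
    define y where "y = l2_restrict S (to_l2 \<zeta>)"
    define u where "u k = lift ?T (l2_restrict (B k) x)" for k
    define v where "v k = l2_restrict (B k) y" for k
    define Q where "Q = (\<Sum>h\<in>S. cstar (\<beta> h (\<zeta> h)) * \<beta> h (\<zeta> h))"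
    have yy: "l2_inner y y = Q"
      unfolding Q_def by (subst l2_inner_finite[OF S]) (simp_all add: y_def l2_restrict.rep_eq z)
    have u_fun: "l2_fun (u k) h = \<beta> h (?T (\<lambda>l. if l + k \<in> F then \<xi> l else 0) h)" for k h
    proof -
      have mk: "(\<lambda>l. if l + k \<in> F then \<xi> l else 0) \<in> modset \<alpha>"
        using modset_restrict[OF m, of "{l. l + k \<in> F}"] by simp
      have "l2_restrict (B k) x = to_l2 (\<lambda>l. if l + k \<in> F then \<xi> l else 0)"
        using to_l2_restrict[OF m, of "B k"] by (simp add: x_def B_def)
      then show ?thesis
        using adjointable_modset[OF T mk] by (simp add: u_def to_l2_op[OF T mk, symmetric])
    qed
    have uv: "(\<Sum>k\<in>K. l2_inner (u k) (v k)) = real n *\<^sub>R Q"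
    proof -
      have "l2_inner (u k) (v k) = (\<Sum>h\<in>S. cstar (\<beta> h (if h + k \<in> F then
          ?T (\<lambda>l. if l + k \<in> F then \<xi> l else 0) h else 0)) * \<beta> h (\<zeta> h))" for k
        by (subst l2_inner_finite[OF S])
          (auto simp: v_def y_def B_def l2_restrict.rep_eq z u_fun intro!: sum.cong)
      then have "(\<Sum>k\<in>K. l2_inner (u k) (v k)) = (\<Sum>h\<in>S. \<Sum>k\<in>K. cstar (\<beta> h (if h + k \<in> F then
          ?T (\<lambda>l. if l + k \<in> F then \<xi> l else 0) h else 0)) * \<beta> h (\<zeta> h))"
        by (simp only: sum.swap[of _ K S])
      also have "\<dots> = (\<Sum>h\<in>S. cstar (\<beta> h (real n *\<^sub>R \<zeta> h)) * \<beta> h (\<zeta> h))"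
      proof (rule sum.cong[OF refl])
        fix h assume h: "h \<in> S"
        show "(\<Sum>k\<in>K. cstar (\<beta> h (if h + k \<in> F then
            ?T (\<lambda>l. if l + k \<in> F then \<xi> l else 0) h else 0)) * \<beta> h (\<zeta> h))
            = cstar (\<beta> h (real n *\<^sub>R \<zeta> h)) * \<beta> h (\<zeta> h)"
          unfolding \<zeta>_def n_def folner_compression[OF F S f m h \<phi>, folded K_def] cstar_aut_sum[OF aut_inv]
            cstar_sum sum_distrib_right ..
      qed
      finally show ?thesis by (simp add: Q_def scaleR_sum_right)
    qed
    have uu: "norm (\<Sum>k\<in>K. l2_inner (u k) (u k)) \<le> C\<^sup>2 * (real n * (norm x)\<^sup>2)"
    proof -
      obtain T' where T': "l2_adjoint T' (lift ?T)" using adjointable_l2_adjoint[OF T] .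
      have bT: "norm (lift ?T w) \<le> C * norm w" for w
        using C(2)[of "of_l2 w"] by (simp add: lift_def mnorm_eq adjointable_modset[OF T])
      let ?r = "\<lambda>k. l2_inner (l2_restrict (B k) x) (l2_restrict (B k) x)"
      \<comment> \<open>Here the A-valued bound is essential: the truncations of \<xi> overlap at
        most n times in the order of A, whereas the sum of their squared norms has no such
        bound.\<close>
      have "cpos (\<Sum>k\<in>K. C\<^sup>2 *\<^sub>R ?r k - l2_inner (u k) (u k))"
        unfolding u_def by (rule cpos_sum) (rule l2_adjoint_inner_le[OF T' C(1) bT])
      moreover have "cpos (C\<^sup>2 *\<^sub>R (real n *\<^sub>R l2_inner x x - (\<Sum>k\<in>K. ?r k)))"
        by (rule cpos_scaleR[OF _ l2_restrict_sum_inner_le[OF K B]]) simp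
      ultimately have "cpos ((\<Sum>k\<in>K. C\<^sup>2 *\<^sub>R ?r k - l2_inner (u k) (u k))
          + C\<^sup>2 *\<^sub>R (real n *\<^sub>R l2_inner x x - (\<Sum>k\<in>K. ?r k)))"
        by (rule cpos_add)
      then have "cpos (C\<^sup>2 *\<^sub>R real n *\<^sub>R l2_inner x x - (\<Sum>k\<in>K. l2_inner (u k) (u k)))"
        by (simp add: sum_subtractf scaleR_sum_right algebra_simps)
      from norm_mono_cpos[OF cpos_sum[OF l2_inner_self_cpos] this] show ?thesis
        by (simp add: norm_l2_power2)
    qed
    have vv: "norm (\<Sum>k\<in>K. l2_inner (v k) (v k)) \<le> real n * norm Q"
      using norm_mono_cpos[OF cpos_sum[OF l2_inner_self_cpos] l2_restrict_sum_inner_le[OF K B, of y]]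
      by (simp add: v_def yy)
    have "(norm (\<Sum>k\<in>K. l2_inner (u k) (v k)))\<^sup>2 \<le> (C\<^sup>2 * (real n * (norm x)\<^sup>2)) * (real n * norm Q)"
      by (rule order_trans[OF l2_sum_cauchy_schwarz mult_mono[OF uu vv]]) simp_all
    then have "(real n)\<^sup>2 * (norm Q)\<^sup>2 \<le> (real n)\<^sup>2 * ((C * norm x)\<^sup>2 * norm Q)"
      by (simp add: uv power_mult_distrib power2_eq_square ac_simps)
    then have "norm Q * norm Q \<le> (C * norm x)\<^sup>2 * norm Q"
      using n by (simp add: power2_eq_square)
    then have "norm Q \<le> (C * norm x)\<^sup>2"
      by (cases "norm Q = 0") (simp_all add: mult_le_cancel_right)
    then have "(fnorm S (l2_fun (to_l2 \<zeta>)))\<^sup>2 \<le> (C * norm x)\<^sup>2"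
      by (simp add: fnorm_power2 Q_def z)
    then show "fnorm S (l2_fun (to_l2 \<zeta>)) \<le> C * norm (to_l2 \<xi>)"
      unfolding x_def by (rule power2_le_imp_le) (simp add: C(1))
  qed
  then show ?thesis using m z by (simp add: mnorm_eq \<zeta>_def)
qed

end

section \<open>Coefficients of a Foelner net\<close>

text \<open>Directedness merges finitely many thresholds into one.\<close>

lemma net_tendsto0_finite:
  assumes "directed le" "finite G" "\<And>g. g \<in> G \<Longrightarrow> net_tendsto0 le (r g)" "e > 0"
  shows "\<exists>i0. \<forall>i. le i0 i \<longrightarrow> (\<forall>g\<in>G. \<bar>r g i\<bar> < e)"
  using assms(2,3)
proof (induction G)
  case (insert g G)
  then obtain i1 where i1: "\<And>i. le i1 i \<Longrightarrow> \<forall>g\<in>G. \<bar>r g i\<bar> < e" by auto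
  obtain i2 where i2: "\<And>i. le i2 i \<Longrightarrow> \<bar>r g i\<bar> < e"
    using insert.prems[of g] assms(4) by (auto simp: net_tendsto0_def)
  obtain i0 where "le i1 i0" "le i2 i0" using assms(1) unfolding directed_def by blast
  then have "le i1 i \<and> le i2 i" if "le i0 i" for i
    using that assms(1) unfolding directed_def by blast
  with i1 i2 show ?case by (intro exI[of _ i0]) auto
qed simp

definition folner_coeff :: "'g::group_add set \<Rightarrow> 'g \<Rightarrow> real" where
  "folner_coeff F g = real (card ((+) g ` F \<inter> F)) / real (card F)"

text \<open>A nonzero coefficient means that F meets its translate by g, so g is a difference of two
  elements of F.\<close>

lemma folner_coeff_finite_support:
  assumes "finite F"
  shows "finite {g. folner_coeff F g \<noteq> 0}"
proof (rule finite_subset)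
  show "{g. folner_coeff F g \<noteq> 0} \<subseteq> (\<lambda>(x, y). x - y) ` (F \<times> F)"
  proof
    fix g assume "g \<in> {g. folner_coeff F g \<noteq> 0}"
    then have "(+) g ` F \<inter> F \<noteq> {}" by (metis (mono_tags) card.empty div_0 folner_coeff_def mem_Collect_eq of_nat_0)
    then obtain y where "y \<in> F" "g + y \<in> F" by blast
    then show "g \<in> (\<lambda>(x, y). x - y) ` (F \<times> F)" by (intro image_eqI[of _ _ "(g + y, y)"]) auto
  qed
qed (use assms in simp)

lemma folner_coeff_zero: "finite F \<Longrightarrow> F \<noteq> {} \<Longrightarrow> folner_coeff F 0 = 1"
  by (simp add: folner_coeff_def)

text \<open>The defect from 1 is exactly the share of F outside its translate, one half of the
  symmetric difference in the Foelner condition.\<close>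

lemma abs_folner_coeff_minus_one_le:
  assumes "finite F" "F \<noteq> {}"
  shows "\<bar>folner_coeff F g - 1\<bar>
    \<le> real (card (((+) g ` F - F) \<union> (F - (+) g ` F))) / real (card F)"
proof -
  have c: "real (card F) > 0" using assms by (simp add: card_gt_0_iff)
  have "card F = card ((+) g ` F \<inter> F) + card (F - (+) g ` F)"
    using card_Int_Diff[OF assms(1), of "(+) g ` F"] by (simp add: Int_commute)
  then have "folner_coeff F g - 1 = - (real (card (F - (+) g ` F)) / real (card F))"
    using c by (simp add: folner_coeff_def field_simps)
  moreover have "card (F - (+) g ` F) \<le> card (((+) g ` F - F) \<union> (F - (+) g ` F))"
    using assms by (intro card_mono) auto
  ultimately show ?thesis using c by (simp add: divide_right_mono)
qed

section \<open>Norm and convergence of the Foelner multipliers on the reduced crossed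
  product\<close>

context twisted
begin

lemma opnorm_le_of_approximates:
  assumes "approximates S e T" "e \<ge> 0" "adjointable \<alpha> S" "adjointable \<alpha> T"
  shows "opnorm \<alpha> T \<le> opnorm \<alpha> S + e"
proof (rule opnorm_le)
  fix \<xi> assume m: "\<xi> \<in> modset \<alpha>"
  have "T \<xi> = (\<lambda>h. S \<xi> h + op_diff T S \<xi> h)" by (simp add: op_diff_def)
  then have "mnorm \<alpha> (T \<xi>) \<le> mnorm \<alpha> (S \<xi>) + mnorm \<alpha> (op_diff T S \<xi>)"
    using mnorm_add_le[OF adjointable_modset[OF assms(3) m] op_diff_modset[OF assms(4,3) m]] by simp
  with mnorm_le_opnorm[OF assms(3) m] approximatesD[OF assms(1) m]
  show "mnorm \<alpha> (T \<xi>) \<le> (opnorm \<alpha> S + e) * mnorm \<alpha> \<xi>" by (simp add: algebra_simps)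
qed (use opnorm_nonneg[OF assms(3)] assms(2) in simp)

text \<open>The crude constant K of the multiplier map only multiplies the approximation error e, so
  it disappears as e tends to 0 and the constant 1 from the finitely supported elements
  remains.\<close>

lemma folner_fin_mult_contractive:
  assumes F: "finite F" "F \<noteq> {}" and x: "x \<in> cred \<alpha> \<sigma>"
  shows "opnorm \<alpha> (fin_mult (folner_coeff F) x) \<le> opnorm \<alpha> x"
proof -
  let ?M = "fin_mult (folner_coeff F)"
  note fin = folner_coeff_finite_support[OF F(1)]
  note M = fin_mult_is_mult_map[OF fin]
  have adjM: "adjointable \<alpha> (?M y)" for y
    by (rule fin_ops_adjointable[OF fin_mult_in_fin_ops[OF fin]])
  obtain K where K: "K \<ge> 0" "\<And>x. x \<in> cred \<alpha> \<sigma> \<Longrightarrow> opnorm \<alpha> (?M x) \<le> K * opnorm \<alpha> x"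
    using is_mult_map_bounded[OF M] by blast
  have "opnorm \<alpha> (?M x) \<le> opnorm \<alpha> x + (1 + K) * e" if e: "e > 0" for e
  proof -
    obtain y where y: "y \<in> fin_ops" "approximates y e x" using fin_ops_dense[OF x e] .
    then obtain f where f: "cc_fun f" "y = Lam \<alpha> \<sigma> f" by auto
    note yc = fin_ops_cred[OF y(1)]
    note adj = fin_ops_adjointable[OF y(1)] cred_adjointable[OF x]
    have "opnorm \<alpha> (?M x) \<le> opnorm \<alpha> (?M y) + K * e"
      using is_mult_map_approximates[OF M x yc y(2) _ K] e K(1)
      by (intro opnorm_le_of_approximates adjM) simp_all
    also have "opnorm \<alpha> (?M y) \<le> opnorm \<alpha> y"
    proof (rule opnorm_le)
      fix \<xi> assume "\<xi> \<in> modset \<alpha>"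
      then show "mnorm \<alpha> (?M y \<xi>) \<le> opnorm \<alpha> y * mnorm \<alpha> \<xi>"
        using folner_multiplier_contractive[OF F f(1) folner_coeff_def opnorm_nonneg[OF adj(1)]]
          mnorm_le_opnorm[OF adj(1)] by (simp add: f fin_mult_def fourier_Lam[OF f(1)])
    qed (rule opnorm_nonneg[OF adj(1)])
    also have "opnorm \<alpha> y \<le> opnorm \<alpha> x + e"
      using approximates_sym[OF y(2) adj] e adj by (intro opnorm_le_of_approximates) simp_all
    finally show ?thesis by (simp add: algebra_simps)
  qed
  note bound = this
  show ?thesis
  proof (rule field_le_epsilon)
    fix e :: real assume "e > 0"
    then show "opnorm \<alpha> (?M x) \<le> opnorm \<alpha> x + e"
      using bound[of "e / (1 + K)"] K(1) by (simp add: add_pos_nonneg)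
  qed
qed

lemma op_diff_Lam:
  assumes "cc_fun f" "cc_fun f'"
  shows "op_diff (Lam \<alpha> \<sigma> f) (Lam \<alpha> \<sigma> f') = Lam \<alpha> \<sigma> (\<lambda>g. f g - f' g)"
  unfolding op_diff_eq Lam_cscale[OF assms(2), symmetric]
    Lam_add[OF assms(1) cc_fun_cscale[OF assms(2)], symmetric]
  by (simp add: cscale_minus_one)

text \<open>The bound 1 is attained at the identity operator
  \<open>Lam \<alpha> \<sigma> xi0\<close>, which every Foelner multiplier fixes because its
  coefficient at the neutral element is 1.\<close>

lemma tnorm_folner:
  assumes F: "finite F" "F \<noteq> {}"
  shows "tnorm \<alpha> \<sigma> (\<lambda>g a. folner_coeff F g *\<^sub>R a) = 1"
proof -
  note fin = folner_coeff_finite_support[OF F(1)]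
  let ?one = "Lam \<alpha> \<sigma> xi0"
  have cc: "cc_fun (xi0 :: 'g \<Rightarrow> 'a)" by (simp add: cc_fun_def xi0_def)
  have one: "?one \<in> cred \<alpha> \<sigma>" using cc by (intro fin_ops_cred) simp
  have "opnorm \<alpha> ?one \<le> (\<Sum>g\<in>{0::'g}. norm (xi0 g :: 'a))"
    by (rule opnorm_Lam_le) (auto simp: xi0_def)
  moreover have "norm (fourier ?one 0) \<le> opnorm \<alpha> ?one"
    by (rule norm_fourier_le[OF cred_adjointable[OF one]])
  moreover have "(xi0 :: 'g \<Rightarrow> 'a) 0 = 1" by (simp add: xi0_def)
  ultimately have n1: "opnorm \<alpha> ?one = 1" by (simp add: fourier_Lam[OF cc])
  have "(\<lambda>g. folner_coeff F g *\<^sub>R xi0 g) = (xi0 :: 'g \<Rightarrow> 'a)"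
    by (auto simp: xi0_def folner_coeff_zero[OF F])
  then have M1: "fin_mult (folner_coeff F) ?one = ?one"
    by (simp add: fin_mult_def fourier_Lam[OF cc])
  show ?thesis
    unfolding tnorm_def
  proof (rule cSup_eq_maximum)
    show "1 \<in> (\<lambda>x. opnorm \<alpha> (M_T \<alpha> \<sigma> (\<lambda>g a. folner_coeff F g *\<^sub>R a) x)) ` {x \<in> cred \<alpha> \<sigma>. opnorm \<alpha> x \<le> 1}"
      using one n1 M1 M_T_eq_fin_mult[OF fin one] by (intro image_eqI[of _ _ ?one]) simp_all
    fix t assume "t \<in> (\<lambda>x. opnorm \<alpha> (M_T \<alpha> \<sigma> (\<lambda>g a. folner_coeff F g *\<^sub>R a) x)) ` {x \<in> cred \<alpha> \<sigma>. opnorm \<alpha> x \<le> 1}"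
    then obtain x where x: "x \<in> cred \<alpha> \<sigma>" "opnorm \<alpha> x \<le> 1"
      and t: "t = opnorm \<alpha> (M_T \<alpha> \<sigma> (\<lambda>g a. folner_coeff F g *\<^sub>R a) x)" by auto
    show "t \<le> 1"
      using folner_fin_mult_contractive[OF F x(1)] x(2) by (simp add: t M_T_eq_fin_mult[OF fin x(1)])
  qed
qed

lemma folner_net_converges:
  assumes net: "folner_net le F" and x: "x \<in> cred \<alpha> \<sigma>"
  shows "net_tendsto0 le (\<lambda>i. opnorm \<alpha> (op_diff (fin_mult (folner_coeff (F i)) x) x))"
  unfolding net_tendsto0_def
proof (intro allI impI)
  fix e :: real assume e: "e > 0"
  have F: "finite (F i)" "F i \<noteq> {}" for i using net by (auto simp: folner_net_def)
  \<comment> \<open>Three errors of size e/4 stay strictly below e.\<close>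
  have e4: "e / 4 > 0" using e by simp
  obtain y where y: "y \<in> fin_ops" "approximates y (e / 4) x" using fin_ops_dense[OF x e4] .
  then obtain f where f: "cc_fun f" "y = Lam \<alpha> \<sigma> f" by auto
  define G where "G = {g. f g \<noteq> 0}"
  have G: "finite G" using f by (simp add: G_def cc_fun_def)
  \<comment> \<open>The added 1 keeps c positive when f vanishes; the total error is then e/(4c)
    times c - 1.\<close>
  define c where "c = (\<Sum>g\<in>G. norm (f g)) + 1"
  have c: "c > 0" unfolding c_def by (rule add_nonneg_pos[OF sum_nonneg]) simp_all
  define r where "r g i = real (card (((+) g ` F i - F i) \<union> (F i - (+) g ` F i))) / real (card (F i))" for g i
  have "directed le" "\<And>g. net_tendsto0 le (r g)"
    using net unfolding folner_net_def r_def by simp_all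
  then obtain i0 where i0: "\<And>i g. le i0 i \<Longrightarrow> g \<in> G \<Longrightarrow> \<bar>r g i\<bar> < e / 4 / c"
    using net_tendsto0_finite[of le G r "e / 4 / c"] G e c by auto
  have "\<bar>opnorm \<alpha> (op_diff (fin_mult (folner_coeff (F i)) x) x)\<bar> < e" if i: "le i0 i" for i
  proof -
    let ?M = "fin_mult (folner_coeff (F i))"
    note fin = folner_coeff_finite_support[OF F(1)[of i]]
    have adjM: "adjointable \<alpha> (?M w)" for w
      by (rule fin_ops_adjointable[OF fin_mult_in_fin_ops[OF fin]])
    note adj = fin_ops_adjointable[OF y(1)] cred_adjointable[OF x]
    \<comment> \<open>The factor 1 is the contraction constant, uniform in i; the sum of the
      coefficients of \<phi> would not serve as a uniform bound.\<close>
    have "approximates (?M y) (1 * (e / 4)) (?M x)"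
      by (rule is_mult_map_approximates[OF fin_mult_is_mult_map[OF fin] x fin_ops_cred[OF y(1)] y(2)])
        (use e folner_fin_mult_contractive[OF F] in simp_all)
    then have 1: "approximates (?M y) (e / 4) (?M x)" by simp
    have "opnorm \<alpha> (op_diff (?M y) y) \<le> (\<Sum>g\<in>G. norm (folner_coeff (F i) g *\<^sub>R f g - f g))"
      unfolding f(2) fin_mult_def fourier_Lam[OF f(1)] op_diff_Lam[OF cc_fun_fin_mult[OF fin] f(1)]
      by (rule opnorm_Lam_le[OF G]) (auto simp: G_def)
    also have "\<dots> \<le> (\<Sum>g\<in>G. e / 4 / c * norm (f g))"
    proof (rule sum_mono)
      fix g assume g: "g \<in> G"
      have "norm (folner_coeff (F i) g *\<^sub>R f g - f g) = \<bar>folner_coeff (F i) g - 1\<bar> * norm (f g)"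
        by (metis norm_scaleR scaleR_left_diff_distrib scaleR_one)
      also have "\<bar>folner_coeff (F i) g - 1\<bar> \<le> e / 4 / c"
        using abs_folner_coeff_minus_one_le[OF F, of i g] i0[OF i g] by (simp add: r_def)
      finally show "norm (folner_coeff (F i) g *\<^sub>R f g - f g) \<le> e / 4 / c * norm (f g)"
        by (simp add: mult_right_mono)
    qed
    also have "\<dots> = e / 4 / c * (c - 1)" by (simp add: c_def sum_distrib_left)
    also have "\<dots> \<le> e / 4" using c e by (simp add: field_simps)
    finally have 2: "approximates y (e / 4) (?M y)"
      by (rule approximates_mono[OF approximates_opnorm[OF adj(1) adjM]])
    have 3: "approximates x (e / 4) y" by (rule approximates_sym[OF y(2) adj])
    have "approximates x (e / 4 + e / 4 + e / 4) (?M x)"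
      by (rule approximates_trans[OF approximates_trans[OF 3 2 adj(2,1) adjM] 1 adj(2) adjM adjM])
    then have "opnorm \<alpha> (op_diff (?M x) x) \<le> e / 4 + e / 4 + e / 4"
      by (rule opnorm_op_diff_le) (use e in simp)
    moreover have "opnorm \<alpha> (op_diff (?M x) x) \<ge> 0"
      by (rule opnorm_nonneg[OF adjointable_op_diff[OF adjM adj(2)]])
    ultimately show ?thesis using e by simp
  qed
  then show "\<exists>i0. \<forall>i. le i0 i \<longrightarrow> \<bar>opnorm \<alpha> (op_diff (fin_mult (folner_coeff (F i)) x) x)\<bar> < e" by blast
qed

end

section \<open>The Foelner multipliers as a bounded Fourier summing net\<close>

theorem theorem5p6:
  fixes \<alpha> :: "'g::group_add \<Rightarrow> 'a::unital_cstar \<Rightarrow> 'a" and \<sigma> :: "'g \<Rightarrow> 'g \<Rightarrow> 'a"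
    and le :: "'i \<Rightarrow> 'i \<Rightarrow> bool" and F :: "'i \<Rightarrow> 'g set"
    and T :: "'i \<Rightarrow> 'g \<Rightarrow> 'a \<Rightarrow> 'a"
  assumes "twisted_system \<alpha> \<sigma>"
    and "amenable_group TYPE('g)"
    and "folner_net le F"
    and "\<And>i g a. T i g a = scaleR (real (card (((+) g) ` F i \<inter> F i)) / real (card (F i))) a"
  shows "fourier_summing_net \<alpha> \<sigma> le T \<and> (\<forall>i. finite_G_support (T i))
         \<and> (\<forall>i. tnorm \<alpha> \<sigma> (T i) = 1) \<and> bounded_fejer TYPE('i) \<alpha> \<sigma>"
proof -
  interpret twisted \<alpha> \<sigma> by unfold_locales (rule assms(1))
  have F: "finite (F i)" "F i \<noteq> {}" for i using assms(3) by (auto simp: folner_net_def)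
  note fin = folner_coeff_finite_support[OF F(1)]
  have T: "T i = (\<lambda>g a. folner_coeff (F i) g *\<^sub>R a)" for i
    by (simp add: fun_eq_iff assms(4) folner_coeff_def)
  have "directed le" using assms(3) by (simp add: folner_net_def)
  then have sum: "fourier_summing_net \<alpha> \<sigma> le T"
    unfolding fourier_summing_net_def T
    using fin_mult_in_MCF[OF fin] folner_net_converges[OF assms(3)] M_T_eq_fin_mult[OF fin] by simp
  have supp: "finite_G_support (T i)" for i
    unfolding finite_G_support_def T
    by (rule finite_subset[OF _ fin[of i]]) (auto simp: fun_eq_iff)
  have norm: "tnorm \<alpha> \<sigma> (T i) = 1" for i
    unfolding T by (rule tnorm_folner[OF F])
  \<comment> \<open>The net itself is the witness, with bound 1.\<close>
  have "bounded_fejer TYPE('i) \<alpha> \<sigma>"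
    unfolding bounded_fejer_def bounded_mult_net_def using sum supp norm
    by (intro exI[of _ le] exI[of _ T] conjI allI exI[of _ 1]) simp_all
  with sum supp norm show ?thesis by blast
qed

end
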